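(* Consider a regular latent position network model (LPM) on $S\subseteq\mathbb{R}^d$ with link probability function $K$ and bounding function $G$, and suppose it is $e(n)$-sparse in expectation. Let $$\alpha^K_n=\sup_{0< x\le 2G(n)}\frac{|K'(x)|}{|x|K(x)\epsilon},\qquad \beta^K_n=\sup_{0< x\le 2G(n)}\frac{x^2K(x)}{K'(x)^2},$$ where $\epsilon>0$ is such that $K\le 1-\epsilon$. Then the LPM has: 1. learnable link probabilities if $\alpha^K_n\,e(n)^{-1}n^{1.5}G(n)^2\to0$ as $n\to\infty$; 2. learnable squared distances if $\beta^K_n\alpha^K_n n^{-0.5}G(n)^2\to0$ as $n\to\infty$; 3. learnable latent positions if it possesses $a(n)$-$b(n)$ distinctly bunched eigenvalues with $$\frac{a(n)}{n}\to0\quad\text{and}\quad\frac{\beta^K_n\alpha^K_n n^{0.5}G(n)^2}{b(n)}\to0\quad\text{as } n\to\infty.$$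
   Context: $\mathbb{R}_+=[0,\infty)$. LPM: for each $n$, nodes $1,\dots,n$ have random latent positions $Z_1,\dots,Z_n\in S\subseteq\mathbb{R}^d$ (forming the rows of $Z\in\mathbb{R}^{n\times d}$), and conditional on them $Y^n\in\{0,1\}^{n\times n}$ is a symmetric zero-diagonal adjacency matrix whose entries $Y^n_{ij}$, $i<j$, are independent with $\mathbb{P}(Y^n_{ij}=1\mid Z)=K(\|Z_i-Z_j\|)$, where $K:\mathbb{R}_+\to[0,1]$ does not depend on $n$. Regular LPM: (1) $K$ is known, monotonically decreasing, differentiable, and upper bounded by $1-\epsilon$ for some $\epsilon>0$; (2) $S\subseteq\mathbb{R}^d$; (3) there is a known differentiable function $G(n)$ such that $\mathbb{P}(\max_{1\le i\le n}\|Z_i\|\le G(n))\to1$ as $n\to\infty$. $e(n)$-sparse in expectation: $\lim_{n\to\infty}\mathbb{E}\big(\sum_{i,j=1}^nY^n_{ij}/e(n)\big)=C$ for some constant $C\in(0,\infty)$. For $z\in\mathbb{R}^{n\times d}$ with rows $z_i$, $D^z\in\mathbb{R}^{n\times n}$ has entries $D^z_{ij}=\|z_i-z_j\|^2$ and $P^z\in[0,1]^{n\times n}$ has entries $P^z_{ij}=K(\|z_i-z_j\|)$. $\|\cdot\|_F$ is the Frobenius norm, $\mathcal{O}_d$ the set of $d\times d$ orthogonal matrices, and $\mathcal{Q}_{nd}$ the set of $n\times d$ real matrices all of whose rows are identical. The suprema $\alpha^K_n,\beta^K_n$ take values in $[0,\infty]$. Learnability: an estimator is a function $\hat Z(Y^n)\in\mathbb{R}^{n\times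 d}$ of the adjacency matrix (it may use the known $K$, $G$, $d$). The LPM has learnable latent positions if there is an estimator with $\inf_{O\in\mathcal{O}_d,\,Q\in\mathcal{Q}_{nd}}\|\hat Z(Y^n)O-Q-Z\|_F^2/n\to0$ in probability; learnable squared distances if there is an estimator with $\|D^{\hat Z(Y^n)}-D^Z\|_F^2/n^2\to0$ in probability; and, when it is $e(n)$-sparse in expectation, learnable link probabilities if there is an estimator with $\|P^{\hat Z(Y^n)}-P^Z\|_F^2/e(n)\to0$ in probability. Distinctly bunched eigenvalues: let $\mathcal{C}_n=I_n-\frac1n1_n1_n^T$, where $I_n$ is the identity and $1_n$ the $n\times1$ vector of ones. Let $\lambda_1\ge\cdots\ge\lambda_d$ denote the $d$ nonzero eigenvalues of $\mathcal{C}_nZZ^T\mathcal{C}_n$ and set $\lambda_{d+1}:=0$ (these depend on $n$ and $Z$). For functions $a,b:\mathbb{N}\to\mathbb{R}$, the LPM possesses $a(n)$-$b(n)$ distinctly bunched eigenvalues if there exist $k\in\{1,\dots,d\}$ and integers $1=i_1<i_2<\cdots<i_k<i_{k+1}=d+1$ such that (for all $n>d$) $$\frac{(\lambda_{i_{j+1}-1}-\lambda_{i_j})^2}{\lambda_{i_{j+1}-1}}\le a(n)\quad\text{and}\quad\frac{(\lambda_{i_{j+1}-1}-\lambda_{i_{j+1}})^2}{\lambda_{i_j}}\ge b(n)\quad\text{for all }j\in\{1,\dots,k\}.$$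
   Formalization: The bound b(n) is in effect required to be positive for large n (claim 3 fails for negative b, which makes the separation condition empty), and β is required to be eventually finite in claims 2 and 3, excluding only the undefined product 0·∞ when K is constant on the range. *)

theory Defs
  imports "HOL-Probability.Probability" "Jordan_Normal_Form.Char_Poly"
begin

section \<open>Latent position network models\<close>

text \<open>
  The \<open>n\<close> nodes are numbered \<open>0, \<dots>, n - 1\<close>.  An \<open>n \<times> d\<close> matrix of positions is given by its rows
  \<open>z i :: real ^ 'd\<close> for \<open>i < n\<close>; values of \<open>z\<close> at \<open>i \<ge> n\<close> are never used.  A network model is a
  sequence, indexed by \<open>n\<close>, of probability spaces \<open>M n\<close>, random positions \<open>Z n\<close> and random
  adjacency matrices \<open>Y n\<close>; nothing relates the laws for different \<open>n\<close>.  The adjacency matrices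
  have the type \<^typ>\<open>real mat\<close>, whose elements carry their dimension and have no entries
  outside of it, so a function of \<open>Y n \<omega>\<close> has access to the network and to nothing else.
\<close>

definition pos_algebra :: "'w measure \<Rightarrow> nat \<Rightarrow> ('w \<Rightarrow> nat \<Rightarrow> real ^ 'd) \<Rightarrow> 'w measure" where
  "pos_algebra M n Z =
     vimage_algebra (space M) (\<lambda>\<omega>. \<lambda>i\<in>{..<n}. Z \<omega> i) (\<Pi>\<^sub>M i\<in>{..<n}. borel)"

definition cond_prob_given :: "'w measure \<Rightarrow> 'w measure \<Rightarrow> 'w set \<Rightarrow> 'w \<Rightarrow> real" where
  "cond_prob_given M F A = real_cond_exp M F (indicator A)"

definition cond_indep_vars ::
  "'w measure \<Rightarrow> 'w measure \<Rightarrow> 'b measure \<Rightarrow> ('i \<Rightarrow> 'w \<Rightarrow> 'b) \<Rightarrow> 'i set \<Rightarrow> bool" where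
  "cond_indep_vars M F N X I \<longleftrightarrow>
     (\<forall>i\<in>I. X i \<in> measurable M N) \<and>
     (\<forall>J A. J \<subseteq> I \<longrightarrow> finite J \<longrightarrow> (\<forall>i\<in>J. A i \<in> sets N) \<longrightarrow>
        (AE \<omega> in M. cond_prob_given M F {\<omega> \<in> space M. \<forall>i\<in>J. X i \<omega> \<in> A i} \<omega>
                  = (\<Prod>i\<in>J. cond_prob_given M F {\<omega> \<in> space M. X i \<omega> \<in> A i} \<omega>)))"

definition lpm ::
  "(real ^ 'd) set \<Rightarrow> (real \<Rightarrow> real) \<Rightarrow> (nat \<Rightarrow> 'w measure) \<Rightarrow>
   (nat \<Rightarrow> 'w \<Rightarrow> nat \<Rightarrow> real ^ 'd) \<Rightarrow> (nat \<Rightarrow> 'w \<Rightarrow> real mat) \<Rightarrow> bool" where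
  "lpm S K M Z Y \<longleftrightarrow>
     (\<forall>x\<ge>0. 0 \<le> K x \<and> K x \<le> 1) \<and>
     (\<forall>n. prob_space (M n) \<and>
       (\<forall>i<n. (\<lambda>\<omega>. Z n \<omega> i) \<in> borel_measurable (M n)) \<and>
       (\<forall>\<omega>\<in>space (M n). \<forall>i<n. Z n \<omega> i \<in> S) \<and>
       (\<forall>\<omega>\<in>space (M n). Y n \<omega> \<in> carrier_mat n n \<and>
          (\<forall>i<n. \<forall>j<n. Y n \<omega> $$ (i, j) \<in> {0, 1} \<and> Y n \<omega> $$ (i, j) = Y n \<omega> $$ (j, i)) \<and>
          (\<forall>i<n. Y n \<omega> $$ (i, i) = 0)) \<and>
       cond_indep_vars (M n) (pos_algebra (M n) n (Z n)) borel
         (\<lambda>(i, j) \<omega>. Y n \<omega> $$ (i, j)) {(i, j). i < j \<and> j < n} \<and>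
       (\<forall>i j. i < j \<longrightarrow> j < n \<longrightarrow>
          (AE \<omega> in M n.
             cond_prob_given (M n) (pos_algebra (M n) n (Z n))
               {\<omega> \<in> space (M n). Y n \<omega> $$ (i, j) = 1} \<omega>
             = K (norm (Z n \<omega> i - Z n \<omega> j)))))"

text \<open>
  Monotonicity is not required to be strict.  \<open>G\<close> is only evaluated at positive
  integers; differentiability is required on the open half-line so as to allow root functions.
\<close>

definition regular_lpm ::
  "(real ^ 'd) set \<Rightarrow> (real \<Rightarrow> real) \<Rightarrow> (real \<Rightarrow> real) \<Rightarrow> real \<Rightarrow> (nat \<Rightarrow> 'w measure) \<Rightarrow>
   (nat \<Rightarrow> 'w \<Rightarrow> nat \<Rightarrow> real ^ 'd) \<Rightarrow> (nat \<Rightarrow> 'w \<Rightarrow> real mat) \<Rightarrow> bool" where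
  "regular_lpm S K G \<epsilon> M Z Y \<longleftrightarrow>
     lpm S K M Z Y \<and>
     antimono_on {0..} K \<and> K differentiable_on {0..} \<and> 0 < \<epsilon> \<and> (\<forall>x\<ge>0. K x \<le> 1 - \<epsilon>) \<and>
     G differentiable_on {0<..} \<and>
     (\<lambda>n. measure (M n) {\<omega> \<in> space (M n). (MAX i\<in>{..<n}. norm (Z n \<omega> i)) \<le> G (real n)})
       \<longlonglongrightarrow> 1"

definition sparse_in_expectation ::
  "(nat \<Rightarrow> real) \<Rightarrow> (nat \<Rightarrow> 'w measure) \<Rightarrow> (nat \<Rightarrow> 'w \<Rightarrow> real mat) \<Rightarrow> bool" where
  "sparse_in_expectation e M Y \<longleftrightarrow>
     (\<exists>C>0. (\<lambda>n. integral\<^sup>L (M n) (\<lambda>\<omega>. \<Sum>i<n. \<Sum>j<n. Y n \<omega> $$ (i, j) / e n)) \<longlonglongrightarrow> C)"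


section \<open>The suprema controlling the link probability function\<close>

text \<open>
  The quotients are formed in \<^typ>\<open>ennreal\<close>, where \<open>c / 0 = \<infinity>\<close> for \<open>c > 0\<close> and \<open>0 / 0 = 0\<close>.
  A quotient \<open>0 / 0\<close> occurs only where \<open>K x = 0\<close>, since then \<open>deriv K x = 0\<close> for a decreasing
  nonnegative \<open>K\<close>.  If such an \<open>x\<close> lies in the range and \<open>K\<close> does not vanish identically,
  \<open>alpha_sup\<close> is infinite regardless, because \<open>ln K\<close> is unbounded below to the left of
  the first zero of \<open>K\<close>.
\<close>

definition alpha_sup :: "(real \<Rightarrow> real) \<Rightarrow> (real \<Rightarrow> real) \<Rightarrow> real \<Rightarrow> nat \<Rightarrow> ennreal" where
  "alpha_sup K G \<epsilon> n =
     (SUP x\<in>{0<..2 * G (real n)}. ennreal \<bar>deriv K x\<bar> / ennreal (\<bar>x\<bar> * K x * \<epsilon>))"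

definition beta_sup :: "(real \<Rightarrow> real) \<Rightarrow> (real \<Rightarrow> real) \<Rightarrow> nat \<Rightarrow> ennreal" where
  "beta_sup K G n =
     (SUP x\<in>{0<..2 * G (real n)}. ennreal (x\<^sup>2 * K x) / ennreal ((deriv K x)\<^sup>2))"


section \<open>Learnability\<close>

definition frob_norm :: "nat \<Rightarrow> (nat \<Rightarrow> nat \<Rightarrow> real) \<Rightarrow> real" where
  "frob_norm n A = sqrt (\<Sum>i<n. \<Sum>j<n. (A i j)\<^sup>2)"

definition frob_norm_rows :: "nat \<Rightarrow> (nat \<Rightarrow> real ^ 'd) \<Rightarrow> real" where
  "frob_norm_rows n A = sqrt (\<Sum>i<n. (norm (A i))\<^sup>2)"

definition sq_dist_matrix :: "(nat \<Rightarrow> real ^ 'd) \<Rightarrow> nat \<Rightarrow> nat \<Rightarrow> real" where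
  "sq_dist_matrix z i j = (norm (z i - z j))\<^sup>2"

definition link_prob_matrix :: "(real \<Rightarrow> real) \<Rightarrow> (nat \<Rightarrow> real ^ 'd) \<Rightarrow> nat \<Rightarrow> nat \<Rightarrow> real" where
  "link_prob_matrix K z i j = K (norm (z i - z j))"

definition null_in_prob :: "(nat \<Rightarrow> 'w measure) \<Rightarrow> (nat \<Rightarrow> 'w \<Rightarrow> real) \<Rightarrow> bool" where
  "null_in_prob M X \<longleftrightarrow>
     (\<forall>\<delta>>0. (\<lambda>n. measure (M n) {\<omega> \<in> space (M n). \<bar>X n \<omega>\<bar> > \<delta>}) \<longlonglongrightarrow> 0)"

text \<open>
  An estimator maps an adjacency matrix to the rows of the estimated positions; the number of nodes
  is the dimension of the matrix.  Being learnable means that some estimator \<open>Zhat\<close> learns; since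
  \<open>Zhat\<close> may use the known \<open>K\<close>, \<open>G\<close> and \<open>d\<close> but not the unknown law of the positions, it has to be
  quantified after \<open>K\<close>, \<open>G\<close>, \<open>'d\<close> and before the model \<open>(M, Z, Y)\<close>.
\<close>

definition learns_link_probs ::
  "(real mat \<Rightarrow> nat \<Rightarrow> real ^ 'd) \<Rightarrow> (real \<Rightarrow> real) \<Rightarrow> (nat \<Rightarrow> real) \<Rightarrow> (nat \<Rightarrow> 'w measure) \<Rightarrow>
   (nat \<Rightarrow> 'w \<Rightarrow> nat \<Rightarrow> real ^ 'd) \<Rightarrow> (nat \<Rightarrow> 'w \<Rightarrow> real mat) \<Rightarrow> bool" where
  "learns_link_probs Zhat K e M Z Y \<longleftrightarrow>
     null_in_prob M (\<lambda>n \<omega>.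
       (frob_norm n (\<lambda>i j. link_prob_matrix K (Zhat (Y n \<omega>)) i j
                          - link_prob_matrix K (Z n \<omega>) i j))\<^sup>2 / e n)"

definition learns_sq_dists ::
  "(real mat \<Rightarrow> nat \<Rightarrow> real ^ 'd) \<Rightarrow> (nat \<Rightarrow> 'w measure) \<Rightarrow>
   (nat \<Rightarrow> 'w \<Rightarrow> nat \<Rightarrow> real ^ 'd) \<Rightarrow> (nat \<Rightarrow> 'w \<Rightarrow> real mat) \<Rightarrow> bool" where
  "learns_sq_dists Zhat M Z Y \<longleftrightarrow>
     null_in_prob M (\<lambda>n \<omega>.
       (frob_norm n (\<lambda>i j. sq_dist_matrix (Zhat (Y n \<omega>)) i j
                          - sq_dist_matrix (Z n \<omega>) i j))\<^sup>2 / (real n)\<^sup>2)"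

definition learns_positions ::
  "(real mat \<Rightarrow> nat \<Rightarrow> real ^ 'd) \<Rightarrow> (nat \<Rightarrow> 'w measure) \<Rightarrow>
   (nat \<Rightarrow> 'w \<Rightarrow> nat \<Rightarrow> real ^ 'd) \<Rightarrow> (nat \<Rightarrow> 'w \<Rightarrow> real mat) \<Rightarrow> bool" where
  "learns_positions Zhat M Z Y \<longleftrightarrow>
     null_in_prob M (\<lambda>n \<omega>.
       (INF (R, Q) \<in> {R. orthogonal_matrix R} \<times> {Q. \<forall>i<n. \<forall>j<n. Q i = Q j}.
          (frob_norm_rows n (\<lambda>i. Zhat (Y n \<omega>) i v* R - Q i - Z n \<omega> i))\<^sup>2 / real n))"


section \<open>Distinctly bunched eigenvalues\<close>

definition centering_matrix :: "nat \<Rightarrow> real mat" where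
  "centering_matrix n = 1\<^sub>m n - (1 / real n) \<cdot>\<^sub>m Matrix.mat n n (\<lambda>_. 1)"

text \<open>The entries of \<open>z z\<^sup>T\<close> are the inner products of the rows of \<open>z\<close>.\<close>

definition centered_gram :: "nat \<Rightarrow> (nat \<Rightarrow> real ^ 'd) \<Rightarrow> real mat" where
  "centered_gram n z =
     centering_matrix n * Matrix.mat n n (\<lambda>(i, j). inner (z i) (z j)) * centering_matrix n"

text \<open>The nonzero eigenvalues in decreasing order, repeated according to multiplicity.\<close>

definition nonzero_eigs :: "real mat \<Rightarrow> real list" where
  "nonzero_eigs A =
     rev (sorted_list_of_multiset (filter_mset (\<lambda>x. x \<noteq> 0) (proots (char_poly A))))"

definition eig :: "real mat \<Rightarrow> nat \<Rightarrow> real" where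
  "eig A l = (if 1 \<le> l \<and> l \<le> length (nonzero_eigs A) then nonzero_eigs A ! (l - 1) else 0)"

text \<open>
  The eigenvalues are random; the inequalities are required almost surely for every \<open>n > d\<close>,
  whereas the bunching indices \<open>k\<close> and \<open>i\<close> depend neither on \<open>n\<close> nor on the outcome.
\<close>

definition distinctly_bunched ::
  "(nat \<Rightarrow> real) \<Rightarrow> (nat \<Rightarrow> real) \<Rightarrow> (nat \<Rightarrow> 'w measure) \<Rightarrow>
   (nat \<Rightarrow> 'w \<Rightarrow> nat \<Rightarrow> real ^ 'd) \<Rightarrow> bool" where
  "distinctly_bunched a b M Z \<longleftrightarrow>
     (\<exists>k\<in>{1..CARD('d)}. \<exists>i :: nat \<Rightarrow> nat.
        i 1 = 1 \<and> i (k + 1) = CARD('d) + 1 \<and> strict_mono_on {1..k + 1} i \<and>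
        (\<forall>n>CARD('d). AE \<omega> in M n.
           let lam = eig (centered_gram n (Z n \<omega>)) in
             length (nonzero_eigs (centered_gram n (Z n \<omega>))) = CARD('d) \<and>
             (\<forall>j\<in>{1..k}.
                (lam (i (j + 1) - 1) - lam (i j))\<^sup>2 / lam (i (j + 1) - 1) \<le> a n \<and>
                (lam (i (j + 1) - 1) - lam (i (j + 1)))\<^sup>2 / lam (i j) \<ge> b n)))"


section \<open>Rate conditions\<close>

text \<open>
  In \<^typ>\<open>ennreal\<close> one has \<open>0 * \<infinity> = 0\<close>, which must not count as small here: for constant
  \<open>K\<close> one has \<open>alpha_sup = 0\<close> and \<open>beta_sup = \<infinity>\<close>, and the positions are not identifiable.  The
  finiteness of \<open>beta_sup\<close> rules out just this indeterminate form; whenever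
  \<open>alpha_sup > 0\<close>, it follows from the convergence.  Since \<^const>\<open>ennreal\<close> maps nonpositive numbers
  to \<open>0\<close>, quotients with a nonpositive \<open>e n\<close> or \<open>b n\<close> and a positive numerator are \<open>\<infinity>\<close>.
\<close>

definition link_prob_rate ::
  "(real \<Rightarrow> real) \<Rightarrow> (real \<Rightarrow> real) \<Rightarrow> real \<Rightarrow> (nat \<Rightarrow> real) \<Rightarrow> bool" where
  "link_prob_rate K G \<epsilon> e \<longleftrightarrow>
     (\<lambda>n. alpha_sup K G \<epsilon> n / ennreal (e n) * ennreal (real n powr 1.5 * (G (real n))\<^sup>2))
       \<longlonglongrightarrow> 0"

definition sq_dist_rate :: "(real \<Rightarrow> real) \<Rightarrow> (real \<Rightarrow> real) \<Rightarrow> real \<Rightarrow> bool" where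
  "sq_dist_rate K G \<epsilon> \<longleftrightarrow>
     (\<forall>\<^sub>F n in sequentially. beta_sup K G n < \<infinity>) \<and>
     (\<lambda>n. beta_sup K G n * alpha_sup K G \<epsilon> n * ennreal (real n powr (- 0.5) * (G (real n))\<^sup>2))
       \<longlonglongrightarrow> 0"

definition position_rate ::
  "(real \<Rightarrow> real) \<Rightarrow> (real \<Rightarrow> real) \<Rightarrow> real \<Rightarrow> (nat \<Rightarrow> real) \<Rightarrow> (nat \<Rightarrow> real) \<Rightarrow> bool" where
  "position_rate K G \<epsilon> a b \<longleftrightarrow>
     (\<lambda>n. a n / real n) \<longlonglongrightarrow> 0 \<and>
     (\<forall>\<^sub>F n in sequentially. beta_sup K G n < \<infinity>) \<and>
     (\<lambda>n. beta_sup K G n * alpha_sup K G \<epsilon> n * ennreal (real n powr 0.5 * (G (real n))\<^sup>2)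
          / ennreal (b n)) \<longlonglongrightarrow> 0"

end

theory Submission
  imports Defs
begin

text \<open>
  One estimator serves all three claims: over all configurations in the ball of radius \<open>G n\<close> it
  maximizes the likelihood the network would have if its entries were Poisson variables with the
  link probabilities as means.  Up to a constant, the logarithm of this likelihood is the sum of
  \<open>Y\<^sub>i\<^sub>j ln q\<^sub>i\<^sub>j - q\<^sub>i\<^sub>j\<close>, whose expectation under link probabilities \<open>p\<close> is largest at \<open>q = p\<close>; it falls
  short of that maximum by a Poisson divergence, which dominates the squared Hellinger distance
  of the link probabilities (\<open>sq_sqrt_diff_le_poisson_divergence\<close>).  With probability tending to
  \<open>1\<close> the true configuration lies in the ball, and the inequality expressing that the estimate is
  at least as likely as the truth bounds the squared Hellinger distance by the noise
  \<open>\<Sum> (Y\<^sub>i\<^sub>j - p\<^sub>i\<^sub>j) (ln q\<^sub>i\<^sub>j - ln p\<^sub>i\<^sub>j)\<close> at the estimate (\<open>hellinger_sq_le_noise\<close>).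

  Since the estimate depends on the network, this noise has to be bounded uniformly over the ball.
  For a fixed configuration, it is a weighted sum of centred Bernoulli variables that are
  independent given the positions, hence sub-Gaussian (\<open>noise_tail\<close>).  As a function of the
  configuration, it is controlled by the Lipschitz constant of \<open>ln K\<close> in the squared distance,
  which is at most \<open>\<alpha>\<close> up to a factor.  Chaining along dyadic grids of the \<open>n d\<close>
  coordinates then yields \<open>\<alpha> G(n)\<^sup>2 n\<^sup>3\<^sup>/\<^sup>2\<close>, without a logarithmic factor, outside of an event of
  probability at most \<open>2 n e\<^sup>-\<^sup>n\<close> (\<open>noise_uniform_bound\<close>).  This is the rate of the squared Hellinger
  distance (\<open>hellinger_consistency\<close>).

  The squared Hellinger distance dominates the squared Frobenius distance of the link probabilities,
  which gives the first claim.  Up to a factor, \<open>\<beta>\<close> bounds the squared inverse of the derivative of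
  \<open>sqrt K\<close> in the squared distance, so the Hellinger distance times \<open>sqrt \<beta>\<close> dominates the Frobenius
  distance of the matrices of squared distances.  This gives the second claim.

  For the third, double centering turns squared distances into inner products of the centred
  positions.  Two configurations with Gram matrices at squared Frobenius distance \<open>F\<close> can be
  rotated onto each other with a squared error of order \<open>F / \<mu>\<close>, where \<open>\<mu>\<close> is the smallest eigenvalue of the
  second moment matrix of the true centred positions (\<open>procrustes_bound\<close>).  Having \<open>d\<close> nonzero
  eigenvalues makes \<open>\<mu>\<close> positive and bounds it from below by \<open>\<lambda>\<^sub>d\<close> (\<open>gram_smallest_eigenvalue\<close>), and
  the gap of the last bunch to \<open>\<lambda>\<^sub>d\<^sub>+\<^sub>1 = 0\<close> bounds \<open>\<lambda>\<^sub>d\<close> by \<open>b(n)\<close>.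
\<close>

no_notation Matrix.scalar_prod (infix "\<bullet>" 70)
no_notation Matrix.vec_index (infixl "$" 100)

section \<open>Smoothness of the link function in the squared distance\<close>

lemma link_has_derivative:
  fixes K :: "real \<Rightarrow> real"
  assumes "K differentiable_on {0..}" "0 < x"
  shows "(K has_real_derivative deriv K x) (at x)"
proof -
  have "K differentiable (at x within {0..})"
    using assms by (auto simp: differentiable_on_def)
  moreover have "at x within {0..} = at x"
    using assms(2) by (intro at_within_interior) auto
  ultimately show ?thesis
    by (simp add: DERIV_deriv_iff_real_differentiable)
qed

lemma link_deriv_nonpos:
  fixes K :: "real \<Rightarrow> real"
  assumes "K differentiable_on {0..}" "antimono_on {0..} K" "0 < x"
  shows "deriv K x \<le> 0"
proof (rule ccontr)
  assume "\<not> deriv K x \<le> 0"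
  then obtain e where "e > 0" and e: "\<And>h. h > 0 \<Longrightarrow> h < e \<Longrightarrow> K x < K (x + h)"
    using DERIV_pos_inc_right[OF link_has_derivative[OF assms(1,3)]] by auto
  from e[of "e/2"] \<open>e > 0\<close> have "K x < K (x + e/2)" by simp
  moreover have "K (x + e/2) \<le> K x"
    using assms \<open>e > 0\<close> by (intro monotone_onD[OF assms(2)]) auto
  ultimately show False by simp
qed

text \<open>
  The bound on the derivative says that \<open>ln K\<close> decreases in the squared distance at most at rate
  \<open>A / 2\<close>.  The multiplicative form needs no logarithm, so it holds before \<open>K\<close> is known to be
  positive and serves to prove that it is.
\<close>

lemma link_times_exp_mono:
  fixes K :: "real \<Rightarrow> real"
  assumes diff: "K differentiable_on {0..}"
    and bound: "\<And>t. 0 < t \<Longrightarrow> t < r \<Longrightarrow> \<bar>deriv K t\<bar> \<le> A * t * K t"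
    and xy: "0 \<le> x" "x \<le> y" "y \<le> r"
  shows "K x * exp (A * x\<^sup>2 / 2) \<le> K y * exp (A * y\<^sup>2 / 2)"
proof (rule DERIV_nonneg_imp_increasing_open[OF xy(2)])
  fix t assume t: "x < t" "t < y"
  then have "0 < t" "t < r" using xy by auto
  have "((\<lambda>u. K u * exp (A * u\<^sup>2 / 2)) has_real_derivative
      (deriv K t + A * t * K t) * exp (A * t\<^sup>2 / 2)) (at t)"
    using link_has_derivative[OF diff \<open>0 < t\<close>]
    by (auto intro!: derivative_eq_intros simp: algebra_simps)
  moreover have "0 \<le> deriv K t + A * t * K t"
    using bound[OF \<open>0 < t\<close> \<open>t < r\<close>] by linarith
  ultimately show "\<exists>D. ((\<lambda>u. K u * exp (A * u\<^sup>2 / 2)) has_real_derivative D) (at t) \<and> 0 \<le> D"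
    by (intro exI conjI) (assumption, simp)
next
  have "continuous_on {x..y} K"
    using differentiable_imp_continuous_on[OF diff] xy(1)
    by (elim continuous_on_subset) auto
  then show "continuous_on {x..y} (\<lambda>u. K u * exp (A * u\<^sup>2 / 2))"
    by (intro continuous_intros) auto
qed

lemma link_positive:
  fixes K :: "real \<Rightarrow> real"
  assumes diff: "K differentiable_on {0..}"
    and bound: "\<And>t. 0 < t \<Longrightarrow> t < r \<Longrightarrow> \<bar>deriv K t\<bar> \<le> A * t * K t"
    and "0 < K 0" "0 \<le> x" "x \<le> r"
  shows "0 < K x"
proof -
  have "0 < K 0 * exp (A * 0\<^sup>2 / 2)" using \<open>0 < K 0\<close> by simp
  also have "\<dots> \<le> K x * exp (A * x\<^sup>2 / 2)"
    using assms by (intro link_times_exp_mono[OF diff bound]) auto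
  finally show ?thesis by (simp add: zero_less_mult_iff)
qed

lemma ln_link_lipschitz:
  fixes K :: "real \<Rightarrow> real"
  assumes diff: "K differentiable_on {0..}" and anti: "antimono_on {0..} K"
    and bound: "\<And>t. 0 < t \<Longrightarrow> t < r \<Longrightarrow> \<bar>deriv K t\<bar> \<le> A * t * K t"
    and "0 < K 0"
    and x: "0 \<le> x" "x \<le> r" and y: "0 \<le> y" "y \<le> r"
  shows "\<bar>ln (K x) - ln (K y)\<bar> \<le> A / 2 * \<bar>x\<^sup>2 - y\<^sup>2\<bar>"
proof -
  have *: "\<bar>ln (K u) - ln (K v)\<bar> \<le> A / 2 * \<bar>u\<^sup>2 - v\<^sup>2\<bar>" if uv: "0 \<le> u" "u \<le> v" "v \<le> r" for u v
  proof -
    have pos: "0 < K u" "0 < K v"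
      using link_positive[OF diff bound \<open>0 < K 0\<close>] uv by auto
    have "K u * exp (A * u\<^sup>2 / 2) \<le> K v * exp (A * v\<^sup>2 / 2)"
      by (rule link_times_exp_mono[OF diff bound uv])
    then have "ln (K u * exp (A * u\<^sup>2 / 2)) \<le> ln (K v * exp (A * v\<^sup>2 / 2))"
      using pos by simp
    then have 1: "ln (K u) - ln (K v) \<le> A / 2 * (v\<^sup>2 - u\<^sup>2)"
      using pos by (simp add: ln_mult algebra_simps)
    have "K v \<le> K u" using uv by (intro monotone_onD[OF anti]) auto
    then have "0 \<le> ln (K u) - ln (K v)" using pos by simp
    moreover have "u\<^sup>2 \<le> v\<^sup>2" using uv by (intro power_mono) auto
    ultimately show ?thesis using 1 by simp
  qed
  show ?thesis
    using *[of x y] *[of y x] x y by (cases "x \<le> y") (auto simp: abs_minus_commute)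
qed

text \<open>
  The hypothesis gives \<open>x sqrt K \<le> sqrt B \<bar>K'\<bar>\<close>, which bounds the derivative \<open>2 x\<close> of the square by
  \<open>4 sqrt B\<close> times that of \<open>- sqrt K\<close>.  So \<open>4 sqrt B * sqrt K + x\<^sup>2\<close> is decreasing.
\<close>

lemma sq_diff_le_sqrt_link_diff:
  fixes K :: "real \<Rightarrow> real"
  assumes diff: "K differentiable_on {0..}" and anti: "antimono_on {0..} K"
    and pos: "\<And>t. 0 \<le> t \<Longrightarrow> t \<le> r \<Longrightarrow> 0 < K t"
    and bound: "\<And>t. 0 < t \<Longrightarrow> t < r \<Longrightarrow> t\<^sup>2 * K t \<le> B * (deriv K t)\<^sup>2"
    and x: "0 \<le> x" "x \<le> r" and y: "0 \<le> y" "y \<le> r"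
  shows "\<bar>x\<^sup>2 - y\<^sup>2\<bar> \<le> 4 * sqrt B * \<bar>sqrt (K x) - sqrt (K y)\<bar>"
proof -
  have *: "\<bar>u\<^sup>2 - v\<^sup>2\<bar> \<le> 4 * sqrt B * \<bar>sqrt (K u) - sqrt (K v)\<bar>"
    if uv: "0 \<le> u" "u \<le> v" "v \<le> r" for u v
  proof -
    have "- (4 * sqrt B * sqrt (K u) + u\<^sup>2) \<le> - (4 * sqrt B * sqrt (K v) + v\<^sup>2)"
    proof (rule DERIV_nonneg_imp_increasing_open[OF uv(2)])
      fix t assume t: "u < t" "t < v"
      then have "0 < t" "t < r" using uv by auto
      then have "0 < K t" using pos by simp
      have "((\<lambda>w. - (4 * sqrt B * sqrt (K w) + w\<^sup>2)) has_real_derivative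
          - (4 * sqrt B * deriv K t / (2 * sqrt (K t)) + 2 * t)) (at t)"
        using link_has_derivative[OF diff \<open>0 < t\<close>] \<open>0 < K t\<close>
        by (auto intro!: derivative_eq_intros simp: field_simps)
      moreover have "0 \<le> - (4 * sqrt B * deriv K t / (2 * sqrt (K t)) + 2 * t)"
      proof -
        have "sqrt (t\<^sup>2 * K t) \<le> sqrt (B * (deriv K t)\<^sup>2)"
          using bound[OF \<open>0 < t\<close> \<open>t < r\<close>] by simp
        then have "t * sqrt (K t) \<le> sqrt B * \<bar>deriv K t\<bar>"
          using \<open>0 < t\<close> by (simp add: real_sqrt_mult)
        also have "\<bar>deriv K t\<bar> = - deriv K t"
          using link_deriv_nonpos[OF diff anti \<open>0 < t\<close>] by simp
        finally show ?thesis using \<open>0 < K t\<close> by (simp add: field_simps)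
      qed
      ultimately show "\<exists>D. ((\<lambda>w. - (4 * sqrt B * sqrt (K w) + w\<^sup>2)) has_real_derivative D) (at t)
          \<and> 0 \<le> D"
        by blast
    next
      have "continuous_on {u..v} K"
        using differentiable_imp_continuous_on[OF diff] uv(1)
        by (elim continuous_on_subset) auto
      then show "continuous_on {u..v} (\<lambda>w. - (4 * sqrt B * sqrt (K w) + w\<^sup>2))"
        by (intro continuous_intros) auto
    qed
    moreover have "K v \<le> K u" using uv by (intro monotone_onD[OF anti]) auto
    moreover have "u\<^sup>2 \<le> v\<^sup>2" using uv by (intro power_mono) auto
    ultimately show ?thesis by (simp add: algebra_simps)
  qed
  show ?thesis
    using *[of x y] *[of y x] x y by (cases "x \<le> y") (auto simp: abs_minus_commute)
qed

section \<open>The link function under finite suprema\<close>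

lemma ennreal_divide_le_imp_le_mult:
  assumes "ennreal a / ennreal b \<le> ennreal c" "0 \<le> a" "0 \<le> b" "0 \<le> c"
  shows "a \<le> c * b"
proof (cases "b = 0")
  case True
  with assms have "a = 0"
    by (cases "a = 0") (auto simp: ennreal_divide_eq_top_iff top_unique ennreal_eq_0_iff)
  then show ?thesis using assms by simp
next
  case False
  with assms have "a / b \<le> c"
    by (simp add: divide_ennreal)
  with False assms show ?thesis by (simp add: field_simps)
qed

lemma deriv_link_le_alpha_sup:
  assumes fin: "alpha_sup K G \<epsilon> n < \<infinity>"
    and "0 < \<epsilon>" "\<And>x. 0 \<le> x \<Longrightarrow> 0 \<le> K x" "0 < t" "t \<le> 2 * G (real n)"
  shows "\<bar>deriv K t\<bar> \<le> \<epsilon> * enn2real (alpha_sup K G \<epsilon> n) * t * K t"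
proof -
  have "ennreal \<bar>deriv K t\<bar> / ennreal (\<bar>t\<bar> * K t * \<epsilon>) \<le> alpha_sup K G \<epsilon> n"
    unfolding alpha_sup_def using assms by (intro SUP_upper) auto
  then have "\<bar>deriv K t\<bar> \<le> enn2real (alpha_sup K G \<epsilon> n) * (\<bar>t\<bar> * K t * \<epsilon>)"
    using assms by (intro ennreal_divide_le_imp_le_mult) auto
  then show ?thesis using \<open>0 < t\<close> by (simp add: mult_ac)
qed

lemma link_le_beta_sup:
  assumes fin: "beta_sup K G n < \<infinity>"
    and "\<And>x. 0 \<le> x \<Longrightarrow> 0 \<le> K x" "0 < t" "t \<le> 2 * G (real n)"
  shows "t\<^sup>2 * K t \<le> enn2real (beta_sup K G n) * (deriv K t)\<^sup>2"
proof -
  have "ennreal (t\<^sup>2 * K t) / ennreal ((deriv K t)\<^sup>2) \<le> beta_sup K G n"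
    unfolding beta_sup_def using assms by (intro SUP_upper) auto
  then show ?thesis
    using assms by (intro ennreal_divide_le_imp_le_mult) auto
qed

text \<open>
  The rate conditions for squared distances and positions bound the product of \<open>alpha_sup\<close> and
  \<open>beta_sup\<close>; a bound on \<open>alpha_sup\<close> follows because the other factor does not vanish.
\<close>

lemma beta_sup_pos:
  assumes "K differentiable_on {0..}" "0 < K 0" "0 < G (real n)"
  shows "0 < beta_sup K G n"
proof -
  have "continuous (at 0 within {0..}) K"
    using differentiable_imp_continuous_on[OF assms(1)]
    by (auto simp: continuous_on_eq_continuous_within)
  then have "\<forall>\<^sub>F x in at 0 within {0..}. 0 < K x"
    using assms(2) by (auto simp: continuous_within order_tendstoD)
  then obtain s where "s > 0" and s: "\<And>x. x \<ge> 0 \<Longrightarrow> x \<noteq> 0 \<Longrightarrow> dist x 0 < s \<Longrightarrow> 0 < K x"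
    unfolding eventually_at by auto
  define t where "t = min (s / 2) (2 * G (real n))"
  have t: "0 < t" "t \<le> 2 * G (real n)" "0 < K t"
    using \<open>s > 0\<close> assms(3) s[of t] by (auto simp: t_def)
  have "0 < ennreal (t\<^sup>2 * K t) / ennreal ((deriv K t)\<^sup>2)"
    using t by (auto simp: ennreal_zero_less_divide)
  also have "\<dots> \<le> beta_sup K G n"
    unfolding beta_sup_def using t by (intro SUP_upper) auto
  finally show ?thesis .
qed

section \<open>Pairs of nodes and their link probabilities\<close>

abbreviation dyads :: "nat \<Rightarrow> (nat \<times> nat) set" where
  "dyads n \<equiv> {(i, j). i < j \<and> j < n}"

lemma finite_dyads: "finite (dyads n)"
  by (rule finite_subset[of _ "{..<n} \<times> {..<n}"]) auto

lemma card_dyads_le: "card (dyads n) \<le> n\<^sup>2"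
proof -
  have "card (dyads n) \<le> card ({..<n} \<times> {..<n})"
    by (intro card_mono) auto
  then show ?thesis by (simp add: power2_eq_square)
qed

lemma sum_symmetric_eq_dyads:
  fixes f :: "nat \<Rightarrow> nat \<Rightarrow> real"
  assumes sym: "\<And>i j. i < n \<Longrightarrow> j < n \<Longrightarrow> f i j = f j i"
    and diag: "\<And>i. i < n \<Longrightarrow> f i i = 0"
  shows "(\<Sum>i<n. \<Sum>j<n. f i j) = 2 * (\<Sum>(i, j)\<in>dyads n. f i j)"
proof -
  have "(\<Sum>i<n. \<Sum>j<n. f i j) = (\<Sum>(i, j)\<in>{..<n} \<times> {..<n}. f i j)"
    by (simp add: sum.cartesian_product)
  also have "{..<n} \<times> {..<n} = dyads n \<union> (prod.swap ` dyads n \<union> (\<lambda>i. (i, i)) ` {..<n})"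
    by (auto simp: image_iff)
  also have "(\<Sum>(i, j)\<in>\<dots>. f i j) = (\<Sum>(i, j)\<in>dyads n. f i j) +
      ((\<Sum>(i, j)\<in>prod.swap ` dyads n. f i j) + (\<Sum>(i, j)\<in>(\<lambda>i. (i, i)) ` {..<n}. f i j))"
    by (subst sum.union_disjoint; (subst sum.union_disjoint)?)
      (auto simp: finite_dyads)
  also have "(\<Sum>(i, j)\<in>prod.swap ` dyads n. f i j) = (\<Sum>(i, j)\<in>dyads n. f i j)"
    using sym by (subst sum.reindex) (auto intro!: sum.cong)
  also have "(\<Sum>(i, j)\<in>(\<lambda>i. (i, i)) ` {..<n}. f i j) = 0"
    using diag by (intro sum.neutral) auto
  finally show ?thesis by simp
qed

definition link_at :: "(real \<Rightarrow> real) \<Rightarrow> (nat \<Rightarrow> real ^ 'd) \<Rightarrow> nat \<times> nat \<Rightarrow> real" where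
  "link_at K z p = K (norm (z (fst p) - z (snd p)))"

lemma measurable_pos_algebra_component:
  assumes "i < n"
  shows "(\<lambda>\<omega>. Z \<omega> i) \<in> borel_measurable (pos_algebra M n Z)"
proof -
  have "(\<lambda>\<omega>. \<lambda>i\<in>{..<n}. Z \<omega> i) \<in> pos_algebra M n Z \<rightarrow>\<^sub>M (\<Pi>\<^sub>M i\<in>{..<n}. borel)"
    unfolding pos_algebra_def
    by (rule measurable_vimage_algebra1) (auto simp: space_PiM)
  from measurable_compose[OF this measurable_component_singleton[of i]] assms
  show ?thesis by simp
qed

text \<open>
  \<open>K\<close> is continuous on the half-line only, so it is extended by its value at \<open>0\<close>.
\<close>

lemma measurable_link_at:
  fixes K :: "real \<Rightarrow> real"
  assumes cont: "continuous_on {0..} K" and p: "p \<in> dyads n"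
  shows "(\<lambda>\<omega>. link_at K (Z \<omega>) p) \<in> borel_measurable (pos_algebra M n Z)"
proof -
  have "continuous_on UNIV (\<lambda>x. K (max 0 x))"
    by (rule continuous_on_compose2[OF cont]) (auto intro!: continuous_intros)
  then have [measurable]: "(\<lambda>x. K (max 0 x)) \<in> borel_measurable borel"
    by (rule borel_measurable_continuous_onI)
  have [measurable]: "(\<lambda>\<omega>. Z \<omega> (fst p)) \<in> borel_measurable (pos_algebra M n Z)"
      "(\<lambda>\<omega>. Z \<omega> (snd p)) \<in> borel_measurable (pos_algebra M n Z)"
    using p by (auto intro!: measurable_pos_algebra_component)
  have "(\<lambda>\<omega>. K (max 0 (norm (Z \<omega> (fst p) - Z \<omega> (snd p))))) \<in> borel_measurable (pos_algebra M n Z)"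
    by measurable
  then show ?thesis by (simp add: link_at_def)
qed

lemma subalgebra_pos_algebra:
  assumes "\<And>i. i < n \<Longrightarrow> (\<lambda>\<omega>. Z \<omega> i) \<in> borel_measurable M"
  shows "subalgebra M (pos_algebra M n Z)"
  unfolding subalgebra_def
proof
  show "space (pos_algebra M n Z) = space M" by (simp add: pos_algebra_def)
  have "(\<lambda>\<omega>. \<lambda>i\<in>{..<n}. Z \<omega> i) \<in> M \<rightarrow>\<^sub>M (\<Pi>\<^sub>M i\<in>{..<n}. borel)"
    using assms by (intro measurable_restrict) auto
  then show "sets (pos_algebra M n Z) \<subseteq> sets M"
    unfolding pos_algebra_def by (auto simp: sets_vimage_algebra2 space_PiM measurable_sets)
qed

section \<open>Grids in a ball\<close>

definition grid :: "real \<Rightarrow> nat \<Rightarrow> (real ^ 'd) set" where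
  "grid r k = {x. norm x \<le> r \<and> (\<forall>c. \<exists>m::int. \<bar>m\<bar> \<le> 2 ^ k \<and> x $ c = r * of_int m / 2 ^ k)}"

lemma zero_in_grid: "0 \<le> r \<Longrightarrow> 0 \<in> grid r k"
  by (auto simp: grid_def intro!: exI[of _ 0])

lemma grid_finite_card:
  "finite (grid r k :: (real ^ 'd) set) \<and> card (grid r k :: (real ^ 'd) set) \<le> (3 * 2 ^ k) ^ CARD('d)"
proof -
  define T where "T = (\<lambda>m::int. r * of_int m / 2 ^ k) ` {- (2 ^ k)..2 ^ k}"
  have "finite T" by (simp add: T_def)
  have "card T \<le> card {- (2 ^ k)..(2 ^ k :: int)}"
    unfolding T_def by (rule card_image_le) simp
  also have "\<dots> = 2 * 2 ^ k + 1"
    by (simp add: nat_add_distrib nat_mult_distrib nat_power_eq)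
  also have "\<dots> \<le> 3 * 2 ^ k" by simp
  finally have T: "card T \<le> 3 * 2 ^ k" .
  have inj: "inj_on vec_nth (grid r k :: (real ^ 'd) set)"
    by (rule inj_onI) (simp add: vec_nth_inject)
  have sub: "vec_nth ` (grid r k :: (real ^ 'd) set) \<subseteq> (UNIV :: 'd set) \<rightarrow>\<^sub>E T"
  proof (clarsimp simp: PiE_def)
    fix x :: "real ^ 'd" and c assume "x \<in> grid r k"
    then obtain m :: int where "\<bar>m\<bar> \<le> 2 ^ k" "x $ c = r * of_int m / 2 ^ k"
      by (auto simp: grid_def)
    then show "x $ c \<in> T" unfolding T_def by (intro image_eqI[of _ _ m]) auto
  qed
  have fin: "finite ((UNIV :: 'd set) \<rightarrow>\<^sub>E T)"
    by (intro finite_PiE \<open>finite T\<close>) auto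
  have "card (grid r k :: (real ^ 'd) set) \<le> card ((UNIV :: 'd set) \<rightarrow>\<^sub>E T)"
    by (rule card_inj_on_le[OF inj sub fin])
  also have "\<dots> = card T ^ CARD('d)" by (simp add: card_PiE)
  also have "\<dots> \<le> (3 * 2 ^ k) ^ CARD('d)" using T by (rule power_mono) simp
  finally show ?thesis
    using finite_imageD[OF finite_subset[OF sub fin] inj] by blast
qed

text \<open>
  Coordinates are rounded towards zero, so that the grid point does not leave the ball.
\<close>

lemma grid_covers_ball:
  fixes x :: "real ^ 'd"
  assumes "norm x \<le> r"
  shows "\<exists>y\<in>grid r k. norm (x - y) \<le> real CARD('d) * r / 2 ^ k"
proof (cases "r = 0")
  case True
  with assms show ?thesis by (intro bexI[of _ 0]) (auto simp: zero_in_grid)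
next
  case False
  then have "0 < r" using assms norm_ge_zero[of x] by linarith
  define a where "a c = x $ c * 2 ^ k / r" for c
  define m where "m c = (if 0 \<le> a c then \<lfloor>a c\<rfloor> else \<lceil>a c\<rceil>)" for c
  define y :: "real ^ 'd" where "y = (\<chi> c. r * of_int (m c) / 2 ^ k)"
  have x: "x $ c = r * a c / 2 ^ k" for c
    using \<open>0 < r\<close> by (simp add: a_def)
  have m: "\<bar>real_of_int (m c)\<bar> \<le> \<bar>a c\<bar>" "\<bar>a c - of_int (m c)\<bar> \<le> 1" for c
    unfolding m_def by (auto split: if_splits; linarith)+
  have "\<bar>y $ c\<bar> \<le> \<bar>x $ c\<bar>" for c
    using m(1)[of c] \<open>0 < r\<close> by (simp add: x y_def abs_mult divide_right_mono mult_left_mono)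
  then have "norm y \<le> norm x"
    by (intro norm_le_componentwise_cart) auto
  moreover have "\<bar>m c\<bar> \<le> 2 ^ k" for c
  proof -
    have "\<bar>x $ c\<bar> \<le> r" using component_le_norm_cart[of x c] assms by linarith
    then have "\<bar>a c\<bar> \<le> 2 ^ k"
      using \<open>0 < r\<close> by (simp add: a_def abs_mult field_simps)
    with m(1)[of c] have "\<bar>real_of_int (m c)\<bar> \<le> 2 ^ k" by linarith
    then show ?thesis by (simp flip: of_int_abs of_int_power_eq_of_int_cancel_iff)
  qed
  ultimately have "y \<in> grid r k"
    using assms unfolding grid_def by (auto simp: y_def)
  moreover have "norm (x - y) \<le> real CARD('d) * r / 2 ^ k"
  proof -
    have "norm (x - y) \<le> (\<Sum>c\<in>UNIV. \<bar>(x - y) $ c\<bar>)" by (rule norm_le_l1_cart)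
    also have "\<dots> \<le> (\<Sum>c\<in>(UNIV :: 'd set). r / 2 ^ k)"
    proof (rule sum_mono)
      fix c
      have "(x - y) $ c = r / 2 ^ k * (a c - of_int (m c))"
        by (simp add: x y_def algebra_simps diff_divide_distrib)
      also have "\<bar>\<dots>\<bar> = r / 2 ^ k * \<bar>a c - of_int (m c)\<bar>"
        using \<open>0 < r\<close> by (simp add: abs_mult)
      also have "\<dots> \<le> r / 2 ^ k * 1"
        using \<open>0 < r\<close> m(2) by (intro mult_left_mono) auto
      finally show "\<bar>(x - y) $ c\<bar> \<le> r / 2 ^ k" by simp
    qed
    finally show ?thesis by simp
  qed
  ultimately show ?thesis by blast
qed

lemma sum_Suc_div_pow2_le: "(\<Sum>k<n. real (Suc k) / 2 ^ k) \<le> 4"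
proof -
  have "(\<Sum>k<n. real (Suc k) / 2 ^ k) = 4 - (2 * real n + 4) / 2 ^ n"
  proof (induction n)
    case (Suc n)
    have "(4::real) - (2 * real n + 4) / 2 ^ n + real (Suc n) / 2 ^ n = 4 - (2 * real (Suc n) + 4) / 2 ^ Suc n"
      by (simp add: divide_simps)
    with Suc show ?case by (simp only: sum.lessThan_Suc)
  qed simp
  then show ?thesis by simp
qed

text \<open>
  The union bound of one chaining step: the number of pairs of grid configurations at levels
  \<open>k\<close> and \<open>Suc k\<close>, times the tail at level \<open>2 d sqrt n (k + 1)\<close>.  The entropy is of order
  \<open>n d (k + 1)\<close>, the exponent of the tail of order \<open>n d\<^sup>2 (k + 1)\<^sup>2\<close>.
\<close>

lemma net_pairs_weight_le:
  fixes n d k :: nat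
  assumes "0 < d"
  shows "real (((3 * 2 ^ k) ^ d) ^ n * ((3 * 2 ^ Suc k) ^ d) ^ n) *
    exp (- 2 * (2 * real d * sqrt (real n) * real (Suc k))\<^sup>2) \<le> exp (- real n)"
proof -
  have "real (((3 * 2 ^ k) ^ d) ^ n * ((3 * 2 ^ Suc k) ^ d) ^ n) = (18 * 4 ^ k) ^ (d * n)"
  proof -
    have "(3 * 2 ^ k) * (3 * 2 ^ Suc k) = 18 * (2 ^ k * 2 ^ k :: nat)" by simp
    also have "2 ^ k * 2 ^ k = (4 ^ k :: nat)" by (simp flip: power_mult_distrib)
    finally have "((3 * 2 ^ k) ^ d) ^ n * ((3 * 2 ^ Suc k) ^ d) ^ n = ((18 * 4 ^ k) ^ d :: nat) ^ n"
      by (simp only: power_mult_distrib[symmetric])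
    then show ?thesis by (simp add: power_mult)
  qed
  also have "\<dots> \<le> exp (5 + 2 * real k) ^ (d * n)"
  proof (rule power_mono)
    have "(18::real) * 4 ^ k \<le> 2 ^ 5 * (2 ^ 2) ^ k" by simp
    also have "\<dots> = 2 ^ (5 + 2 * k)" by (simp only: power_add power_mult)
    also have "\<dots> \<le> exp 1 ^ (5 + 2 * k)"
      using exp_ge_add_one_self[of 1] by (intro power_mono) auto
    also have "\<dots> = exp (5 + 2 * real k)"
      by (simp flip: exp_of_nat_mult)
    finally show "18 * 4 ^ k \<le> exp (5 + 2 * real k)" .
  qed simp
  also have "\<dots> = exp (real (d * n) * (5 + 2 * real k))"
    by (simp only: exp_of_nat_mult)
  finally have "real (((3 * 2 ^ k) ^ d) ^ n * ((3 * 2 ^ Suc k) ^ d) ^ n) *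
      exp (- 2 * (2 * real d * sqrt (real n) * real (Suc k))\<^sup>2) \<le>
      exp (real (d * n) * (5 + 2 * real k)) * exp (- 2 * (2 * real d * sqrt (real n) * real (Suc k))\<^sup>2)"
    by (intro mult_right_mono) auto
  also have "\<dots> \<le> exp (- real n)"
  proof -
    have "real d * real (Suc k) \<ge> 1 * 1" using assms by (intro mult_mono) auto
    then have s: "1 \<le> real d * real (Suc k)" by simp
    then have "real d * real (Suc k) \<le> (real d * real (Suc k))\<^sup>2"
      by (simp add: power2_eq_square mult_le_cancel_left1)
    with s have "1 + 5 * (real d * real (Suc k)) \<le> 8 * (real d * real (Suc k))\<^sup>2" by linarith
    moreover have "real d * (5 + 2 * real k) \<le> real d * (5 * real (Suc k))"
      by (intro mult_left_mono) auto
    ultimately have "real d * (5 + 2 * real k) - 8 * (real d * real (Suc k))\<^sup>2 \<le> - 1" by linarith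
    then have "real n * (real d * (5 + 2 * real k) - 8 * (real d * real (Suc k))\<^sup>2) \<le> real n * (- 1)"
      by (intro mult_left_mono) auto
    moreover have "(2 * real d * sqrt (real n) * real (Suc k))\<^sup>2 = 4 * real n * (real d * real (Suc k))\<^sup>2"
      by (simp add: power_mult_distrib)
    ultimately show ?thesis by (simp flip: exp_add) (simp add: algebra_simps)
  qed
  finally show ?thesis .
qed

section \<open>Concentration of the edge noise\<close>

text \<open>
  The left-hand side is the moment generating function of a centred Bernoulli variable.  Negative
  \<open>s\<close> reduce to positive ones by exchanging success and failure.
\<close>

lemma hoeffding_bernoulli:
  fixes p s :: real
  assumes "0 \<le> p" "p \<le> 1"
  shows "exp (- (s * p)) * (1 + p * (exp s - 1)) \<le> exp (s\<^sup>2 / 8)"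
proof -
  have *: "exp (- (s * p)) * (1 + p * (exp s - 1)) \<le> exp (s\<^sup>2 / 8)"
    if "0 \<le> s" "0 \<le> p" for s p :: real
  proof -
    have pos: "0 < 1 + p * (exp s - 1)" using that by (intro add_pos_nonneg) auto
    have "exp (- (s * p)) * (1 + p * (exp s - 1)) = exp (- s * p + ln (1 + p * (exp s - 1)))"
      using pos by (simp add: exp_add exp_diff exp_minus field_simps)
    also have "\<dots> \<le> exp (s\<^sup>2 / 8)"
      using Hoeffdings_lemma_aux[OF that] by (simp only: exp_le_cancel_iff)
    finally show ?thesis .
  qed
  show ?thesis
  proof (cases "0 \<le> s")
    case True
    then show ?thesis using * assms by blast
  next
    case False
    have "exp (- (s * p)) * (1 + p * (exp s - 1)) =
        exp (- (- s * (1 - p))) * (1 + (1 - p) * (exp (- s) - 1))"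
      by (simp add: algebra_simps exp_diff exp_minus field_simps)
    also have "\<dots> \<le> exp ((- s)\<^sup>2 / 8)"
      using False assms by (intro *) auto
    finally show ?thesis by simp
  qed
qed

context
  fixes S :: "(real ^ 'd) set" and K :: "real \<Rightarrow> real" and M :: "nat \<Rightarrow> 'w measure"
    and Z :: "nat \<Rightarrow> 'w \<Rightarrow> nat \<Rightarrow> real ^ 'd" and Y :: "nat \<Rightarrow> 'w \<Rightarrow> real mat" and n :: nat
  assumes lpm: "lpm S K M Z Y" and cont: "continuous_on {0..} K"
begin

abbreviation (input) prob_at :: "'w \<Rightarrow> nat \<times> nat \<Rightarrow> real" where
  "prob_at \<omega> \<equiv> link_at K (Z n \<omega>)"

interpretation prob_space "M n"
  using lpm by (simp add: lpm_def)

interpretation finite_measure_subalgebra "M n" "pos_algebra (M n) n (Z n)"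
  using lpm by unfold_locales (auto simp: lpm_def intro!: subalgebra_pos_algebra)

lemma link_at_range: "0 \<le> link_at K z p" "link_at K z p \<le> 1"
  using lpm by (auto simp: lpm_def link_at_def)

lemma adjacency_measurable: "p \<in> dyads n \<Longrightarrow> (\<lambda>\<omega>. Y n \<omega> $$ p) \<in> borel_measurable (M n)"
  using lpm by (cases p) (auto simp: lpm_def cond_indep_vars_def)

lemma adjacency_0_1: "\<omega> \<in> space (M n) \<Longrightarrow> p \<in> dyads n \<Longrightarrow> Y n \<omega> $$ p \<in> {0, 1}"
  using lpm by (cases p) (auto simp: lpm_def)

lemma link_at_measurable: "p \<in> dyads n \<Longrightarrow> (\<lambda>\<omega>. link_at K (Z n \<omega>) p) \<in> borel_measurable (M n)"
  by (rule measurable_from_subalg[OF subalg measurable_link_at[OF cont]])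

text \<open>
  A product of entries of the adjacency matrix is the indicator of the event that all of them equal
  \<open>1\<close>, whose conditional probability factorizes.  This is the only form in which the conditional
  independence enters.
\<close>

lemma expectation_prod_adjacency:
  assumes J: "J \<subseteq> dyads n"
    and g: "g \<in> borel_measurable (pos_algebra (M n) n (Z n))" and bdd: "\<And>\<omega>. \<bar>g \<omega>\<bar> \<le> c"
  shows "expectation (\<lambda>\<omega>. g \<omega> * (\<Prod>p\<in>J. Y n \<omega> $$ p)) =
    expectation (\<lambda>\<omega>. g \<omega> * (\<Prod>p\<in>J. link_at K (Z n \<omega>) p))"
proof -
  let ?F = "pos_algebra (M n) n (Z n)"
  define A where "A = {\<omega> \<in> space (M n). \<forall>p\<in>J. (case p of (i, j) \<Rightarrow> \<lambda>\<omega>. Y n \<omega> $$ (i, j)) \<omega> \<in> {1}}"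
  have fin: "finite J" using J finite_dyads by (rule finite_subset)
  have gM [measurable]: "g \<in> borel_measurable (M n)"
    by (rule measurable_from_subalg[OF subalg g])
  have A_eq: "A = {\<omega> \<in> space (M n). \<forall>p\<in>J. Y n \<omega> $$ p = 1}"
    by (auto simp: A_def split: prod.splits)
  have A_meas [measurable]: "A \<in> sets (M n)"
    unfolding A_eq
  proof (rule sets.sets_Collect_finite_All[OF _ fin])
    fix p assume "p \<in> J"
    then have [measurable]: "(\<lambda>\<omega>. Y n \<omega> $$ p) \<in> borel_measurable (M n)"
      using J adjacency_measurable by auto
    show "{\<omega> \<in> space (M n). Y n \<omega> $$ p = 1} \<in> events" by measurable
  qed
  have "AE \<omega> in M n. cond_prob_given (M n) ?F A \<omega> =
      (\<Prod>p\<in>J. cond_prob_given (M n) ?F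
        {\<omega> \<in> space (M n). (case p of (i, j) \<Rightarrow> \<lambda>\<omega>. Y n \<omega> $$ (i, j)) \<omega> \<in> {1}} \<omega>)"
  proof -
    have "cond_indep_vars (M n) ?F borel (\<lambda>(i, j) \<omega>. Y n \<omega> $$ (i, j)) (dyads n)"
      using lpm by (simp add: lpm_def)
    then show ?thesis
      unfolding cond_indep_vars_def A_def using J fin by (elim conjE allE[of _ J] allE[of _ "\<lambda>_. {1}"]) auto
  qed
  moreover have "AE \<omega> in M n. \<forall>p\<in>J. cond_prob_given (M n) ?F
      {\<omega> \<in> space (M n). (case p of (i, j) \<Rightarrow> \<lambda>\<omega>. Y n \<omega> $$ (i, j)) \<omega> \<in> {1}} \<omega> = link_at K (Z n \<omega>) p"
  proof (intro AE_finite_allI[OF fin])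
    fix p assume "p \<in> J"
    then obtain i j where "p = (i, j)" "i < j" "j < n" using J by auto
    then show "AE \<omega> in M n. cond_prob_given (M n) ?F
        {\<omega> \<in> space (M n). (case p of (i, j) \<Rightarrow> \<lambda>\<omega>. Y n \<omega> $$ (i, j)) \<omega> \<in> {1}} \<omega> = link_at K (Z n \<omega>) p"
      using lpm by (simp add: lpm_def link_at_def)
  qed
  ultimately have ae: "AE \<omega> in M n. real_cond_exp (M n) ?F (indicator A) \<omega> = (\<Prod>p\<in>J. link_at K (Z n \<omega>) p)"
    by eventually_elim (simp add: cond_prob_given_def)
  have "expectation (\<lambda>\<omega>. g \<omega> * (\<Prod>p\<in>J. Y n \<omega> $$ p)) = expectation (\<lambda>\<omega>. g \<omega> * indicator A \<omega>)"
  proof (rule Bochner_Integration.integral_cong[OF refl])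
    fix \<omega> assume \<omega>: "\<omega> \<in> space (M n)"
    show "g \<omega> * (\<Prod>p\<in>J. Y n \<omega> $$ p) = g \<omega> * indicator A \<omega>"
    proof (cases "\<omega> \<in> A")
      case True
      then show ?thesis by (auto simp: A_eq)
    next
      case False
      then obtain p where p: "p \<in> J" "Y n \<omega> $$ p \<noteq> 1"
        using \<omega> by (auto simp: A_eq)
      then have "Y n \<omega> $$ p = 0"
        using adjacency_0_1[OF \<omega>, of p] J by auto
      then have "(\<Prod>p\<in>J. Y n \<omega> $$ p) = 0" using fin p by (auto simp: prod_zero_iff)
      then show ?thesis using False by simp
    qed
  qed
  also have "\<dots> = expectation (\<lambda>\<omega>. g \<omega> * real_cond_exp (M n) ?F (indicator A) \<omega>)"
  proof (rule real_cond_exp_intg(2)[symmetric])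
    show "integrable (M n) (\<lambda>\<omega>. g \<omega> * indicator A \<omega>)"
    proof (rule integrable_const_bound)
      have "norm (g \<omega> * indicator A \<omega>) \<le> c" for \<omega>
        using bdd[of \<omega>] by (auto simp: indicator_def)
      then show "AE \<omega> in M n. norm (g \<omega> * indicator A \<omega>) \<le> c" by simp
    qed measurable
  qed (use g in \<open>auto\<close>)
  also have "\<dots> = expectation (\<lambda>\<omega>. g \<omega> * (\<Prod>p\<in>J. link_at K (Z n \<omega>) p))"
  proof (rule integral_cong_AE)
    show "(\<lambda>\<omega>. g \<omega> * (\<Prod>p\<in>J. link_at K (Z n \<omega>) p)) \<in> borel_measurable (M n)"
      using J link_at_measurable by (intro borel_measurable_times borel_measurable_prod) auto
    show "AE \<omega> in M n. g \<omega> * real_cond_exp (M n) ?F (indicator A) \<omega> =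
        g \<omega> * (\<Prod>p\<in>J. link_at K (Z n \<omega>) p)"
      using ae by eventually_elim simp
  qed measurable
  finally show ?thesis .
qed

abbreviation (input) noise :: "(nat \<times> nat \<Rightarrow> real) \<Rightarrow> 'w \<Rightarrow> real" where
  "noise c \<omega> \<equiv> (\<Sum>p\<in>dyads n. c p * (Y n \<omega> $$ p - link_at K (Z n \<omega>) p))"

lemma noise_measurable: "noise c \<in> borel_measurable (M n)"
  by (intro borel_measurable_sum borel_measurable_times borel_measurable_diff borel_measurable_const
      adjacency_measurable link_at_measurable)

lemma exp_noise_integrable: "integrable (M n) (\<lambda>\<omega>. exp (noise c \<omega>))"
proof (rule integrable_const_bound)
  show "AE \<omega> in M n. norm (exp (noise c \<omega>)) \<le> exp (\<Sum>p\<in>dyads n. \<bar>c p\<bar>)"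
  proof (rule AE_I2)
    fix \<omega> assume \<omega>: "\<omega> \<in> space (M n)"
    have "c p * (Y n \<omega> $$ p - link_at K (Z n \<omega>) p) \<le> \<bar>c p\<bar>" if "p \<in> dyads n" for p
    proof -
      have "\<bar>Y n \<omega> $$ p - link_at K (Z n \<omega>) p\<bar> \<le> 1"
        using adjacency_0_1[OF \<omega> that] link_at_range[of "Z n \<omega>" p] by auto
      then have "\<bar>c p\<bar> * \<bar>Y n \<omega> $$ p - link_at K (Z n \<omega>) p\<bar> \<le> \<bar>c p\<bar> * 1"
        by (intro mult_left_mono) auto
      then show ?thesis by (simp flip: abs_mult)
    qed
    then show "norm (exp (noise c \<omega>)) \<le> exp (\<Sum>p\<in>dyads n. \<bar>c p\<bar>)"
      by (auto intro!: sum_mono)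
  qed
  show "(\<lambda>\<omega>. exp (noise c \<omega>)) \<in> borel_measurable (M n)"
    using noise_measurable by measurable
qed

text \<open>
  Since the entries are \<open>0\<close> or \<open>1\<close>, \<open>exp (c Y) = 1 + (exp c - 1) Y\<close>.  Expanding the product over all
  pairs expresses the moment generating function through expectations of products of entries, which
  may be replaced by products of link probabilities.  Refolding the product leaves one Bernoulli factor
  per pair.
\<close>

lemma expectation_exp_noise_le:
  "expectation (\<lambda>\<omega>. exp (noise c \<omega>)) \<le> exp (\<Sum>p\<in>dyads n. (c p)\<^sup>2 / 8)"
proof -
  let ?P = "\<lambda>\<omega>. link_at K (Z n \<omega>)"
  define g where "g \<omega> = exp (- (\<Sum>p\<in>dyads n. c p * ?P \<omega> p))" for \<omega>
  define u where "u p = exp (c p) - 1" for p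
  have gF: "g \<in> borel_measurable (pos_algebra (M n) n (Z n))"
    unfolding g_def by (intro measurable_compose[OF _ borel_measurable_exp] borel_measurable_uminus
      borel_measurable_sum borel_measurable_times borel_measurable_const measurable_link_at[OF cont])
  have bdd: "\<bar>g \<omega>\<bar> \<le> exp (\<Sum>p\<in>dyads n. \<bar>c p\<bar>)" for \<omega>
  proof -
    have "- (c p * ?P \<omega> p) \<le> \<bar>c p\<bar>" for p
    proof -
      have "\<bar>c p\<bar> * \<bar>?P \<omega> p\<bar> \<le> \<bar>c p\<bar> * 1"
        using link_at_range[of "Z n \<omega>" p] by (intro mult_left_mono) auto
      then show ?thesis by (simp flip: abs_mult)
    qed
    then show ?thesis by (auto simp: g_def sum_negf[symmetric] intro!: sum_mono)
  qed
  have gM: "g \<in> borel_measurable (M n)"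
    by (rule measurable_from_subalg[OF subalg gF])
  have int: "integrable (M n) (\<lambda>\<omega>. g \<omega> * (\<Prod>p\<in>J. f \<omega> p))"
    if "\<And>p. p \<in> J \<Longrightarrow> (\<lambda>\<omega>. f \<omega> p) \<in> borel_measurable (M n)"
      "\<And>\<omega> p. \<omega> \<in> space (M n) \<Longrightarrow> p \<in> J \<Longrightarrow> 0 \<le> f \<omega> p \<and> f \<omega> p \<le> 1" for J f
  proof (rule integrable_const_bound)
    show "AE \<omega> in M n. norm (g \<omega> * (\<Prod>p\<in>J. f \<omega> p)) \<le> exp (\<Sum>p\<in>dyads n. \<bar>c p\<bar>)"
    proof (rule AE_I2)
      fix \<omega> assume \<omega>: "\<omega> \<in> space (M n)"
      have "0 \<le> (\<Prod>p\<in>J. f \<omega> p)" "(\<Prod>p\<in>J. f \<omega> p) \<le> 1"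
        using that(2)[OF \<omega>] by (auto intro!: prod_nonneg prod_le_1)
      then have "\<bar>g \<omega>\<bar> * \<bar>\<Prod>p\<in>J. f \<omega> p\<bar> \<le> exp (\<Sum>p\<in>dyads n. \<bar>c p\<bar>) * 1"
        using bdd by (intro mult_mono) auto
      then show "norm (g \<omega> * (\<Prod>p\<in>J. f \<omega> p)) \<le> exp (\<Sum>p\<in>dyads n. \<bar>c p\<bar>)"
        by (simp add: abs_mult)
    qed
  qed (use that gM in \<open>auto intro!: borel_measurable_times borel_measurable_prod\<close>)
  have expand: "g \<omega> * (\<Prod>p\<in>dyads n. 1 + u p * f p) =
      (\<Sum>J\<in>Pow (dyads n). (\<Prod>p\<in>J. u p) * (g \<omega> * (\<Prod>p\<in>J. f p)))" for \<omega> f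
  proof -
    have "(\<Prod>p\<in>dyads n. 1 + u p * f p) = (\<Sum>J\<in>Pow (dyads n). (\<Prod>p\<in>J. u p * f p))"
      using prod_add[OF finite_dyads, of "\<lambda>p. u p * f p" "\<lambda>_. 1" n] by (simp add: add.commute)
    then show ?thesis by (simp add: prod.distrib sum_distrib_left mult_ac)
  qed
  have swap: "expectation (\<lambda>\<omega>. g \<omega> * (\<Prod>p\<in>dyads n. 1 + u p * f \<omega> p)) =
      (\<Sum>J\<in>Pow (dyads n). (\<Prod>p\<in>J. u p) * expectation (\<lambda>\<omega>. g \<omega> * (\<Prod>p\<in>J. f \<omega> p)))"
    if "\<And>p. p \<in> dyads n \<Longrightarrow> (\<lambda>\<omega>. f \<omega> p) \<in> borel_measurable (M n)"
      "\<And>\<omega> p. \<omega> \<in> space (M n) \<Longrightarrow> p \<in> dyads n \<Longrightarrow> 0 \<le> f \<omega> p \<and> f \<omega> p \<le> 1" for f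
    unfolding expand
  proof (subst Bochner_Integration.integral_sum)
    fix J assume "J \<in> Pow (dyads n)"
    then show "integrable (M n) (\<lambda>\<omega>. (\<Prod>p\<in>J. u p) * (g \<omega> * (\<Prod>p\<in>J. f \<omega> p)))"
      using that by (intro integrable_mult_right int) auto
  qed simp
  have "expectation (\<lambda>\<omega>. exp (noise c \<omega>)) =
      expectation (\<lambda>\<omega>. g \<omega> * (\<Prod>p\<in>dyads n. 1 + u p * Y n \<omega> $$ p))"
  proof (rule Bochner_Integration.integral_cong[OF refl])
    fix \<omega> assume \<omega>: "\<omega> \<in> space (M n)"
    have "exp (noise c \<omega>) = g \<omega> * (\<Prod>p\<in>dyads n. exp (c p * Y n \<omega> $$ p))"
      by (simp add: g_def right_diff_distrib sum_subtractf exp_sum[OF finite_dyads, symmetric] exp_add[symmetric])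
    also have "(\<Prod>p\<in>dyads n. exp (c p * Y n \<omega> $$ p)) = (\<Prod>p\<in>dyads n. 1 + u p * Y n \<omega> $$ p)"
    proof (rule prod.cong[OF refl])
      fix p assume "p \<in> dyads n"
      from adjacency_0_1[OF \<omega> this]
      show "exp (c p * Y n \<omega> $$ p) = 1 + u p * Y n \<omega> $$ p" by (auto simp: u_def)
    qed
    finally show "exp (noise c \<omega>) = g \<omega> * (\<Prod>p\<in>dyads n. 1 + u p * Y n \<omega> $$ p)" .
  qed
  also have "\<dots> = (\<Sum>J\<in>Pow (dyads n). (\<Prod>p\<in>J. u p) * expectation (\<lambda>\<omega>. g \<omega> * (\<Prod>p\<in>J. Y n \<omega> $$ p)))"
  proof (rule swap)
    fix \<omega> p assume "\<omega> \<in> space (M n)" "p \<in> dyads n"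
    from adjacency_0_1[OF this] show "0 \<le> Y n \<omega> $$ p \<and> Y n \<omega> $$ p \<le> 1" by auto
  qed (rule adjacency_measurable)
  also have "\<dots> = (\<Sum>J\<in>Pow (dyads n). (\<Prod>p\<in>J. u p) * expectation (\<lambda>\<omega>. g \<omega> * (\<Prod>p\<in>J. ?P \<omega> p)))"
    by (intro sum.cong refl arg_cong2[where f = "(*)"] expectation_prod_adjacency[OF _ gF bdd]) auto
  also have "\<dots> = expectation (\<lambda>\<omega>. g \<omega> * (\<Prod>p\<in>dyads n. 1 + u p * ?P \<omega> p))"
    by (intro swap[symmetric] conjI link_at_measurable link_at_range)
  also have "\<dots> \<le> expectation (\<lambda>\<omega>. exp (\<Sum>p\<in>dyads n. (c p)\<^sup>2 / 8))"
  proof (rule integral_mono)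
    show "integrable (M n) (\<lambda>\<omega>. g \<omega> * (\<Prod>p\<in>dyads n. 1 + u p * ?P \<omega> p))"
      unfolding expand
      by (intro Bochner_Integration.integrable_sum integrable_mult_right int conjI
          link_at_measurable link_at_range) auto
    fix \<omega>
    have "g \<omega> * (\<Prod>p\<in>dyads n. 1 + u p * ?P \<omega> p) =
        (\<Prod>p\<in>dyads n. exp (- (c p * ?P \<omega> p)) * (1 + ?P \<omega> p * (exp (c p) - 1)))"
      by (simp add: g_def u_def prod.distrib exp_sum finite_dyads sum_negf[symmetric] mult.commute)
    also have "\<dots> \<le> (\<Prod>p\<in>dyads n. exp ((c p)\<^sup>2 / 8))"
    proof (rule prod_mono)
      fix p
      have r: "0 \<le> ?P \<omega> p" "?P \<omega> p \<le> 1" by (rule link_at_range)+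
      have "1 + ?P \<omega> p * (exp (c p) - 1) = (1 - ?P \<omega> p) + ?P \<omega> p * exp (c p)"
        by (simp add: algebra_simps)
      also have "\<dots> \<ge> 0" using r by (intro add_nonneg_nonneg) auto
      finally have "0 \<le> exp (- (c p * ?P \<omega> p)) * (1 + ?P \<omega> p * (exp (c p) - 1))"
        by simp
      moreover have "exp (- (c p * ?P \<omega> p)) * (1 + ?P \<omega> p * (exp (c p) - 1)) \<le> exp ((c p)\<^sup>2 / 8)"
        by (rule hoeffding_bernoulli[OF r])
      ultimately show "0 \<le> exp (- (c p * ?P \<omega> p)) * (1 + ?P \<omega> p * (exp (c p) - 1)) \<and>
          exp (- (c p * ?P \<omega> p)) * (1 + ?P \<omega> p * (exp (c p) - 1)) \<le> exp ((c p)\<^sup>2 / 8)" ..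
    qed
    finally show "g \<omega> * (\<Prod>p\<in>dyads n. 1 + u p * ?P \<omega> p) \<le> exp (\<Sum>p\<in>dyads n. (c p)\<^sup>2 / 8)"
      by (simp add: exp_sum finite_dyads)
  qed simp
  finally show ?thesis by (simp add: prob_space)
qed

lemma noise_upper_tail:
  assumes c: "\<And>p. p \<in> dyads n \<Longrightarrow> \<bar>c p\<bar> \<le> w" and "0 < n" "0 < \<tau>" "0 < w"
  shows "prob {\<omega> \<in> space (M n). noise c \<omega> \<ge> \<tau> * real n * w} \<le> exp (- 2 * \<tau>\<^sup>2)"
proof -
  \<comment> \<open>The minimizer of \<open>(l w n)\<^sup>2 / 8 - l \<tau> n w\<close>.\<close>
  define l where "l = 4 * \<tau> / (real n * w)"
  have "0 < l" using assms by (simp add: l_def)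
  have scale: "noise (\<lambda>p. l * c p) \<omega> = l * noise c \<omega>" for \<omega>
    by (simp only: sum_distrib_left mult.assoc)
  have int: "integrable (M n) (\<lambda>\<omega>. exp (l * noise c \<omega>))"
    using exp_noise_integrable[of "\<lambda>p. l * c p"] by (simp only: scale)
  have "(\<Sum>p\<in>dyads n. (l * c p)\<^sup>2 / 8) \<le> (\<Sum>p\<in>dyads n. (l * w)\<^sup>2 / 8)"
  proof (intro sum_mono divide_right_mono)
    fix p assume "p \<in> dyads n"
    then have "\<bar>l * c p\<bar> \<le> \<bar>l * w\<bar>"
      using c \<open>0 < l\<close> \<open>0 < w\<close> by (simp add: abs_mult)
    then show "(l * c p)\<^sup>2 \<le> (l * w)\<^sup>2" by (simp only: abs_le_square_iff)
  qed simp
  also have "\<dots> = real (card (dyads n)) * ((l * w)\<^sup>2 / 8)" by simp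
  also have "\<dots> \<le> (real n)\<^sup>2 * ((l * w)\<^sup>2 / 8)"
    using card_dyads_le[of n] by (intro mult_right_mono) (simp_all flip: of_nat_power)
  also have "\<dots> = 2 * \<tau>\<^sup>2"
    using assms by (simp add: l_def power_mult_distrib power_divide)
  finally have V: "(\<Sum>p\<in>dyads n. (l * c p)\<^sup>2 / 8) \<le> 2 * \<tau>\<^sup>2" .
  have lt: "- l * (\<tau> * real n * w) = - 4 * \<tau>\<^sup>2"
    using assms by (simp add: l_def power2_eq_square)
  have "prob {\<omega> \<in> space (M n). noise c \<omega> \<ge> \<tau> * real n * w} \<le>
      exp (- l * (\<tau> * real n * w)) * (\<integral>\<omega>\<in>space (M n). exp (l * noise c \<omega>) \<partial>M n)"
  proof (rule Chernoff_ineq_ge[OF \<open>0 < l\<close>])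
    show "set_integrable (M n) (space (M n)) (\<lambda>\<omega>. exp (l * noise c \<omega>))"
      unfolding set_integrable_def using int by (rule integrable_mult_indicator[OF sets.top])
  qed simp
  also have "(\<integral>\<omega>\<in>space (M n). exp (l * noise c \<omega>) \<partial>M n) = expectation (\<lambda>\<omega>. exp (l * noise c \<omega>))"
    by (rule set_integral_space[OF int])
  also have "exp (- l * (\<tau> * real n * w)) * \<dots> \<le> exp (- 4 * \<tau>\<^sup>2) * exp (2 * \<tau>\<^sup>2)"
  proof (unfold lt, rule mult_left_mono)
    have "expectation (\<lambda>\<omega>. exp (l * noise c \<omega>)) \<le> exp (\<Sum>p\<in>dyads n. (l * c p)\<^sup>2 / 8)"
      using expectation_exp_noise_le[of "\<lambda>p. l * c p"] by (simp only: scale)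
    also have "\<dots> \<le> exp (2 * \<tau>\<^sup>2)" using V by (simp only: exp_le_cancel_iff)
    finally show "expectation (\<lambda>\<omega>. exp (l * noise c \<omega>)) \<le> exp (2 * \<tau>\<^sup>2)" .
  qed simp
  also have "\<dots> = exp (- 2 * \<tau>\<^sup>2)"
    by (simp flip: exp_add)
  finally show ?thesis .
qed

text \<open>
  Hoeffding's inequality, with a uniform bound \<open>w\<close> on the at most \<open>n\<^sup>2\<close> weights.
\<close>

lemma noise_tail:
  assumes c: "\<And>p. p \<in> dyads n \<Longrightarrow> \<bar>c p\<bar> \<le> w" and "0 < n" "0 < \<tau>" "0 \<le> w"
  shows "prob {\<omega> \<in> space (M n). \<bar>noise c \<omega>\<bar> > \<tau> * real n * w} \<le> 2 * exp (- 2 * \<tau>\<^sup>2)"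
proof (cases "w = 0")
  case True
  then have "noise c \<omega> = 0" for \<omega>
    using c by (intro sum.neutral) auto
  then show ?thesis using True by simp
next
  case False
  then have "0 < w" using assms by simp
  let ?U = "\<lambda>c. {\<omega> \<in> space (M n). noise c \<omega> \<ge> \<tau> * real n * w}"
  have neg: "noise (\<lambda>p. - c p) \<omega> = - noise c \<omega>" for \<omega>
    by (simp add: sum_negf)
  have meas: "?U c \<in> events" for c
    using noise_measurable[of c] by measurable
  have "prob {\<omega> \<in> space (M n). \<bar>noise c \<omega>\<bar> > \<tau> * real n * w} \<le> prob (?U c \<union> ?U (\<lambda>p. - c p))"
  proof (rule finite_measure_mono)
    show "{\<omega> \<in> space (M n). \<bar>noise c \<omega>\<bar> > \<tau> * real n * w} \<subseteq> ?U c \<union> ?U (\<lambda>p. - c p)"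
    proof
      fix \<omega> assume "\<omega> \<in> {\<omega> \<in> space (M n). \<bar>noise c \<omega>\<bar> > \<tau> * real n * w}"
      then have "\<omega> \<in> space (M n)" "noise c \<omega> \<ge> \<tau> * real n * w \<or> - noise c \<omega> \<ge> \<tau> * real n * w"
        by (simp_all only: mem_Collect_eq) linarith
      then show "\<omega> \<in> ?U c \<union> ?U (\<lambda>p. - c p)" unfolding neg by blast
    qed
  qed (intro sets.Un meas)
  also have "\<dots> \<le> prob (?U c) + prob (?U (\<lambda>p. - c p))"
    by (intro measure_Un_le meas)
  also have "\<dots> \<le> exp (- 2 * \<tau>\<^sup>2) + exp (- 2 * \<tau>\<^sup>2)"
    using c assms \<open>0 < w\<close> by (intro add_mono noise_upper_tail) auto
  finally show ?thesis by simp
qed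

lemma noise_diff: "noise c \<omega> - noise c' \<omega> = noise (\<lambda>p. c p - c' p) \<omega>"
  by (simp add: sum_subtractf[symmetric] left_diff_distrib)

lemma noise_abs_le:
  assumes \<omega>: "\<omega> \<in> space (M n)" and c: "\<And>p. p \<in> dyads n \<Longrightarrow> \<bar>c p\<bar> \<le> w" and "0 \<le> w"
  shows "\<bar>noise c \<omega>\<bar> \<le> (real n)\<^sup>2 * w"
proof -
  have "\<bar>noise c \<omega>\<bar> \<le> (\<Sum>p\<in>dyads n. \<bar>c p * (Y n \<omega> $$ p - link_at K (Z n \<omega>) p)\<bar>)" by (rule sum_abs)
  also have "\<dots> \<le> (\<Sum>p\<in>dyads n. w)"
  proof (rule sum_mono)
    fix p assume p: "p \<in> dyads n"
    have "\<bar>Y n \<omega> $$ p - link_at K (Z n \<omega>) p\<bar> \<le> 1"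
      using adjacency_0_1[OF \<omega> p] link_at_range[of "Z n \<omega>" p] by auto
    then have "\<bar>c p\<bar> * \<bar>Y n \<omega> $$ p - link_at K (Z n \<omega>) p\<bar> \<le> w * 1"
      using c[OF p] \<open>0 \<le> w\<close> by (intro mult_mono) auto
    then show "\<bar>c p * (Y n \<omega> $$ p - link_at K (Z n \<omega>) p)\<bar> \<le> w" by (simp add: abs_mult)
  qed
  also have "\<dots> = real (card (dyads n)) * w" by simp
  also have "\<dots> \<le> (real n)\<^sup>2 * w"
    using card_dyads_le[of n] \<open>0 \<le> w\<close> by (intro mult_right_mono) (simp_all flip: of_nat_power)
  finally show ?thesis .
qed

text \<open>
  Chaining.  Configurations are approximated on grids of mesh \<open>r / 2^k\<close>, starting from the zero
  configuration at level \<open>0\<close>.  An increment between neighbouring levels \<open>k\<close> and \<open>Suc k\<close> has weights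
  of order \<open>L d r / 2^k\<close>; outside of the exceptional event it is at most \<open>2 d sqrt n (k + 1)\<close> times
  \<open>n\<close> times that weight, which is summable over \<open>k\<close>.  The chain stops at level \<open>n\<close>, where the trivial
  bound on the noise suffices because \<open>n / 2^n \<le> 1\<close>.
\<close>

lemma noise_uniform_bound:
  fixes h :: "real ^ 'd \<Rightarrow> real ^ 'd \<Rightarrow> real"
  assumes lip: "\<And>x y x' y'. \<lbrakk>norm x \<le> r; norm y \<le> r; norm x' \<le> r; norm y' \<le> r\<rbrakk> \<Longrightarrow>
      \<bar>h x y - h x' y'\<bar> \<le> L * (norm (x - x') + norm (y - y'))"
    and "0 < n" "0 \<le> r" "0 \<le> L"
  defines "hh \<equiv> \<lambda>z p. h (z (fst p)) (z (snd p))"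
  shows "\<exists>E\<in>events. prob E \<le> 2 * real n * exp (- real n) \<and>
    (\<forall>\<omega>\<in>space (M n) - E. \<forall>z. (\<forall>i<n. norm (z i) \<le> r) \<longrightarrow>
      \<bar>noise (hh z) \<omega> - noise (hh (\<lambda>_. 0)) \<omega>\<bar> \<le> 34 * (real CARD('d))\<^sup>2 * L * r * (real n * sqrt (real n)))"
proof -
  let ?d = "real CARD('d)"
  define N where "N k = {..<n} \<rightarrow>\<^sub>E (grid r k :: (real ^ 'd) set)" for k
  define rad where "rad k = ?d * r / 2 ^ k" for k
  define pairs where "pairs k = {(u, v) \<in> N k \<times> N (Suc k). \<forall>i<n. norm (v i - u i) \<le> 2 * rad k}" for k
  define w where "w k = 4 * L * rad k" for k
  define \<tau> where "\<tau> k = 2 * ?d * sqrt (real n) * real (Suc k)" for k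
  define B where "B k uv = {\<omega> \<in> space (M n).
      \<bar>noise (\<lambda>p. hh (snd uv) p - hh (fst uv) p) \<omega>\<bar> > \<tau> k * real n * w k}" for k uv
  define E where "E = (\<Union>k<n. \<Union>uv\<in>pairs k. B k uv)"
  have rad: "0 \<le> rad k" for k using \<open>0 \<le> r\<close> by (simp add: rad_def)
  have w: "0 \<le> w k" for k using rad \<open>0 \<le> L\<close> by (simp add: w_def)
  have \<tau>: "0 < \<tau> k" for k using \<open>0 < n\<close> by (simp add: \<tau>_def)
  have finN: "finite (N k)" for k
    unfolding N_def using grid_finite_card[where 'd = 'd] by (intro finite_PiE) auto
  have cardN: "card (N k) \<le> ((3 * 2 ^ k) ^ CARD('d)) ^ n" for k
    unfolding N_def using grid_finite_card[where 'd = 'd, of r k]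
    by (subst card_PiE) (auto intro!: power_mono)
  have finP: "finite (pairs k)" for k
    unfolding pairs_def by (rule finite_subset[OF _ finite_cartesian_product[OF finN finN, of k "Suc k"]]) auto
  have cardP: "card (pairs k) \<le> ((3 * 2 ^ k) ^ CARD('d)) ^ n * ((3 * 2 ^ Suc k) ^ CARD('d)) ^ n" for k
  proof -
    have "card (pairs k) \<le> card (N k \<times> N (Suc k))"
      unfolding pairs_def using finN by (intro card_mono finite_cartesian_product) auto
    also have "\<dots> \<le> ((3 * 2 ^ k) ^ CARD('d)) ^ n * ((3 * 2 ^ Suc k) ^ CARD('d)) ^ n"
      unfolding card_cartesian_product by (intro mult_mono cardN) auto
    finally show ?thesis .
  qed
  have N_ball: "norm (u i) \<le> r" if "u \<in> N k" "i < n" for u k i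
  proof -
    have "u i \<in> grid r k" using that by (auto simp: N_def)
    then show ?thesis by (simp add: grid_def)
  qed
  have incr: "\<bar>hh z p - hh u p\<bar> \<le> 2 * L * s"
    if p: "p \<in> dyads n" and z: "\<And>i. i < n \<Longrightarrow> norm (z i) \<le> r" and u: "\<And>i. i < n \<Longrightarrow> norm (u i) \<le> r"
      and s: "\<And>i. i < n \<Longrightarrow> norm (z i - u i) \<le> s" for z u s p
  proof -
    have i: "fst p < n" "snd p < n" using p by auto
    have "\<bar>hh z p - hh u p\<bar> \<le> L * (norm (z (fst p) - u (fst p)) + norm (z (snd p) - u (snd p)))"
      unfolding hh_def using i z u by (intro lip) auto
    also have "\<dots> \<le> L * (s + s)"
      using i s \<open>0 \<le> L\<close> by (intro mult_left_mono add_mono) auto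
    finally show ?thesis by simp
  qed
  have B_meas: "B k uv \<in> events" for k uv
    unfolding B_def using noise_measurable[of "\<lambda>p. hh (snd uv) p - hh (fst uv) p"] by measurable
  have B_prob: "prob (B k uv) \<le> 2 * exp (- 2 * (\<tau> k)\<^sup>2)" if uv: "uv \<in> pairs k" for k uv
    unfolding B_def
  proof (rule noise_tail[OF _ \<open>0 < n\<close> \<tau> w])
    fix p assume p: "p \<in> dyads n"
    have "\<bar>hh (snd uv) p - hh (fst uv) p\<bar> \<le> 2 * L * (2 * rad k)"
      using uv N_ball by (intro incr[OF p]) (auto simp: pairs_def)
    then show "\<bar>hh (snd uv) p - hh (fst uv) p\<bar> \<le> w k" by (simp add: w_def)
  qed
  have E_meas: "E \<in> events"
    unfolding E_def using B_meas finP by (intro sets.finite_UN) auto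
  have "prob E \<le> (\<Sum>k<n. prob (\<Union>uv\<in>pairs k. B k uv))"
    unfolding E_def using B_meas finP by (intro measure_UNION_le sets.finite_UN) auto
  also have "\<dots> \<le> (\<Sum>k<n. 2 * exp (- real n))"
  proof (rule sum_mono)
    fix k
    have "prob (\<Union>uv\<in>pairs k. B k uv) \<le> (\<Sum>uv\<in>pairs k. prob (B k uv))"
      using B_meas finP by (intro measure_UNION_le) auto
    also have "\<dots> \<le> (\<Sum>uv\<in>pairs k. 2 * exp (- 2 * (\<tau> k)\<^sup>2))"
      by (intro sum_mono B_prob)
    also have "\<dots> = 2 * (real (card (pairs k)) * exp (- 2 * (\<tau> k)\<^sup>2))" by simp
    also have "\<dots> \<le> 2 * (real (((3 * 2 ^ k) ^ CARD('d)) ^ n * ((3 * 2 ^ Suc k) ^ CARD('d)) ^ n) *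
        exp (- 2 * (\<tau> k)\<^sup>2))"
      using cardP by (intro mult_left_mono mult_right_mono) (simp_all only: of_nat_le_iff, auto)
    also have "\<dots> \<le> 2 * exp (- real n)"
      unfolding \<tau>_def by (intro mult_left_mono net_pairs_weight_le) auto
    finally show "prob (\<Union>uv\<in>pairs k. B k uv) \<le> 2 * exp (- real n)" .
  qed
  finally have E_prob: "prob E \<le> 2 * real n * exp (- real n)" by simp
  have bound: "\<bar>noise (hh z) \<omega> - noise (hh (\<lambda>_. 0)) \<omega>\<bar> \<le> 34 * ?d\<^sup>2 * L * r * (real n * sqrt (real n))"
    if \<omega>: "\<omega> \<in> space (M n)" "\<omega> \<notin> E" and z: "\<And>i. i < n \<Longrightarrow> norm (z i) \<le> r" for \<omega> z
  proof -
    have "\<forall>k i. \<exists>y. i < n \<longrightarrow> y \<in> grid r k \<and> norm (z i - y) \<le> rad k"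
      using grid_covers_ball[OF z] unfolding rad_def by blast
    then obtain y where y: "\<And>i k. i < n \<Longrightarrow> y k i \<in> grid r k \<and> norm (z i - y k i) \<le> rad k"
      by metis
    \<comment> \<open>The grids at level \<open>0\<close> contain the zero configuration, whose distance \<open>r\<close> is at most \<open>rad 0 = d r\<close>.\<close>
    define q where "q k = (\<lambda>i\<in>{..<n}. if k = 0 then 0 else y k i)" for k :: nat
    have qN: "q k \<in> N k" for k
      using y zero_in_grid[OF \<open>0 \<le> r\<close>] by (auto simp: q_def N_def)
    have q_near: "norm (z i - q k i) \<le> rad k" if "i < n" for i k
    proof (cases "k = 0")
      case True
      have "1 * r \<le> ?d * r" using \<open>0 \<le> r\<close> by (intro mult_right_mono) auto
      then show ?thesis using z[OF that] that True by (simp add: q_def rad_def)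
    next
      case False
      then show ?thesis using y that by (simp add: q_def)
    qed
    have step: "\<bar>noise (hh (q (Suc k))) \<omega> - noise (hh (q k)) \<omega>\<bar> \<le> \<tau> k * real n * w k" if "k < n" for k
    proof -
      have "norm (q (Suc k) i - q k i) \<le> 2 * rad k" if "i < n" for i
      proof -
        have "norm (q (Suc k) i - q k i) \<le> norm (z i - q k i) + norm (z i - q (Suc k) i)"
          using norm_triangle_ineq4[of "z i - q k i" "z i - q (Suc k) i"] by simp
        also have "\<dots> \<le> rad k + rad (Suc k)"
          using q_near[OF that] by (intro add_mono)
        also have "rad (Suc k) \<le> rad k"
          using \<open>0 \<le> r\<close> by (simp add: rad_def field_simps)
        finally show ?thesis by simp
      qed
      then have "(q k, q (Suc k)) \<in> pairs k" using qN by (simp add: pairs_def)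
      then have "\<omega> \<notin> B k (q k, q (Suc k))" using \<omega>(2) \<open>k < n\<close> by (auto simp: E_def)
      then show ?thesis unfolding noise_diff using \<omega>(1) by (simp add: B_def not_less)
    qed
    have "noise (hh (q n)) \<omega> - noise (hh (q 0)) \<omega> =
        (\<Sum>k<n. noise (hh (q (Suc k))) \<omega> - noise (hh (q k)) \<omega>)"
      by (rule sum_lessThan_telescope[symmetric])
    also have "\<bar>\<dots>\<bar> \<le> (\<Sum>k<n. \<tau> k * real n * w k)"
      using step by (intro order.trans[OF sum_abs] sum_mono) auto
    also have "\<dots> = 8 * ?d\<^sup>2 * L * r * (real n * sqrt (real n)) * (\<Sum>k<n. real (Suc k) / 2 ^ k)"
      unfolding sum_distrib_left
      by (intro sum.cong refl) (simp add: \<tau>_def w_def rad_def power2_eq_square field_simps)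
    also have "\<dots> \<le> 8 * ?d\<^sup>2 * L * r * (real n * sqrt (real n)) * 4"
      using \<open>0 \<le> r\<close> \<open>0 \<le> L\<close> by (intro mult_left_mono sum_Suc_div_pow2_le) auto
    finally have 1: "\<bar>noise (hh (q n)) \<omega> - noise (hh (q 0)) \<omega>\<bar> \<le> 32 * ?d\<^sup>2 * L * r * (real n * sqrt (real n))"
      by simp
    have 2: "noise (hh (q 0)) \<omega> = noise (hh (\<lambda>_. 0)) \<omega>"
      by (intro sum.cong refl) (auto simp: hh_def q_def)
    have "\<bar>noise (hh z) \<omega> - noise (hh (q n)) \<omega>\<bar> \<le> (real n)\<^sup>2 * (2 * L * rad n)"
      unfolding noise_diff
    proof (rule noise_abs_le[OF \<omega>(1)])
      fix p assume p: "p \<in> dyads n"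
      show "\<bar>hh z p - hh (q n) p\<bar> \<le> 2 * L * rad n"
        using z q_near N_ball[OF qN] by (intro incr[OF p])
    qed (use rad \<open>0 \<le> L\<close> in auto)
    also have "\<dots> = 2 * L * r * real n * (?d * (real n / 2 ^ n))"
      by (simp add: rad_def power2_eq_square)
    also have "\<dots> \<le> 2 * L * r * real n * (?d\<^sup>2 * sqrt (real n))"
    proof (intro mult_left_mono mult_mono)
      have "real n \<le> 2 ^ n" using of_nat_less_two_power[of n, where 'a = real] by linarith
      then have "real n / 2 ^ n \<le> 1" by simp
      also have "1 \<le> sqrt (real n)" using \<open>0 < n\<close> by simp
      finally show "real n / 2 ^ n \<le> sqrt (real n)" .
      show "?d \<le> ?d\<^sup>2" by (simp add: power2_eq_square)
    qed (use \<open>0 \<le> r\<close> \<open>0 \<le> L\<close> in auto)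
    finally have 3: "\<bar>noise (hh z) \<omega> - noise (hh (q n)) \<omega>\<bar> \<le> 2 * ?d\<^sup>2 * L * r * (real n * sqrt (real n))"
      by (simp add: mult_ac)
    from 1 2 3 show ?thesis by linarith
  qed
  show ?thesis
    using E_meas E_prob bound by (intro bexI[of _ E] conjI) auto
qed

end

section \<open>The Poisson likelihood and its maximizer\<close>

text \<open>
  With \<open>r = sqrt (q / p)\<close>, the claim reads \<open>(r - 1)\<^sup>2 \<le> r\<^sup>2 - 1 - 2 ln r\<close>, which is \<open>ln r \<le> r - 1\<close>.
\<close>

lemma sq_sqrt_diff_le_poisson_divergence:
  fixes p q :: real
  assumes "0 < p" "0 < q"
  shows "(sqrt p - sqrt q)\<^sup>2 \<le> q - p - p * (ln q - ln p)"
proof -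
  have "ln (sqrt q / sqrt p) \<le> sqrt q / sqrt p - 1"
    using assms by (intro ln_le_minus_one) auto
  then have "ln q - ln p \<le> 2 * (sqrt q / sqrt p - 1)"
    using assms by (simp add: ln_div ln_sqrt)
  then have "p * (ln q - ln p) \<le> p * (2 * (sqrt q / sqrt p - 1))"
    using assms by (intro mult_left_mono) auto
  also have "\<dots> = 2 * (sqrt p * sqrt q) - 2 * p"
    using assms by (simp add: field_simps) 
  finally show ?thesis
    using assms by (simp add: power2_diff)
qed

text \<open>
  The exponential of \<open>\<Sum> (Y ln q - q)\<close>.  Written as a product, it is continuous in the positions
  even where link probabilities vanish, so that a maximizer exists for every network.
\<close>

definition poisson_likelihood :: "(real \<Rightarrow> real) \<Rightarrow> real mat \<Rightarrow> (nat \<Rightarrow> real ^ 'd) \<Rightarrow> real" where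
  "poisson_likelihood K A z =
    (\<Prod>p\<in>dyads (dim_row A). (if A $$ p = 1 then link_at K z p else 1) * exp (- link_at K z p))"

definition poisson_mle :: "(real \<Rightarrow> real) \<Rightarrow> (real \<Rightarrow> real) \<Rightarrow> real mat \<Rightarrow> nat \<Rightarrow> real ^ 'd" where
  "poisson_mle K G A = (SOME z. (\<forall>i<dim_row A. norm (z i) \<le> G (real (dim_row A))) \<and>
    (\<forall>z' :: nat \<Rightarrow> real ^ 'd. (\<forall>i<dim_row A. norm (z' i) \<le> G (real (dim_row A))) \<longrightarrow>
      poisson_likelihood K A z' \<le> poisson_likelihood K A z))"

lemma link_at_cong: "p \<in> dyads n \<Longrightarrow> (\<And>i. i < n \<Longrightarrow> z i = z' i) \<Longrightarrow> link_at K z p = link_at K z' p"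
  by (auto simp: link_at_def)

lemma continuous_on_link_at:
  fixes K :: "real \<Rightarrow> real"
  assumes "continuous_on {0..} K"
  shows "continuous_on S (\<lambda>z :: nat \<Rightarrow> real ^ 'd. link_at K z p)"
proof -
  have coord: "continuous_on S (\<lambda>z :: nat \<Rightarrow> real ^ 'd. z i)" for i
    by (rule continuous_on_subset[OF continuous_on_product_coordinates]) simp
  show ?thesis
    unfolding link_at_def
    by (rule continuous_on_compose2[OF assms])
      (auto intro!: continuous_on_norm continuous_on_diff coord)
qed

text \<open>
  The likelihood depends on the first \<open>n\<close> positions only.  Setting the others to zero leaves a product of
  compact sets, on which the continuous likelihood attains its maximum.
\<close>

lemma poisson_mle_exists:
  fixes K :: "real \<Rightarrow> real"
  assumes cont: "continuous_on {0..} K" and "0 \<le> r"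
  shows "\<exists>z :: nat \<Rightarrow> real ^ 'd. (\<forall>i<dim_row A. norm (z i) \<le> r) \<and>
    (\<forall>z' :: nat \<Rightarrow> real ^ 'd. (\<forall>i<dim_row A. norm (z' i) \<le> r) \<longrightarrow> poisson_likelihood K A z' \<le> poisson_likelihood K A z)"
proof -
  define n where "n = dim_row A"
  define C :: "(nat \<Rightarrow> real ^ 'd) set" where "C = (\<Pi>\<^sub>E i\<in>UNIV. if i < n then cball 0 r else {0})"
  have "compactin (product_topology (\<lambda>_. euclidean) UNIV) C"
    unfolding C_def by (subst compactin_PiE) (auto simp: compactin_euclidean_iff)
  then have "compact C"
    by (simp add: euclidean_product_topology compactin_euclidean_iff)
  moreover have "(\<lambda>_. 0) \<in> C" using \<open>0 \<le> r\<close> by (auto simp: C_def)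
  moreover have "continuous_on C (poisson_likelihood K A)"
    unfolding poisson_likelihood_def
  proof (intro continuous_on_prod continuous_on_mult continuous_on_exp continuous_on_minus
      continuous_on_link_at[OF cont])
    fix p
    show "continuous_on C (\<lambda>z. if A $$ p = 1 then link_at K z p else 1)"
      using continuous_on_link_at[OF cont, of C p] by (cases "A $$ p = 1") auto
  qed
  ultimately obtain z where "z \<in> C" and z: "\<And>z'. z' \<in> C \<Longrightarrow> poisson_likelihood K A z' \<le> poisson_likelihood K A z"
    using continuous_attains_sup[of C "poisson_likelihood K A"] by blast
  have "poisson_likelihood K A z' \<le> poisson_likelihood K A z" if z': "\<forall>i<n. norm (z' i) \<le> r"
    for z' :: "nat \<Rightarrow> real ^ 'd"
  proof -
    define u where "u i = (if i < n then z' i else 0)" for i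
    have "u \<in> C" using z' by (auto simp: C_def u_def)
    moreover have "link_at K z' p = link_at K u p" if "p \<in> dyads n" for p
      by (rule link_at_cong[OF that]) (simp add: u_def)
    then have "poisson_likelihood K A z' = poisson_likelihood K A u"
      unfolding poisson_likelihood_def n_def[symmetric] by (intro prod.cong refl) simp
    ultimately show ?thesis using z by simp
  qed
  moreover have "\<forall>i<n. norm (z i) \<le> r"
  proof (intro allI impI)
    fix i assume "i < n"
    have "z i \<in> (if i < n then cball 0 r else {0})"
      using \<open>z \<in> C\<close> unfolding C_def by (rule PiE_mem) simp
    with \<open>i < n\<close> show "norm (z i) \<le> r" by simp
  qed
  ultimately show ?thesis unfolding n_def by blast
qed

lemma poisson_mle_maximizes:
  fixes K G :: "real \<Rightarrow> real"
  assumes "continuous_on {0..} K" "A \<in> carrier_mat n n" "0 \<le> G (real n)"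
  shows "i < n \<Longrightarrow> norm (poisson_mle K G A i :: real ^ 'd) \<le> G (real n)"
    and "(\<And>i. i < n \<Longrightarrow> norm (z' i :: real ^ 'd) \<le> G (real n)) \<Longrightarrow>
      poisson_likelihood K A z' \<le> poisson_likelihood K A (poisson_mle K G A :: nat \<Rightarrow> real ^ 'd)"
proof -
  have n: "dim_row A = n" using assms by auto
  have "(\<forall>i<n. norm (poisson_mle K G A i :: real ^ 'd) \<le> G (real n)) \<and>
    (\<forall>z' :: nat \<Rightarrow> real ^ 'd. (\<forall>i<n. norm (z' i) \<le> G (real n)) \<longrightarrow>
      poisson_likelihood K A z' \<le> poisson_likelihood K A (poisson_mle K G A :: nat \<Rightarrow> real ^ 'd))"
    using someI_ex[OF poisson_mle_exists[OF assms(1,3), of A, where 'd = 'd]]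
    unfolding poisson_mle_def n .
  then show "i < n \<Longrightarrow> norm (poisson_mle K G A i :: real ^ 'd) \<le> G (real n)"
    "(\<And>i. i < n \<Longrightarrow> norm (z' i :: real ^ 'd) \<le> G (real n)) \<Longrightarrow>
      poisson_likelihood K A z' \<le> poisson_likelihood K A (poisson_mle K G A :: nat \<Rightarrow> real ^ 'd)"
    by simp_all
qed

definition hellinger_sq :: "(real \<Rightarrow> real) \<Rightarrow> nat \<Rightarrow> (nat \<Rightarrow> real ^ 'd) \<Rightarrow> (nat \<Rightarrow> real ^ 'd) \<Rightarrow> real" where
  "hellinger_sq K n z z' = (\<Sum>p\<in>dyads n. (sqrt (link_at K z p) - sqrt (link_at K z' p))\<^sup>2)"

text \<open>
  The log-likelihood of \<open>z\<close> minus that of the truth \<open>z'\<close> is the noise on the right minus the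
  Poisson divergence, so it is nonnegative only if the divergence is at most the noise.
\<close>

lemma hellinger_sq_le_noise:
  fixes z z' :: "nat \<Rightarrow> real ^ 'd"
  assumes A: "A \<in> carrier_mat n n" "\<And>p. p \<in> dyads n \<Longrightarrow> A $$ p \<in> {0, 1}"
    and lik: "poisson_likelihood K A z' \<le> poisson_likelihood K A z"
    and pos: "\<And>p. p \<in> dyads n \<Longrightarrow> 0 < link_at K z p" "\<And>p. p \<in> dyads n \<Longrightarrow> 0 < link_at K z' p"
  shows "hellinger_sq K n z z' \<le>
    (\<Sum>p\<in>dyads n. (ln (link_at K z p) - ln (link_at K z' p)) * (A $$ p - link_at K z' p))"
proof -
  have exp_form: "poisson_likelihood K A u =
      exp (\<Sum>p\<in>dyads n. A $$ p * ln (link_at K u p) - link_at K u p)"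
    if "\<And>p. p \<in> dyads n \<Longrightarrow> 0 < link_at K u p" for u :: "nat \<Rightarrow> real ^ 'd"
  proof -
    have "poisson_likelihood K A u = (\<Prod>p\<in>dyads n. exp (A $$ p * ln (link_at K u p) - link_at K u p))"
      unfolding poisson_likelihood_def using A(1)
    proof (intro prod.cong)
      fix p assume p: "p \<in> dyads n"
      from A(2)[OF p] that[OF p] 
      show "(if A $$ p = 1 then link_at K u p else 1) * exp (- link_at K u p) =
          exp (A $$ p * ln (link_at K u p) - link_at K u p)"
        by (auto simp: exp_diff exp_minus field_simps)
    qed auto
    then show ?thesis by (simp add: exp_sum finite_dyads)
  qed
  have "(\<Sum>p\<in>dyads n. A $$ p * ln (link_at K z' p) - link_at K z' p) \<le>
      (\<Sum>p\<in>dyads n. A $$ p * ln (link_at K z p) - link_at K z p)"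
    using lik pos by (simp only: exp_form exp_le_cancel_iff)
  then have 0: "0 \<le> (\<Sum>p\<in>dyads n. (A $$ p * ln (link_at K z p) - link_at K z p) -
      (A $$ p * ln (link_at K z' p) - link_at K z' p))"
    by (simp only: sum_subtractf)
  have "hellinger_sq K n z z' \<le> (\<Sum>p\<in>dyads n. link_at K z p - link_at K z' p -
      link_at K z' p * (ln (link_at K z p) - ln (link_at K z' p)))"
    unfolding hellinger_sq_def
  proof (rule sum_mono)
    fix p assume "p \<in> dyads n"
    with sq_sqrt_diff_le_poisson_divergence[OF pos(2) pos(1)]
    show "(sqrt (link_at K z p) - sqrt (link_at K z' p))\<^sup>2 \<le> link_at K z p - link_at K z' p -
      link_at K z' p * (ln (link_at K z p) - ln (link_at K z' p))"
      by (simp add: power2_commute)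
  qed
  also have "\<dots> \<le> \<dots> + (\<Sum>p\<in>dyads n. (A $$ p * ln (link_at K z p) - link_at K z p) -
      (A $$ p * ln (link_at K z' p) - link_at K z' p))"
    using 0 by simp
  also have "\<dots> = (\<Sum>p\<in>dyads n. (ln (link_at K z p) - ln (link_at K z' p)) * (A $$ p - link_at K z' p))"
    unfolding sum.distrib[symmetric] by (intro sum.cong refl) (simp add: algebra_simps)
  finally show ?thesis .
qed

section \<open>Hellinger consistency\<close>

lemma dist_sq_norm_diff_le:
  fixes x y x' y' :: "'a :: real_normed_vector"
  assumes "norm x \<le> r" "norm y \<le> r" "norm x' \<le> r" "norm y' \<le> r"
  shows "\<bar>(norm (x - y))\<^sup>2 - (norm (x' - y'))\<^sup>2\<bar> \<le> 4 * r * (norm (x - x') + norm (y - y'))"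
proof -
  have "\<bar>norm (x - y) - norm (x' - y')\<bar> \<le> norm ((x - y) - (x' - y'))"
    by (rule norm_triangle_ineq3)
  also have "(x - y) - (x' - y') = (x - x') - (y - y')" by simp
  also have "norm \<dots> \<le> norm (x - x') + norm (y - y')" by (rule norm_triangle_ineq4)
  finally have 1: "\<bar>norm (x - y) - norm (x' - y')\<bar> \<le> norm (x - x') + norm (y - y')" .
  have "norm (x - y) \<le> 2 * r" "norm (x' - y') \<le> 2 * r"
    using norm_triangle_ineq4[of x y] norm_triangle_ineq4[of x' y'] assms by linarith+
  then have 2: "norm (x - y) + norm (x' - y') \<le> 4 * r" by simp
  have "\<bar>(norm (x - y))\<^sup>2 - (norm (x' - y'))\<^sup>2\<bar> =
      (norm (x - y) + norm (x' - y')) * \<bar>norm (x - y) - norm (x' - y')\<bar>"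
  proof -
    have "(norm (x - y))\<^sup>2 - (norm (x' - y'))\<^sup>2 =
        (norm (x - y) + norm (x' - y')) * (norm (x - y) - norm (x' - y'))"
      by (simp add: power2_eq_square algebra_simps)
    then show ?thesis by (simp only: abs_mult) simp
  qed
  also have "\<dots> \<le> 4 * r * (norm (x - x') + norm (y - y'))"
    using 1 2 order.trans[OF norm_ge_zero assms(1)] by (intro mult_mono) auto
  finally show ?thesis .
qed

text \<open>
  On the ball of radius \<open>r = G n\<close>, \<open>ln K\<close> of the distance is Lipschitz in both positions with
  constant \<open>2 \<alpha> r\<close>: the factor \<open>\<alpha> / 2\<close> is the constant in the squared distance (\<open>\<epsilon> \<le> 1\<close>, since
  \<open>K 0 \<le> 1 - \<epsilon>\<close>), the factor \<open>4 r\<close> comes from \<open>dist_sq_norm_diff_le\<close>.  The uniform bound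
  \<open>34 d\<^sup>2 (2 \<alpha> r) r n\<^sup>3\<^sup>/\<^sup>2\<close> compares to the zero configuration and is used twice, at the estimate and at
  the true positions.
\<close>

lemma hellinger_consistency:
  fixes Z :: "nat \<Rightarrow> 'w \<Rightarrow> nat \<Rightarrow> real ^ 'd"
  assumes reg: "regular_lpm S K G \<epsilon> M Z Y" and K0: "0 < K 0"
    and fin: "alpha_sup K G \<epsilon> n < \<infinity>" and "0 < n" "0 \<le> G (real n)"
  shows "\<exists>E\<in>sets (M n). measure (M n) E \<le> 2 * real n * exp (- real n) \<and>
    (\<forall>\<omega>\<in>space (M n) - E. (\<forall>i<n. norm (Z n \<omega> i) \<le> G (real n)) \<longrightarrow>
      hellinger_sq K n (poisson_mle K G (Y n \<omega>)) (Z n \<omega>) \<le>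
        136 * (real CARD('d))\<^sup>2 * (enn2real (alpha_sup K G \<epsilon> n) * (G (real n))\<^sup>2 * (real n * sqrt (real n))))"
proof -
  define r where "r = G (real n)"
  define a where "a = enn2real (alpha_sup K G \<epsilon> n)"
  let ?d = "real CARD('d)"
  have lpm: "lpm S K M Z Y" and diff: "K differentiable_on {0..}" and anti: "antimono_on {0..} K"
    and \<epsilon>: "0 < \<epsilon>" "K 0 \<le> 1 - \<epsilon>"
    using reg by (auto simp: regular_lpm_def)
  have cont: "continuous_on {0..} K" by (rule differentiable_imp_continuous_on[OF diff])
  have nonneg: "0 \<le> x \<Longrightarrow> 0 \<le> K x" for x using lpm by (simp add: lpm_def)
  have "0 \<le> a" by (simp add: a_def)
  have "0 \<le> r" using assms by (simp add: r_def)
  have bound: "\<bar>deriv K t\<bar> \<le> a * t * K t" if "0 < t" "t < 2 * r" for t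
  proof -
    have "\<bar>deriv K t\<bar> \<le> \<epsilon> * a * t * K t"
      unfolding a_def using that by (intro deriv_link_le_alpha_sup[OF fin \<epsilon>(1) nonneg]) (auto simp: r_def)
    also have "\<dots> \<le> 1 * a * t * K t"
      using K0 \<epsilon> \<open>0 \<le> a\<close> that nonneg[of t] by (intro mult_right_mono) auto
    finally show ?thesis by simp
  qed
  have norm_le: "norm (x - y) \<le> 2 * r" if "norm x \<le> r" "norm y \<le> r" for x y :: "real ^ 'd"
    using norm_triangle_ineq4[of x y] that by linarith
  have pos: "0 < link_at K z p" if "\<And>i. i < n \<Longrightarrow> norm (z i) \<le> r" "p \<in> dyads n" for z :: "nat \<Rightarrow> real ^ 'd" and p
    unfolding link_at_def
  proof (rule link_positive[OF diff bound K0])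
    show "norm (z (fst p) - z (snd p)) \<le> 2 * r" using that by (intro norm_le) auto
  qed auto
  define h where "h x y = ln (K (norm (x - y)))" for x y :: "real ^ 'd"
  have lip: "\<bar>h x y - h x' y'\<bar> \<le> 2 * a * r * (norm (x - x') + norm (y - y'))"
    if "norm x \<le> r" "norm y \<le> r" "norm x' \<le> r" "norm y' \<le> r" for x y x' y'
  proof -
    have "\<bar>h x y - h x' y'\<bar> \<le> a / 2 * \<bar>(norm (x - y))\<^sup>2 - (norm (x' - y'))\<^sup>2\<bar>"
      unfolding h_def using norm_le that by (intro ln_link_lipschitz[OF diff anti bound K0]) simp_all
    also have "\<dots> \<le> a / 2 * (4 * r * (norm (x - x') + norm (y - y')))"
      using \<open>0 \<le> a\<close> that by (intro mult_left_mono dist_sq_norm_diff_le) auto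
    finally show ?thesis by simp
  qed
  define W where "W z \<omega> = (\<Sum>p\<in>dyads n. h (z (fst p)) (z (snd p)) * (Y n \<omega> $$ p - link_at K (Z n \<omega>) p))" for z \<omega>
  have "0 \<le> 2 * a * r" using \<open>0 \<le> a\<close> \<open>0 \<le> r\<close> by simp
  obtain E where E: "E \<in> sets (M n)" "measure (M n) E \<le> 2 * real n * exp (- real n)"
    and EW: "\<And>\<omega> z. \<omega> \<in> space (M n) - E \<Longrightarrow> \<forall>i<n. norm (z i) \<le> r \<Longrightarrow>
      \<bar>W z \<omega> - W (\<lambda>_. 0) \<omega>\<bar> \<le> 34 * ?d\<^sup>2 * (2 * a * r) * r * (real n * sqrt (real n))"
    using noise_uniform_bound[OF lpm cont lip \<open>0 < n\<close> \<open>0 \<le> r\<close> \<open>0 \<le> 2 * a * r\<close>]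
    unfolding W_def by blast
  show ?thesis
  proof (intro bexI[OF _ E(1)] conjI E(2) ballI impI)
    fix \<omega> assume \<omega>: "\<omega> \<in> space (M n) - E" and "\<forall>i<n. norm (Z n \<omega> i) \<le> G (real n)"
    then have zn: "\<forall>i<n. norm (Z n \<omega> i) \<le> r" by (simp add: r_def)
    define z where "z = (poisson_mle K G (Y n \<omega>) :: nat \<Rightarrow> real ^ 'd)"
    have Yn: "Y n \<omega> \<in> carrier_mat n n" using lpm \<omega> by (simp add: lpm_def)
    have z: "\<forall>i<n. norm (z i) \<le> r"
      unfolding z_def r_def using poisson_mle_maximizes(1)[where G = G and n = n, OF cont Yn \<open>0 \<le> G (real n)\<close>] by blast
    have lik: "poisson_likelihood K (Y n \<omega>) (Z n \<omega>) \<le> poisson_likelihood K (Y n \<omega>) z"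
      unfolding z_def using zn by (intro poisson_mle_maximizes(2)[where G = G and n = n, OF cont Yn \<open>0 \<le> G (real n)\<close>]) (auto simp: r_def)
    have "hellinger_sq K n z (Z n \<omega>) \<le>
      (\<Sum>p\<in>dyads n. (ln (link_at K z p) - ln (link_at K (Z n \<omega>) p)) * (Y n \<omega> $$ p - link_at K (Z n \<omega>) p))"
    proof (rule hellinger_sq_le_noise[OF Yn _ lik])
      show "Y n \<omega> $$ p \<in> {0, 1}" if "p \<in> dyads n" for p
        using adjacency_0_1[OF lpm cont _ that] \<omega> by blast
    qed (use pos z zn in blast)+
    also have "\<dots> = (W z \<omega> - W (\<lambda>_. 0) \<omega>) - (W (Z n \<omega>) \<omega> - W (\<lambda>_. 0) \<omega>)"
      by (simp add: W_def h_def link_at_def sum_subtractf[symmetric] left_diff_distrib)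
    also have "\<dots> \<le> 2 * (34 * ?d\<^sup>2 * (2 * a * r) * r * (real n * sqrt (real n)))"
      using EW[OF \<omega> z] EW[OF \<omega> zn] by linarith
    also have "\<dots> = 136 * ?d\<^sup>2 * (a * r\<^sup>2 * (real n * sqrt (real n)))"
      by (simp add: power2_eq_square)
    finally show "hellinger_sq K n (poisson_mle K G (Y n \<omega>)) (Z n \<omega>) \<le>
        136 * (real CARD('d))\<^sup>2 * (enn2real (alpha_sup K G \<epsilon> n) * (G (real n))\<^sup>2 * (real n * sqrt (real n)))"
      by (simp add: a_def r_def z_def)
  qed
qed

lemma frob_norm_sq_eq_dyads:
  assumes "\<And>i j. f i j = f j i" "\<And>i. f i i = 0"
  shows "(frob_norm n f)\<^sup>2 = 2 * (\<Sum>(i, j)\<in>dyads n. (f i j)\<^sup>2)"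
proof -
  have "(frob_norm n f)\<^sup>2 = (\<Sum>i<n. \<Sum>j<n. (f i j)\<^sup>2)"
    by (simp add: frob_norm_def sum_nonneg)
  also have "\<dots> = 2 * (\<Sum>(i, j)\<in>dyads n. (f i j)\<^sup>2)"
  proof (rule sum_symmetric_eq_dyads)
    show "(f i j)\<^sup>2 = (f j i)\<^sup>2" for i j using assms(1)[of i j] by simp
    show "(f i i)\<^sup>2 = 0" for i using assms(2) by simp
  qed
  finally show ?thesis .
qed

text \<open>
  \<open>a - b = (sqrt a + sqrt b) (sqrt a - sqrt b)\<close> with the first factor at most \<open>2\<close>; the remaining factor
  \<open>2\<close> counts each pair in both orders.
\<close>

lemma link_prob_frob_le_hellinger:
  fixes z z' :: "nat \<Rightarrow> real ^ 'd"
  assumes "\<And>x. 0 \<le> x \<Longrightarrow> 0 \<le> K x \<and> K x \<le> 1"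
  shows "(frob_norm n (\<lambda>i j. link_prob_matrix K z i j - link_prob_matrix K z' i j))\<^sup>2
    \<le> 8 * hellinger_sq K n z z'"
proof -
  have "(frob_norm n (\<lambda>i j. link_prob_matrix K z i j - link_prob_matrix K z' i j))\<^sup>2 =
      2 * (\<Sum>p\<in>dyads n. (link_at K z p - link_at K z' p)\<^sup>2)"
  proof -
    have "(frob_norm n (\<lambda>i j. link_prob_matrix K z i j - link_prob_matrix K z' i j))\<^sup>2 = 2 * (\<Sum>(i, j)\<in>dyads n. (link_prob_matrix K z i j - link_prob_matrix K z' i j)\<^sup>2)"
      by (rule frob_norm_sq_eq_dyads) (simp_all add: link_prob_matrix_def norm_minus_commute)
    then show ?thesis by (simp add: link_prob_matrix_def link_at_def case_prod_unfold)
  qed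
  also have "\<dots> \<le> 2 * (\<Sum>p\<in>dyads n. 4 * (sqrt (link_at K z p) - sqrt (link_at K z' p))\<^sup>2)"
  proof (intro mult_left_mono sum_mono)
    fix p
    let ?a = "link_at K z p" and ?b = "link_at K z' p"
    have r: "0 \<le> ?a" "?a \<le> 1" "0 \<le> ?b" "?b \<le> 1" using assms by (auto simp: link_at_def)
    have "sqrt ?a + sqrt ?b \<le> 2"
      using real_sqrt_le_mono[OF r(2)] real_sqrt_le_mono[OF r(4)] unfolding real_sqrt_one by linarith
    then have "(sqrt ?a + sqrt ?b)\<^sup>2 \<le> 2\<^sup>2"
      using r by (intro power_mono) simp_all
    then have "(sqrt ?a + sqrt ?b)\<^sup>2 * (sqrt ?a - sqrt ?b)\<^sup>2 \<le> 2\<^sup>2 * (sqrt ?a - sqrt ?b)\<^sup>2"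
      by (rule mult_right_mono) (rule zero_le_power2)
    moreover have "(sqrt ?a + sqrt ?b) * (sqrt ?a - sqrt ?b) = ?a - ?b"
      using r by (simp flip: square_diff_square_factored)
    ultimately show "(?a - ?b)\<^sup>2 \<le> 4 * (sqrt ?a - sqrt ?b)\<^sup>2"
      by (simp flip: power_mult_distrib)
  qed simp
  also have "\<dots> = 8 * hellinger_sq K n z z'"
    by (simp add: hellinger_sq_def sum_distrib_left)
  finally show ?thesis .
qed

lemma sq_dist_frob_le_hellinger:
  fixes z z' :: "nat \<Rightarrow> real ^ 'd"
  assumes lip: "\<And>x y. \<lbrakk>0 \<le> x; x \<le> 2 * r; 0 \<le> y; y \<le> 2 * r\<rbrakk> \<Longrightarrow>
      \<bar>x\<^sup>2 - y\<^sup>2\<bar> \<le> 4 * sqrt B * \<bar>sqrt (K x) - sqrt (K y)\<bar>"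
    and "0 \<le> B" and z: "\<And>i. i < n \<Longrightarrow> norm (z i) \<le> r" "\<And>i. i < n \<Longrightarrow> norm (z' i) \<le> r"
  shows "(frob_norm n (\<lambda>i j. sq_dist_matrix z i j - sq_dist_matrix z' i j))\<^sup>2
    \<le> 32 * B * hellinger_sq K n z z'"
proof -
  let ?D = "\<lambda>z p. norm (z (fst p) - z (snd p) :: real ^ 'd)"
  have "(frob_norm n (\<lambda>i j. sq_dist_matrix z i j - sq_dist_matrix z' i j))\<^sup>2 =
      2 * (\<Sum>p\<in>dyads n. ((?D z p)\<^sup>2 - (?D z' p)\<^sup>2)\<^sup>2)"
  proof -
    have "(frob_norm n (\<lambda>i j. sq_dist_matrix z i j - sq_dist_matrix z' i j))\<^sup>2 = 2 * (\<Sum>(i, j)\<in>dyads n. (sq_dist_matrix z i j - sq_dist_matrix z' i j)\<^sup>2)"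
      by (rule frob_norm_sq_eq_dyads) (simp_all add: sq_dist_matrix_def norm_minus_commute)
    then show ?thesis by (simp add: sq_dist_matrix_def case_prod_unfold)
  qed
  also have "\<dots> \<le> 2 * (\<Sum>p\<in>dyads n. 16 * B * (sqrt (link_at K z p) - sqrt (link_at K z' p))\<^sup>2)"
  proof (intro mult_left_mono sum_mono)
    fix p assume p: "p \<in> dyads n"
    have i: "fst p < n" "snd p < n"
      using p by auto
    have r: "?D u p \<le> 2 * r" if "norm (u (fst p)) \<le> r" "norm (u (snd p)) \<le> r" for u
      using norm_triangle_ineq4[of "u (fst p)" "u (snd p)"] that by linarith
    have rz: "?D z p \<le> 2 * r" "?D z' p \<le> 2 * r" by (rule r[OF z(1)[OF i(1)] z(1)[OF i(2)]], rule r[OF z(2)[OF i(1)] z(2)[OF i(2)]])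
    have "\<bar>(?D z p)\<^sup>2 - (?D z' p)\<^sup>2\<bar> \<le> 4 * sqrt B * \<bar>sqrt (link_at K z p) - sqrt (link_at K z' p)\<bar>"
      unfolding link_at_def by (rule lip[OF norm_ge_zero rz(1) norm_ge_zero rz(2)])
    then have "\<bar>(?D z p)\<^sup>2 - (?D z' p)\<^sup>2\<bar>\<^sup>2 \<le> (4 * sqrt B * \<bar>sqrt (link_at K z p) - sqrt (link_at K z' p)\<bar>)\<^sup>2"
      by (intro power_mono) auto
    then show "((?D z p)\<^sup>2 - (?D z' p)\<^sup>2)\<^sup>2 \<le> 16 * B * (sqrt (link_at K z p) - sqrt (link_at K z' p))\<^sup>2"
      using \<open>0 \<le> B\<close> by (simp add: power_mult_distrib)
  qed simp
  also have "\<dots> = 32 * B * hellinger_sq K n z z'"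
    by (simp add: hellinger_sq_def sum_distrib_left mult_ac)
  finally show ?thesis .
qed

section \<open>Aligning two configurations with close Gram matrices\<close>

text \<open>
  For \<open>a = 0\<close> this is the identity, because of division by zero, so it is an orthogonal
  transformation for every \<open>a\<close>.
\<close>

definition reflect :: "real ^ 'd \<Rightarrow> real ^ 'd \<Rightarrow> real ^ 'd" where
  "reflect a x = x - (2 * (x \<bullet> a) / (a \<bullet> a)) *\<^sub>R a"

lemma inner_reflect: "reflect a x \<bullet> y = x \<bullet> y - 2 / (a \<bullet> a) * ((x \<bullet> a) * (y \<bullet> a))"
  by (simp add: reflect_def inner_diff_left inner_commute[of a y])

lemma orthogonal_transformation_reflect: "orthogonal_transformation (reflect a)"
  unfolding orthogonal_transformation_def
proof (intro conjI allI)
  show "linear (reflect a)"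
    by (rule linearI) (simp_all add: reflect_def inner_add_left add_divide_distrib algebra_simps)
  fix v w
  show "reflect a v \<bullet> reflect a w = v \<bullet> w"
  proof (cases "a = 0")
    case False
    then have "a \<bullet> a \<noteq> 0" by simp
    then have "reflect a w \<bullet> a = - (w \<bullet> a)"
      by (simp add: inner_reflect)
    then have "reflect a v \<bullet> reflect a w = v \<bullet> reflect a w + 2 / (a \<bullet> a) * ((v \<bullet> a) * (w \<bullet> a))"
      unfolding inner_reflect[of a v] by simp
    also have "v \<bullet> reflect a w = v \<bullet> w - 2 / (a \<bullet> a) * ((v \<bullet> a) * (w \<bullet> a))"
      using inner_reflect[of a w v] by (simp add: inner_commute[of v] mult.commute)
    finally show ?thesis by simp
  qed (simp add: reflect_def)
qed

lemma orthogonal_matrix_compose_transformation: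
  fixes R :: "real ^ 'd ^ 'd"
  assumes "orthogonal_matrix R" "orthogonal_transformation f"
  shows "\<exists>R'. orthogonal_matrix R' \<and> (\<forall>x. x v* R' = f (x v* R))"
proof (intro exI conjI allI)
  have f: "linear f" "orthogonal_matrix (matrix f)"
    using assms(2) by (auto simp: orthogonal_transformation_matrix)
  show "orthogonal_matrix (R ** Finite_Cartesian_Product.transpose (matrix f))"
    using assms(1) f(2) by (intro orthogonal_matrix_mul) auto
  show "x v* (R ** Finite_Cartesian_Product.transpose (matrix f)) = f (x v* R)" for x
    by (simp add: vector_matrix_mul_assoc[symmetric] matrix_works f(1) linear_matrix_vector_mul_eq)
qed

lemma compact_orthogonal_matrices: "compact {R :: real ^ 'd ^ 'd. orthogonal_matrix R}"
  unfolding compact_eq_bounded_closed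
proof
  have "norm R \<le> real CARD('d)" if "orthogonal_matrix R" for R :: "real ^ 'd ^ 'd"
  proof -
    have "norm (R $ i) = 1" for i
      using that by (auto simp: orthogonal_matrix_orthonormal_rows Finite_Cartesian_Product.row_def)
    then show ?thesis
      using L2_set_le_sum[of UNIV "\<lambda>i. norm (R $ i)"] by (simp add: norm_vec_def)
  qed
  then show "bounded {R :: real ^ 'd ^ 'd. orthogonal_matrix R}"
    by (auto simp: bounded_iff)
  have "{R :: real ^ 'd ^ 'd. orthogonal_matrix R} =
      (\<Inter>i. \<Inter>j. {R. (\<Sum>k\<in>UNIV. R $ k $ i * R $ k $ j) = (if i = j then 1 else 0)})"
    unfolding orthogonal_matrix Finite_Cartesian_Product.vec_eq_iff
    by (simp add: matrix_matrix_mult_def Finite_Cartesian_Product.transpose_def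
        Finite_Cartesian_Product.mat_def set_eq_iff)
  also have "closed \<dots>"
    by (intro closed_INT ballI closed_Collect_eq continuous_intros)
  finally show "closed {R :: real ^ 'd ^ 'd. orthogonal_matrix R}" .
qed

text \<open>
  First-order optimality: a quadratic polynomial with minimum at the origin has no linear term.
\<close>

lemma linear_dominated_imp_zero:
  fixes B C :: real
  assumes "\<And>t. 0 \<le> t * B + t\<^sup>2 * C"
  shows "B = 0"
proof (rule ccontr)
  assume "B \<noteq> 0"
  define D where "D = 1 + \<bar>C\<bar>"
  have "0 < D" by (simp add: D_def)
  have "(- B / D) * B + (- B / D)\<^sup>2 * C = B\<^sup>2 * (C - D) / D\<^sup>2"
    using \<open>0 < D\<close> by (simp add: field_simps power2_eq_square)
  also have "\<dots> < 0"
    using \<open>B \<noteq> 0\<close> \<open>0 < D\<close> by (intro divide_neg_pos mult_pos_neg) (auto simp: D_def)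
  finally show False using assms[of "- B / D"] by simp
qed

text \<open>
  The rotation of \<open>y\<close> maximizing the alignment \<open>\<Sum> y\<^sub>i \<bullet> x\<^sub>i\<close>.  A further reflection cannot
  increase the alignment, which makes the cross moment form \<open>S a b = \<Sum> (u\<^sub>i \<bullet> a) (x\<^sub>i \<bullet> b)\<close> of the
  rotated points \<open>u\<close> nonnegative on the diagonal; products of two reflections with almost equal axes
  cannot either, which makes it symmetric.  This is the polar decomposition, obtained by
  compactness.
\<close>

lemma procrustes_rotation:
  fixes x y :: "nat \<Rightarrow> real ^ 'd" and n :: nat
  obtains R :: "real ^ 'd ^ 'd" where "orthogonal_matrix R"
    and "\<And>a. 0 \<le> (\<Sum>i<n. ((y i v* R) \<bullet> a) * (x i \<bullet> a))"
    and "\<And>a b. (\<Sum>i<n. ((y i v* R) \<bullet> a) * (x i \<bullet> b)) = (\<Sum>i<n. ((y i v* R) \<bullet> b) * (x i \<bullet> a))"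
proof -
  define align where "align R = (\<Sum>i<n. (y i v* R) \<bullet> x i)" for R :: "real ^ 'd ^ 'd"
  have "continuous_on A align" for A
    unfolding align_def vector_matrix_mult_def by (intro continuous_intros)
  then obtain R where R: "orthogonal_matrix R"
    and max: "\<And>R'. orthogonal_matrix R' \<Longrightarrow> align R' \<le> align R"
    using continuous_attains_sup[OF compact_orthogonal_matrices, of align] orthogonal_matrix_id by blast
  define u where "u i = y i v* R" for i
  define S where "S a b = (\<Sum>i<n. (u i \<bullet> a) * (x i \<bullet> b))" for a b
  have turn: "(\<Sum>i<n. f (u i) \<bullet> x i) \<le> (\<Sum>i<n. u i \<bullet> x i)" if f: "orthogonal_transformation f" for f
  proof -
    obtain R' where "orthogonal_matrix R'" "\<And>z. z v* R' = f (z v* R)"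
      using orthogonal_matrix_compose_transformation[OF R f] by blast
    with max[of R'] show ?thesis by (simp add: align_def u_def)
  qed
  have pos: "0 \<le> S a a" for a
  proof (cases "a = 0")
    case False
    then have aa: "0 < a \<bullet> a" by simp
    have "(\<Sum>i<n. reflect a (u i) \<bullet> x i) = (\<Sum>i<n. u i \<bullet> x i) - 2 / (a \<bullet> a) * S a a"
      by (simp only: S_def inner_reflect sum_subtractf sum_distrib_left)
    with turn[OF orthogonal_transformation_reflect, of a] have "0 \<le> 2 / (a \<bullet> a) * S a a" by simp
    then show ?thesis using aa by (simp add: zero_le_divide_iff)
  qed (simp add: S_def)
  have two: "0 \<le> (a \<bullet> a) * S b b + (b \<bullet> b) * S a a - 2 * (a \<bullet> b) * S b a" for a b
  proof (cases "a = 0 \<or> b = 0")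
    case True
    then show ?thesis by (auto simp: S_def)
  next
    case False
    then have aa: "0 < a \<bullet> a" "0 < b \<bullet> b" by auto
    define \<alpha> \<beta> where "\<alpha> = 2 / (a \<bullet> a)" and "\<beta> = 2 / (b \<bullet> b)"
    have "orthogonal_transformation (reflect a \<circ> reflect b)"
      by (intro orthogonal_transformation_compose orthogonal_transformation_reflect)
    from turn[OF this] have "(\<Sum>i<n. reflect a (reflect b (u i)) \<bullet> x i) \<le> (\<Sum>i<n. u i \<bullet> x i)"
      by simp
    also have "(\<Sum>i<n. reflect a (reflect b (u i)) \<bullet> x i) = (\<Sum>i<n. u i \<bullet> x i
        - \<beta> * ((u i \<bullet> b) * (x i \<bullet> b)) - \<alpha> * ((u i \<bullet> a) * (x i \<bullet> a))
        + \<alpha> * \<beta> * (a \<bullet> b) * ((u i \<bullet> b) * (x i \<bullet> a)))"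
      unfolding inner_reflect \<alpha>_def[symmetric] \<beta>_def[symmetric]
      by (intro sum.cong refl) (simp add: algebra_simps)
    also have "\<dots> = (\<Sum>i<n. u i \<bullet> x i) - \<beta> * S b b - \<alpha> * S a a + \<alpha> * \<beta> * (a \<bullet> b) * S b a"
      by (simp only: S_def sum.distrib sum_subtractf sum_distrib_left)
    finally have "0 \<le> \<beta> * S b b + \<alpha> * S a a - \<alpha> * \<beta> * (a \<bullet> b) * S b a" by linarith
    then have "0 \<le> ((a \<bullet> a) * (b \<bullet> b) / 2) * (\<beta> * S b b + \<alpha> * S a a - \<alpha> * \<beta> * (a \<bullet> b) * S b a)"
      using aa by (intro mult_nonneg_nonneg) auto
    also have "\<dots> = (\<beta> * (b \<bullet> b) / 2) * ((a \<bullet> a) * S b b) + (\<alpha> * (a \<bullet> a) / 2) * ((b \<bullet> b) * S a a)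
        - (\<alpha> * (a \<bullet> a) / 2) * (\<beta> * (b \<bullet> b) / 2) * (2 * (a \<bullet> b) * S b a)"
      by (simp add: algebra_simps)
    also have "\<alpha> * (a \<bullet> a) / 2 = 1" using aa by (simp add: \<alpha>_def)
    also have "\<beta> * (b \<bullet> b) / 2 = 1" using aa by (simp add: \<beta>_def)
    finally show ?thesis by simp
  qed
  have sym: "S a c = S c a" for a c
  proof (cases "a = 0")
    case False
    have "0 \<le> t * ((a \<bullet> a) * (S a c - S c a)) +
        t\<^sup>2 * ((a \<bullet> a) * S c c + (c \<bullet> c) * S a a - 2 * (a \<bullet> c) * S c a)" for t
    proof -
      have 1: "S (a + t *\<^sub>R c) (a + t *\<^sub>R c) = S a a + t * (S a c + S c a) + t\<^sup>2 * S c c"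
        unfolding S_def sum_distrib_left sum.distrib[symmetric]
        by (intro sum.cong refl) (simp add: inner_add_right power2_eq_square algebra_simps)
      have 2: "S (a + t *\<^sub>R c) a = S a a + t * S c a"
        unfolding S_def sum_distrib_left sum.distrib[symmetric]
        by (intro sum.cong refl) (simp add: inner_add_right algebra_simps)
      have 3: "(a + t *\<^sub>R c) \<bullet> (a + t *\<^sub>R c) = (a \<bullet> a) + 2 * t * (a \<bullet> c) + t\<^sup>2 * (c \<bullet> c)"
        by (simp add: inner_add_left inner_add_right inner_commute[of c a] power2_eq_square algebra_simps)
      have 4: "a \<bullet> (a + t *\<^sub>R c) = (a \<bullet> a) + t * (a \<bullet> c)"
        by (simp add: inner_add_right)
      have "(a \<bullet> a) * S (a + t *\<^sub>R c) (a + t *\<^sub>R c) + ((a + t *\<^sub>R c) \<bullet> (a + t *\<^sub>R c)) * S a a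
          - 2 * (a \<bullet> (a + t *\<^sub>R c)) * S (a + t *\<^sub>R c) a =
          t * ((a \<bullet> a) * (S a c - S c a)) +
          t\<^sup>2 * ((a \<bullet> a) * S c c + (c \<bullet> c) * S a a - 2 * (a \<bullet> c) * S c a)"
        unfolding 1 2 3 4 by (simp add: power2_eq_square algebra_simps)
      then show ?thesis using two[of a "a + t *\<^sub>R c"] by simp
    qed
    then have "(a \<bullet> a) * (S a c - S c a) = 0" by (rule linear_dominated_imp_zero)
    then show ?thesis using False by simp
  qed (simp add: S_def)
  show ?thesis
    by (rule that[OF R]) (use pos sym in \<open>simp_all add: S_def u_def\<close>)
qed

definition cross_gram :: "nat \<Rightarrow> (nat \<Rightarrow> real ^ 'd) \<Rightarrow> (nat \<Rightarrow> real ^ 'd) \<Rightarrow> 'd \<Rightarrow> 'd \<Rightarrow> real" where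
  "cross_gram n p r a b = (\<Sum>i<n. p i $ a * r i $ b)"

lemma sum_inner_prod_eq_cross_gram:
  fixes p q r s :: "nat \<Rightarrow> real ^ 'd"
  shows "(\<Sum>i<n. \<Sum>j<n. (p i \<bullet> q j) * (r i \<bullet> s j)) =
    (\<Sum>a\<in>UNIV. \<Sum>b\<in>UNIV. cross_gram n p r a b * cross_gram n q s a b)"
proof -
  have "(\<Sum>i<n. \<Sum>j<n. (p i \<bullet> q j) * (r i \<bullet> s j)) =
      (\<Sum>i<n. \<Sum>j<n. \<Sum>a\<in>UNIV. \<Sum>b\<in>UNIV. (p i $ a * r i $ b) * (q j $ a * s j $ b))"
    by (simp add: inner_vec_def sum_product mult_ac)
  also have "\<dots> = (\<Sum>i<n. \<Sum>a\<in>UNIV. \<Sum>b\<in>UNIV. \<Sum>j<n. (p i $ a * r i $ b) * (q j $ a * s j $ b))"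
    by (rule sum.cong[OF refl], subst sum.swap, rule sum.cong[OF refl], rule sum.swap)
  also have "\<dots> = (\<Sum>a\<in>UNIV. \<Sum>b\<in>UNIV. \<Sum>i<n. \<Sum>j<n. (p i $ a * r i $ b) * (q j $ a * s j $ b))"
    by (subst sum.swap, rule sum.cong[OF refl], rule sum.swap)
  also have "\<dots> = (\<Sum>a\<in>UNIV. \<Sum>b\<in>UNIV. cross_gram n p r a b * cross_gram n q s a b)"
    by (simp add: cross_gram_def sum_product)
  finally show ?thesis .
qed

text \<open>
  With \<open>\<Delta> = u - x\<close> for the rotated points \<open>u\<close>, the difference of the inner products is
  \<open>\<Delta>\<^sub>i \<bullet> x\<^sub>j + x\<^sub>i \<bullet> \<Delta>\<^sub>j + \<Delta>\<^sub>i \<bullet> \<Delta>\<^sub>j\<close>.  In terms of the cross moments \<open>T\<close> of \<open>x\<close> and \<open>\<Delta>\<close> (symmetric by the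
  choice of the rotation), of the second moments \<open>N\<close> of \<open>\<Delta>\<close> and of \<open>P = \<Sum> (\<Delta>\<^sub>i \<bullet> x\<^sub>j)\<^sup>2\<close>, its squared norm is
  \<open>2 P + 2 \<bar>T\<bar>\<^sup>2 + \<bar>N\<bar>\<^sup>2 + 4 \<langle>N, T\<rangle>\<close>.  Completing a square bounds this from below by
  \<open>2 P + (6/5) \<langle>N, T\<rangle>\<close>, and nonnegativity of the cross moments of \<open>u\<close> and \<open>x\<close> gives
  \<open>\<langle>N, T\<rangle> \<ge> - P\<close>.
\<close>

lemma procrustes_bound:
  fixes x y :: "nat \<Rightarrow> real ^ 'd"
  assumes \<mu>: "\<And>v. \<mu> * (norm v)\<^sup>2 \<le> (\<Sum>j<n. (v \<bullet> x j)\<^sup>2)"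
  obtains R :: "real ^ 'd ^ 'd" where "orthogonal_matrix R"
    and "4 / 5 * \<mu> * (\<Sum>i<n. (norm (y i v* R - x i))\<^sup>2) \<le> (\<Sum>i<n. \<Sum>j<n. (y i \<bullet> y j - x i \<bullet> x j)\<^sup>2)"
proof -
  obtain R :: "real ^ 'd ^ 'd" where R: "orthogonal_matrix R"
    and pos: "\<And>a. 0 \<le> (\<Sum>i<n. ((y i v* R) \<bullet> a) * (x i \<bullet> a))"
    and sym: "\<And>a b. (\<Sum>i<n. ((y i v* R) \<bullet> a) * (x i \<bullet> b)) = (\<Sum>i<n. ((y i v* R) \<bullet> b) * (x i \<bullet> a))"
    by (rule procrustes_rotation[where x = x and y = y and n = n]) blast
  define u where "u i = y i v* R" for i
  define \<Delta> where "\<Delta> i = u i - x i" for i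
  define T where "T = cross_gram n x \<Delta>"
  define N where "N = cross_gram n \<Delta> \<Delta>"
  define P where "P = (\<Sum>i<n. \<Sum>j<n. (\<Delta> i \<bullet> x j)\<^sup>2)"
  have T_sym: "T a b = T b a" for a b
  proof -
    have "(\<Sum>i<n. u i $ a * x i $ b) = (\<Sum>i<n. u i $ b * x i $ a)"
      using sym[of "axis a 1" "axis b 1"] by (simp add: u_def inner_axis)
    then show ?thesis
      by (simp add: T_def cross_gram_def \<Delta>_def right_diff_distrib sum_subtractf mult.commute)
  qed
  have flip: "cross_gram n \<Delta> x a b = T a b" for a b
    using T_sym[of a b] by (simp add: T_def cross_gram_def mult.commute)
  have TT: "(\<Sum>i<n. \<Sum>j<n. (\<Delta> i \<bullet> x j) * (x i \<bullet> \<Delta> j)) = (\<Sum>a\<in>UNIV. \<Sum>b\<in>UNIV. (T a b)\<^sup>2)"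
    unfolding sum_inner_prod_eq_cross_gram flip by (simp add: T_def power2_eq_square)
  have NN: "(\<Sum>i<n. \<Sum>j<n. (\<Delta> i \<bullet> \<Delta> j)\<^sup>2) = (\<Sum>a\<in>UNIV. \<Sum>b\<in>UNIV. (N a b)\<^sup>2)"
    unfolding power2_eq_square sum_inner_prod_eq_cross_gram by (simp add: N_def)
  have NT: "(\<Sum>i<n. \<Sum>j<n. (\<Delta> i \<bullet> x j) * (\<Delta> i \<bullet> \<Delta> j)) = (\<Sum>a\<in>UNIV. \<Sum>b\<in>UNIV. N a b * T a b)"
    unfolding sum_inner_prod_eq_cross_gram by (simp add: N_def T_def)
  have P': "(\<Sum>i<n. \<Sum>j<n. (x i \<bullet> \<Delta> j)\<^sup>2) = P"
    unfolding P_def by (subst sum.swap) (simp add: inner_commute)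
  have NT': "(\<Sum>i<n. \<Sum>j<n. (x i \<bullet> \<Delta> j) * (\<Delta> i \<bullet> \<Delta> j)) = (\<Sum>a\<in>UNIV. \<Sum>b\<in>UNIV. N a b * T a b)"
    unfolding NT[symmetric] by (subst sum.swap) (simp add: inner_commute)
  have uu: "u i \<bullet> u j = y i \<bullet> y j" for i j
  proof -
    have "u i \<bullet> u j = y i \<bullet> (R *v (Finite_Cartesian_Product.transpose R *v y j))"
      by (simp add: u_def dot_lmul_matrix)
    also have "R *v (Finite_Cartesian_Product.transpose R *v y j) =
        (R ** Finite_Cartesian_Product.transpose R) *v y j"
      by (rule matrix_vector_mul_assoc)
    finally show ?thesis using R by (simp add: orthogonal_matrix_def)
  qed
  have "(\<Sum>i<n. \<Sum>j<n. (y i \<bullet> y j - x i \<bullet> x j)\<^sup>2) =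
      (\<Sum>i<n. \<Sum>j<n. (\<Delta> i \<bullet> x j)\<^sup>2 + (x i \<bullet> \<Delta> j)\<^sup>2 + (\<Delta> i \<bullet> \<Delta> j)\<^sup>2 +
        2 * ((\<Delta> i \<bullet> x j) * (x i \<bullet> \<Delta> j)) + 2 * ((\<Delta> i \<bullet> x j) * (\<Delta> i \<bullet> \<Delta> j)) +
        2 * ((x i \<bullet> \<Delta> j) * (\<Delta> i \<bullet> \<Delta> j)))"
  proof (intro sum.cong refl)
    fix i j
    have *: "y i \<bullet> y j - x i \<bullet> x j = \<Delta> i \<bullet> x j + x i \<bullet> \<Delta> j + \<Delta> i \<bullet> \<Delta> j"
      unfolding uu[symmetric] by (simp add: \<Delta>_def inner_diff_left inner_diff_right)
    show "(y i \<bullet> y j - x i \<bullet> x j)\<^sup>2 = (\<Delta> i \<bullet> x j)\<^sup>2 + (x i \<bullet> \<Delta> j)\<^sup>2 + (\<Delta> i \<bullet> \<Delta> j)\<^sup>2 +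
        2 * ((\<Delta> i \<bullet> x j) * (x i \<bullet> \<Delta> j)) + 2 * ((\<Delta> i \<bullet> x j) * (\<Delta> i \<bullet> \<Delta> j)) +
        2 * ((x i \<bullet> \<Delta> j) * (\<Delta> i \<bullet> \<Delta> j))"
      unfolding * by (simp add: power2_eq_square algebra_simps)
  qed
  also have "\<dots> = 2 * P + 2 * (\<Sum>a\<in>UNIV. \<Sum>b\<in>UNIV. (T a b)\<^sup>2) + (\<Sum>a\<in>UNIV. \<Sum>b\<in>UNIV. (N a b)\<^sup>2)
      + 4 * (\<Sum>a\<in>UNIV. \<Sum>b\<in>UNIV. N a b * T a b)"
    by (simp only: sum.distrib sum_distrib_left[symmetric] P_def[symmetric] P' TT NN NT NT')
  finally have total: "(\<Sum>i<n. \<Sum>j<n. (y i \<bullet> y j - x i \<bullet> x j)\<^sup>2) = \<dots>" .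
  \<comment> \<open>\<open>7/5\<close> is a rational number just below \<open>sqrt 2\<close>, the largest factor for which at most \<open>2 T\<^sup>2\<close> is used.\<close>
  have "0 \<le> (\<Sum>a\<in>UNIV. \<Sum>b\<in>UNIV. (N a b + 7 / 5 * T a b)\<^sup>2 + (T a b)\<^sup>2 / 25)"
    by (intro sum_nonneg add_nonneg_nonneg) auto
  also have "\<dots> = (\<Sum>a\<in>UNIV. \<Sum>b\<in>UNIV. 2 * (T a b)\<^sup>2 + (N a b)\<^sup>2 + 14 / 5 * (N a b * T a b))"
    by (intro sum.cong refl) (simp add: power2_eq_square algebra_simps)
  also have "\<dots> = 2 * (\<Sum>a\<in>UNIV. \<Sum>b\<in>UNIV. (T a b)\<^sup>2) + (\<Sum>a\<in>UNIV. \<Sum>b\<in>UNIV. (N a b)\<^sup>2)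
      + 14 / 5 * (\<Sum>a\<in>UNIV. \<Sum>b\<in>UNIV. N a b * T a b)"
    by (simp only: sum.distrib sum_distrib_left[symmetric])
  finally have square: "0 \<le> \<dots>" .
  have "(\<Sum>i<n. \<Sum>j<n. (\<Delta> i \<bullet> x j) * (\<Delta> i \<bullet> \<Delta> j)) =
      (\<Sum>i<n. (\<Sum>j<n. (u j \<bullet> \<Delta> i) * (x j \<bullet> \<Delta> i)) - (\<Sum>j<n. (\<Delta> i \<bullet> x j)\<^sup>2))"
  proof (intro sum.cong refl)
    fix i
    have "(\<Delta> i \<bullet> x j) * (\<Delta> i \<bullet> \<Delta> j) = (u j \<bullet> \<Delta> i) * (x j \<bullet> \<Delta> i) - (\<Delta> i \<bullet> x j)\<^sup>2" for j
      unfolding \<Delta>_def[of j] by (simp add: inner_diff_right inner_commute[of "\<Delta> i"] power2_eq_square algebra_simps)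
    then show "(\<Sum>j<n. (\<Delta> i \<bullet> x j) * (\<Delta> i \<bullet> \<Delta> j)) =
        (\<Sum>j<n. (u j \<bullet> \<Delta> i) * (x j \<bullet> \<Delta> i)) - (\<Sum>j<n. (\<Delta> i \<bullet> x j)\<^sup>2)"
      by (simp add: sum_subtractf)
  qed
  also have "\<dots> \<ge> (\<Sum>i<n. 0 - (\<Sum>j<n. (\<Delta> i \<bullet> x j)\<^sup>2))"
    using pos by (intro sum_mono diff_right_mono) (simp add: u_def)
  finally have NT_ge: "(\<Sum>a\<in>UNIV. \<Sum>b\<in>UNIV. N a b * T a b) \<ge> - P"
    unfolding NT by (simp add: P_def sum_negf)
  have "\<mu> * (\<Sum>i<n. (norm (\<Delta> i))\<^sup>2) \<le> P"
    unfolding P_def sum_distrib_left using \<mu> by (intro sum_mono)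
  with total square NT_ge
  have "4 / 5 * \<mu> * (\<Sum>i<n. (norm (\<Delta> i))\<^sup>2) \<le> (\<Sum>i<n. \<Sum>j<n. (y i \<bullet> y j - x i \<bullet> x j)\<^sup>2)"
    by linarith
  then show ?thesis
    using R by (intro that[of R]) (simp_all add: \<Delta>_def u_def)
qed

lemma sum_sq_centered_le:
  fixes f :: "nat \<Rightarrow> real"
  shows "(\<Sum>j<n. (f j - (\<Sum>k<n. f k) / real n)\<^sup>2) \<le> (\<Sum>j<n. (f j)\<^sup>2)"
proof (cases "n = 0")
  case False
  define m where "m = (\<Sum>k<n. f k) / real n"
  have "(\<Sum>j<n. (f j - m)\<^sup>2) = (\<Sum>j<n. (f j)\<^sup>2 - 2 * m * f j + m\<^sup>2)"
    by (intro sum.cong refl) (simp add: power2_eq_square algebra_simps)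
  also have "\<dots> = (\<Sum>j<n. (f j)\<^sup>2) - 2 * m * (\<Sum>k<n. f k) + real n * m\<^sup>2"
    by (simp add: sum.distrib sum_subtractf sum_distrib_left)
  also have "(\<Sum>k<n. f k) = real n * m" using False by (simp add: m_def)
  finally have "(\<Sum>j<n. (f j - m)\<^sup>2) = (\<Sum>j<n. (f j)\<^sup>2) - real n * m\<^sup>2"
    by (simp add: power2_eq_square)
  also have "\<dots> \<le> (\<Sum>j<n. (f j)\<^sup>2)" by simp
  finally show ?thesis by (simp only: m_def)
qed simp

text \<open>
  Subtracting row means and then column means from the matrix of squared distances of a centred
  configuration leaves \<open>- 2\<close> times the Gram matrix.  Both operations are linear and do
  not increase the Frobenius norm.
\<close>

lemma gram_diff_le_sq_dist_diff:
  fixes x y :: "nat \<Rightarrow> real ^ 'd"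
  assumes "0 < n" "(\<Sum>i<n. x i) = 0" "(\<Sum>i<n. y i) = 0"
  shows "4 * (\<Sum>i<n. \<Sum>j<n. (y i \<bullet> y j - x i \<bullet> x j)\<^sup>2) \<le>
    (\<Sum>i<n. \<Sum>j<n. (sq_dist_matrix y i j - sq_dist_matrix x i j)\<^sup>2)"
proof -
  define E where "E i j = sq_dist_matrix y i j - sq_dist_matrix x i j" for i j
  define E1 where "E1 i j = E i j - (\<Sum>k<n. E i k) / real n" for i j
  define E2 where "E2 i j = E1 i j - (\<Sum>k<n. E1 k j) / real n" for i j
  define q where "q j = (norm (y j))\<^sup>2 - (norm (x j))\<^sup>2" for j
  define g where "g i j = y i \<bullet> y j - x i \<bullet> x j" for i j
  have E: "E i j = q i + q j - 2 * g i j" for i j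
    by (simp add: E_def q_def g_def sq_dist_matrix_def power2_norm_eq_inner inner_diff_left
        inner_diff_right inner_commute)
  have g0: "(\<Sum>k<n. g i k) = 0" "(\<Sum>k<n. g k i) = 0" for i
    using assms(2,3) by (simp_all add: g_def sum_subtractf inner_sum_right[symmetric] inner_sum_left[symmetric])
  have E1: "E1 i j = q j - (\<Sum>k<n. q k) / real n - 2 * g i j" for i j
    using \<open>0 < n\<close> by (simp add: E1_def E sum.distrib sum_subtractf sum_distrib_left[symmetric] g0 add_divide_distrib)
  have E2: "E2 i j = - 2 * g i j" for i j
    using \<open>0 < n\<close> by (simp add: E2_def E1 sum_subtractf sum_distrib_left[symmetric] g0 diff_divide_distrib)
  have "4 * (\<Sum>i<n. \<Sum>j<n. (g i j)\<^sup>2) = (\<Sum>i<n. \<Sum>j<n. (E2 i j)\<^sup>2)"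
    by (simp add: E2 power_mult_distrib sum_distrib_left)
  also have "\<dots> = (\<Sum>j<n. \<Sum>i<n. (E2 i j)\<^sup>2)" by (rule sum.swap)
  also have "\<dots> \<le> (\<Sum>j<n. \<Sum>i<n. (E1 i j)\<^sup>2)"
    unfolding E2_def by (intro sum_mono sum_sq_centered_le)
  also have "\<dots> = (\<Sum>i<n. \<Sum>j<n. (E1 i j)\<^sup>2)" by (rule sum.swap)
  also have "\<dots> \<le> (\<Sum>i<n. \<Sum>j<n. (E i j)\<^sup>2)"
    unfolding E1_def by (intro sum_mono sum_sq_centered_le)
  finally show ?thesis by (simp add: g_def E_def)
qed

section \<open>Eigenvalues of Gram matrices\<close>

text \<open>
  Sylvester's identity: both sides are the determinant of the block matrix with rows \<open>(X I, A)\<close> and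
  \<open>(B, I)\<close> times a power of \<open>X\<close>, as seen by clearing one of the off-diagonal blocks.
\<close>

lemma char_poly_mult_commute:
  fixes A B :: "'a :: idom mat"
  assumes A: "A \<in> carrier_mat n m" and B: "B \<in> carrier_mat m n"
  shows "[:0, 1:] ^ m * char_poly (A * B) = [:0, 1:] ^ n * char_poly (B * A)"
proof -
  define X where "X = [:0, 1 :: 'a:]"
  define A' where "A' = map_mat (\<lambda>a. [:a:]) A"
  define B' where "B' = map_mat (\<lambda>a. [:a:]) B"
  have carr: "A' \<in> carrier_mat n m" "B' \<in> carrier_mat m n"
    using A B by (auto simp: A'_def B'_def)
  have const_sum: "[:sum f I:] = (\<Sum>i\<in>I. [:f i:])" for f :: "nat \<Rightarrow> 'a" and I
  proof (induction I rule: infinite_finite_induct)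
    case (insert i I)
    have "[:f i + sum f I:] = [:f i:] + [:sum f I:]" by simp
    with insert show ?case by simp
  qed simp_all
  have prod1: "map_mat (\<lambda>a. [:a:]) (A * B) = A' * B'"
    using A B by (intro eq_matI) (auto simp: A'_def B'_def scalar_prod_def const_sum mult.commute)
  have prod2: "map_mat (\<lambda>a. [:a:]) (B * A) = B' * A'"
    using A B by (intro eq_matI) (auto simp: A'_def B'_def scalar_prod_def const_sum mult.commute)
  have cp1: "char_poly (A * B) = det (X \<cdot>\<^sub>m 1\<^sub>m n - A' * B')"
    unfolding char_poly_defs X_def prod1[symmetric] using A B
    by (intro arg_cong[where f = det] eq_matI) auto
  have cp2: "char_poly (B * A) = det (X \<cdot>\<^sub>m 1\<^sub>m m - B' * A')"
    unfolding char_poly_defs X_def prod2[symmetric] using A B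
    by (intro arg_cong[where f = det] eq_matI) auto
  define W where "W = four_block_mat (X \<cdot>\<^sub>m 1\<^sub>m n) A' B' (1\<^sub>m m)"
  have W: "W \<in> carrier_mat (n + m) (n + m)" using carr by (simp add: W_def)
  define U where "U = four_block_mat (1\<^sub>m n) (0\<^sub>m n m) (- B') (1\<^sub>m m)"
  have U: "U \<in> carrier_mat (n + m) (n + m)" using carr by (simp add: U_def)
  define V where "V = four_block_mat (1\<^sub>m n) (0\<^sub>m n m) (- B') (X \<cdot>\<^sub>m 1\<^sub>m m)"
  have V: "V \<in> carrier_mat (n + m) (n + m)" using carr by (simp add: V_def)
  have "W * U = four_block_mat (X \<cdot>\<^sub>m 1\<^sub>m n - A' * B') A' (0\<^sub>m m n) (1\<^sub>m m)"
    unfolding W_def U_def using carr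
    by (subst mult_four_block_mat[of _ n n _ m _ m _ _ n _ m])
      (auto intro!: arg_cong4[where f = four_block_mat])
  moreover have "det (four_block_mat (X \<cdot>\<^sub>m 1\<^sub>m n - A' * B') A' (0\<^sub>m m n) (1\<^sub>m m)) =
      det (X \<cdot>\<^sub>m 1\<^sub>m n - A' * B') * det (1\<^sub>m m)"
    using carr by (intro det_four_block_mat_lower_left_zero) auto
  moreover have "det U = 1"
    unfolding U_def using carr by (simp add: det_four_block_mat_upper_right_zero[of _ n _ m])
  ultimately have 1: "det W = char_poly (A * B)"
    using det_mult[OF W U] cp1 by simp
  have "V * W = four_block_mat (X \<cdot>\<^sub>m 1\<^sub>m n) A' (0\<^sub>m m n) (X \<cdot>\<^sub>m 1\<^sub>m m - B' * A')"
    unfolding W_def V_def using carr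
    by (subst mult_four_block_mat[of _ n n _ m _ m _ _ n _ m])
      (auto intro!: arg_cong4[where f = four_block_mat])
  moreover have "det (four_block_mat (X \<cdot>\<^sub>m 1\<^sub>m n) A' (0\<^sub>m m n) (X \<cdot>\<^sub>m 1\<^sub>m m - B' * A')) =
      det (X \<cdot>\<^sub>m 1\<^sub>m n) * det (X \<cdot>\<^sub>m 1\<^sub>m m - B' * A')"
    using carr by (intro det_four_block_mat_lower_left_zero) auto
  moreover have "det V = X ^ m"
    unfolding V_def using carr by (simp add: det_four_block_mat_upper_right_zero[of _ n _ m])
  ultimately have "X ^ m * det W = X ^ n * char_poly (B * A)"
    using det_mult[OF V W] cp2 by simp
  then show ?thesis by (simp add: 1 X_def)
qed

text \<open>
  The minimizer of the quadratic form on the unit sphere; first-order optimality makes it an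
  eigenvector.
\<close>

lemma min_quadratic_form_eigenvector:
  fixes x :: "nat \<Rightarrow> real ^ 'd"
  obtains \<mu> v where "norm v = 1" and "\<And>w. \<mu> * (norm w)\<^sup>2 \<le> (\<Sum>j<n. (w \<bullet> x j)\<^sup>2)"
    and "\<And>w. (\<Sum>j<n. (v \<bullet> x j) * (w \<bullet> x j)) = \<mu> * (v \<bullet> w)"
proof -
  define q where "q w = (\<Sum>j<n. (w \<bullet> x j)\<^sup>2)" for w
  define \<beta> where "\<beta> v w = (\<Sum>j<n. (v \<bullet> x j) * (w \<bullet> x j))" for v w
  have "continuous_on A q" for A unfolding q_def by (intro continuous_intros)
  moreover have "sphere (0 :: real ^ 'd) 1 \<noteq> {}" by simp
  ultimately obtain v where v: "v \<in> sphere 0 1" and min: "\<And>w. w \<in> sphere 0 1 \<Longrightarrow> q v \<le> q w"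
    using continuous_attains_inf[of "sphere 0 1" q] by auto
  have nv: "norm v = 1" using v by simp
  have low: "q v * (norm w)\<^sup>2 \<le> q w" for w
  proof (cases "w = 0")
    case False
    define s where "s = w /\<^sub>R norm w"
    have "q v \<le> q s" using False by (intro min) (simp add: s_def)
    then have "q v * (norm w)\<^sup>2 \<le> q s * (norm w)\<^sup>2" by (intro mult_right_mono) auto
    also have "\<dots> = q (norm w *\<^sub>R s)"
      by (simp add: q_def power_mult_distrib sum_distrib_left mult.commute)
    also have "norm w *\<^sub>R s = w" using False by (simp add: s_def)
    finally show ?thesis .
  qed (simp add: q_def)
  have eigen: "\<beta> v w = q v * (v \<bullet> w)" for w
  proof -
    have "0 \<le> t * (2 * (\<beta> v w - q v * (v \<bullet> w))) + t\<^sup>2 * (q w - q v * (norm w)\<^sup>2)" for t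
    proof -
      have "q (v + t *\<^sub>R w) = q v + 2 * t * \<beta> v w + t\<^sup>2 * q w"
        unfolding q_def \<beta>_def sum_distrib_left sum.distrib[symmetric]
        by (intro sum.cong refl) (simp add: inner_add_left power2_eq_square algebra_simps)
      moreover have "(norm (v + t *\<^sub>R w))\<^sup>2 = 1 + 2 * t * (v \<bullet> w) + t\<^sup>2 * (norm w)\<^sup>2"
        using nv unfolding power2_norm_eq_inner
        by (simp add: norm_eq_1 inner_add_left inner_add_right inner_commute[of w v] power2_eq_square algebra_simps)
      ultimately show ?thesis
        using low[of "v + t *\<^sub>R w"] by (simp add: algebra_simps)
    qed
    then have "2 * (\<beta> v w - q v * (v \<bullet> w)) = 0" by (rule linear_dominated_imp_zero)
    then show ?thesis by simp
  qed
  show ?thesis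
    using nv low eigen by (intro that[of v "q v"]) (simp_all add: q_def \<beta>_def)
qed

definition gram :: "nat \<Rightarrow> (nat \<Rightarrow> real ^ 'd) \<Rightarrow> real mat" where
  "gram n x = Matrix.mat n n (\<lambda>(i, j). x i \<bullet> x j)"

lemma gram_carrier [simp]: "gram n x \<in> carrier_mat n n"
  by (simp add: gram_def)

lemma gram_mult_vec:
  assumes "w \<in> carrier_vec n" "i < n"
  shows "vec_index (gram n x *\<^sub>v w) i = x i \<bullet> (\<Sum>j<n. vec_index w j *\<^sub>R x j)"
  using assms by (auto simp: gram_def scalar_prod_def inner_sum_right atLeast0LessThan mult.commute
      intro!: sum.cong)

lemma gram_eigenvalue_nonneg:
  assumes "poly (char_poly (gram n x)) k = 0"
  shows "0 \<le> k"
proof -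
  have "eigenvalue (gram n x) k"
    using assms eigenvalue_root_char_poly[OF gram_carrier] by blast
  then obtain w where w: "w \<in> carrier_vec n" "w \<noteq> 0\<^sub>v n" "gram n x *\<^sub>v w = k \<cdot>\<^sub>v w"
    by (auto simp: eigenvalue_def eigenvector_def gram_def)
  define s where "s = (\<Sum>j<n. vec_index w j *\<^sub>R x j)"
  have "k * vec_index w i = x i \<bullet> s" if "i < n" for i
    using gram_mult_vec[OF w(1) that, of x] w that by (simp add: s_def)
  then have "(\<Sum>i<n. vec_index w i * (k * vec_index w i)) = (\<Sum>i<n. vec_index w i * (x i \<bullet> s))"
    by (intro sum.cong) auto
  also have "\<dots> = s \<bullet> s"
    unfolding s_def by (simp add: inner_sum_left)
  finally have "k * (\<Sum>i<n. (vec_index w i)\<^sup>2) = s \<bullet> s"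
    by (simp add: sum_distrib_left power2_eq_square mult_ac)
  moreover have "0 < (\<Sum>i<n. (vec_index w i)\<^sup>2)"
  proof -
    obtain i where "i < n" "vec_index w i \<noteq> 0"
      using w(1,2) by (metis eq_vecI carrier_vecD index_zero_vec)
    then have "0 < (vec_index w i)\<^sup>2" by simp
    also have "\<dots> \<le> (\<Sum>i<n. (vec_index w i)\<^sup>2)"
      using \<open>i < n\<close> by (intro member_le_sum) auto
    finally show ?thesis .
  qed
  ultimately show ?thesis
    by (metis inner_ge_zero zero_le_mult_iff not_less)
qed

text \<open>
  The eigenvalues are counted with their multiplicity in the characteristic polynomial.  If the
  points lie in a hyperplane, \<open>0\<close> is an eigenvalue of their \<open>d \<times> d\<close> second moment matrix, so that by
  Sylvester's identity it is a root of order greater than \<open>n - d\<close> for the \<open>n \<times> n\<close> Gram matrix.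
\<close>

lemma length_nonzero_eigs_less_if_degenerate:
  fixes x :: "nat \<Rightarrow> real ^ 'd"
  assumes v: "v \<noteq> 0" "\<And>j. j < n \<Longrightarrow> v \<bullet> x j = 0"
  shows "length (nonzero_eigs (gram n x)) < CARD('d)"
proof -
  define d where "d = CARD('d)"
  obtain h :: "nat \<Rightarrow> 'd" where h: "bij_betw h {0..<d} UNIV"
    using ex_bij_betw_nat_finite[of "UNIV :: 'd set"] by (auto simp: d_def)
  have reidx: "(\<Sum>c = 0..<d. f (h c)) = (\<Sum>c\<in>UNIV. f c)" for f :: "'d \<Rightarrow> real"
    by (rule sum.reindex_bij_betw[OF h])
  define A where "A = Matrix.mat n d (\<lambda>(i, c). x i $ h c)"
  define B where "B = Matrix.mat d n (\<lambda>(c, i). x i $ h c)"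
  have AB: "A \<in> carrier_mat n d" "B \<in> carrier_mat d n" by (simp_all add: A_def B_def)
  have "gram n x = A * B"
    by (rule eq_matI) (auto simp: gram_def A_def B_def scalar_prod_def inner_vec_def reidx[of "\<lambda>c. x i $ c * x j $ c" for i j])
  then have syl: "[:0, 1:] ^ d * char_poly (gram n x) = [:0, 1:] ^ n * char_poly (B * A)"
    using char_poly_mult_commute[OF AB] by simp
  define w where "w = Matrix.vec d (\<lambda>c. v $ h c)"
  have BA: "B * A \<in> carrier_mat d d" using AB by simp
  have "eigenvalue (B * A) 0"
    unfolding eigenvalue_def eigenvector_def
  proof (intro exI[of _ w] conjI)
    show "w \<in> carrier_vec (dim_row (B * A))" using AB by (simp add: w_def)
    obtain c where "v $ c \<noteq> 0" using v(1) by (auto simp: Finite_Cartesian_Product.vec_eq_iff)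
    moreover obtain k where "k < d" "h k = c" using h by (metis UNIV_I atLeastLessThan_iff bij_betw_iff_bijections)
    ultimately have "vec_index w k \<noteq> vec_index (0\<^sub>v d) k" by (simp add: w_def)
    then show "w \<noteq> 0\<^sub>v (dim_row (B * A))" using AB by auto
    have "A *\<^sub>v w = 0\<^sub>v n"
    proof (rule eq_vecI)
      fix i assume "i < dim_vec (0\<^sub>v n)"
      then have "i < n" by simp
      have "vec_index (A *\<^sub>v w) i = (\<Sum>c = 0..<d. x i $ h c * v $ h c)"
        using \<open>i < n\<close> by (simp add: A_def w_def scalar_prod_def)
      also have "\<dots> = v \<bullet> x i"
        by (subst reidx[of "\<lambda>c. x i $ c * v $ c"]) (simp add: inner_vec_def mult.commute)
      finally show "vec_index (A *\<^sub>v w) i = vec_index (0\<^sub>v n) i" using v(2) \<open>i < n\<close> by simp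
    qed (simp add: A_def)
    moreover have "w \<in> carrier_vec d" by (simp add: w_def)
    ultimately have "(B * A) *\<^sub>v w = B *\<^sub>v 0\<^sub>v n"
      using AB by (simp add: assoc_mult_mat_vec[of B d n A d w])
    also have "\<dots> = 0 \<cdot>\<^sub>v w" using AB by (intro eq_vecI) (auto simp: w_def scalar_prod_def)
    finally show "(B * A) *\<^sub>v w = 0 \<cdot>\<^sub>v w" .
  qed
  then have root: "poly (char_poly (B * A)) 0 = 0"
    using eigenvalue_root_char_poly[OF BA] by simp
  have deg: "degree (char_poly (gram n x)) = n" "monic (char_poly (gram n x))"
    using degree_monic_char_poly[OF gram_carrier, of n x] by auto
  have deg': "monic (char_poly (B * A))" using degree_monic_char_poly[OF BA] by auto
  have nz: "char_poly (gram n x) \<noteq> 0" "char_poly (B * A) \<noteq> 0" using deg deg' by auto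
  have "order 0 ([:0, 1:] ^ d * char_poly (gram n x)) = d + order 0 (char_poly (gram n x))"
    using nz by (subst order_mult) (use order_power_n_n[of "0 :: real"] in auto)
  moreover have "order 0 ([:0, 1:] ^ n * char_poly (B * A)) = n + order 0 (char_poly (B * A))"
    using nz by (subst order_mult) (use order_power_n_n[of "0 :: real"] in auto)
  moreover have "order 0 (char_poly (B * A)) \<ge> 1"
    using root nz by (simp add: order_root Suc_le_eq)
  ultimately have ord: "n + 1 \<le> d + order 0 (char_poly (gram n x))" using syl by simp
  define R where "R = proots (char_poly (gram n x))"
  have "R = filter_mset (\<lambda>k. k \<noteq> 0) R + filter_mset (\<lambda>k. \<not> k \<noteq> 0) R"
    by (rule multiset_partition)
  then have "size R = size (filter_mset (\<lambda>k. k \<noteq> 0) R) + size (filter_mset (\<lambda>k. k = 0) R)"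
    by (metis (mono_tags, lifting) size_union filter_mset_cong0 not_not)
  moreover have "size (filter_mset (\<lambda>k. k = 0) R) = count R 0"
    by (simp add: filter_eq_replicate_mset)
  moreover have "count R 0 = order 0 (char_poly (gram n x))" using nz by (simp add: R_def)
  moreover have "size R \<le> n" using size_proots_le[of "char_poly (gram n x)"] deg by (simp add: R_def)
  moreover have "length (nonzero_eigs (gram n x)) = size (filter_mset (\<lambda>k. k \<noteq> 0) R)"
    by (simp add: nonzero_eigs_def R_def flip: size_mset)
  ultimately show ?thesis using ord unfolding d_def by linarith
qed

lemma set_nonzero_eigs_gram:
  "set (nonzero_eigs (gram n x)) = {k. k \<noteq> 0 \<and> poly (char_poly (gram n x)) k = 0}"
proof -
  have "char_poly (gram n x) \<noteq> 0"
    using degree_monic_char_poly[OF gram_carrier, of n x] by auto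
  then show ?thesis by (auto simp: nonzero_eigs_def)
qed

lemma eig_antimono:
  assumes "1 \<le> i" "i \<le> j" "j \<le> length (nonzero_eigs A)"
  shows "eig A j \<le> eig A i"
proof -
  have "sorted (rev (nonzero_eigs A))" by (simp add: nonzero_eigs_def)
  then have "sorted_wrt (\<ge>) (nonzero_eigs A)" by (simp add: sorted_wrt_rev)
  then have "nonzero_eigs A ! (j - 1) \<le> nonzero_eigs A ! (i - 1)"
    using assms by (cases "i = j") (auto simp: sorted_wrt_iff_nth_less)
  then show ?thesis using assms by (simp add: eig_def)
qed

text \<open>
  The smallest eigenvalue of the second moment matrix is positive, since otherwise the Gram matrix would have fewer
  than \<open>d\<close> nonzero eigenvalues.  An eigenvector \<open>v\<close> then yields the eigenvector \<open>(v \<bullet> x\<^sub>i)\<^sub>i\<close> of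
  the Gram matrix, so \<open>\<mu>\<close> is among the eigenvalues of which \<open>\<lambda>\<^sub>d\<close> is the smallest.
\<close>

lemma gram_smallest_eigenvalue:
  fixes x :: "nat \<Rightarrow> real ^ 'd"
  assumes len: "length (nonzero_eigs (gram n x)) = CARD('d)"
  obtains \<mu> where "0 < \<mu>" "eig (gram n x) CARD('d) \<le> \<mu>"
    and "\<And>w. \<mu> * (norm w)\<^sup>2 \<le> (\<Sum>j<n. (w \<bullet> x j)\<^sup>2)"
proof -
  obtain \<mu> v where nv: "norm v = 1" and low: "\<And>w. \<mu> * (norm w)\<^sup>2 \<le> (\<Sum>j<n. (w \<bullet> x j)\<^sup>2)"
    and eq: "\<And>w. (\<Sum>j<n. (v \<bullet> x j) * (w \<bullet> x j)) = \<mu> * (v \<bullet> w)"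
    by (rule min_quadratic_form_eigenvector[where n = n and x = x]) blast
  have vv: "v \<bullet> v = 1" using nv by (simp add: norm_eq_1)
  have \<mu>: "\<mu> = (\<Sum>j<n. (v \<bullet> x j)\<^sup>2)" using eq[of v] vv by (simp add: power2_eq_square)
  have "\<mu> \<noteq> 0"
  proof
    assume "\<mu> = 0"
    then have "\<forall>j\<in>{..<n}. (v \<bullet> x j)\<^sup>2 = 0"
      using \<mu> by (subst sum_nonneg_eq_0_iff[symmetric]) auto
    moreover have "v \<noteq> 0" using nv by auto
    ultimately have "length (nonzero_eigs (gram n x)) < CARD('d)"
      by (intro length_nonzero_eigs_less_if_degenerate[of v]) auto
    then show False using len by simp
  qed
  moreover have "0 \<le> \<mu>" unfolding \<mu> by (intro sum_nonneg) auto
  ultimately have "0 < \<mu>" by simp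
  define w where "w = Matrix.vec n (\<lambda>i. v \<bullet> x i)"
  have w: "w \<in> carrier_vec n" by (simp add: w_def)
  have "eigenvector (gram n x) w \<mu>"
    unfolding eigenvector_def
  proof (intro conjI)
    show "w \<in> carrier_vec (dim_row (gram n x))" by (simp add: w_def gram_def)
    show "w \<noteq> 0\<^sub>v (dim_row (gram n x))"
    proof
      assume "w = 0\<^sub>v (dim_row (gram n x))"
      then have "vec_index w j = 0" if "j < n" for j using that by (simp add: gram_def)
      then have "v \<bullet> x j = 0" if "j < n" for j using that by (simp add: w_def)
      then show False using \<mu> \<open>\<mu> \<noteq> 0\<close> by simp
    qed
    show "gram n x *\<^sub>v w = \<mu> \<cdot>\<^sub>v w"
    proof (rule eq_vecI)
      fix i assume "i < dim_vec (\<mu> \<cdot>\<^sub>v w)"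
      then have "i < n" by (simp add: w_def)
      then show "vec_index (gram n x *\<^sub>v w) i = vec_index (\<mu> \<cdot>\<^sub>v w) i"
        using eq[of "x i"] unfolding gram_mult_vec[OF w \<open>i < n\<close>]
        by (simp add: w_def inner_sum_right)
    qed (simp add: w_def gram_def)
  qed
  then have "poly (char_poly (gram n x)) \<mu> = 0"
    using eigenvalue_root_char_poly[OF gram_carrier] by (auto simp: eigenvalue_def)
  then have "\<mu> \<in> set (nonzero_eigs (gram n x))"
    using \<open>\<mu> \<noteq> 0\<close> by (simp add: set_nonzero_eigs_gram)
  then obtain k where "k < CARD('d)" "nonzero_eigs (gram n x) ! k = \<mu>"
    using len by (auto simp: in_set_conv_nth)
  then have "eig (gram n x) CARD('d) \<le> \<mu>"
    using eig_antimono[of "Suc k" "CARD('d)" "gram n x"] len by (simp add: eig_def)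
  then show ?thesis using that \<open>0 < \<mu>\<close> low by blast
qed

text \<open>
  For the last bunch the upper end of the gap is \<open>\<lambda>\<^sub>d\<close> and the lower end \<open>\<lambda>\<^sub>d\<^sub>+\<^sub>1 = 0\<close>, and the
  denominator \<open>\<lambda>\<^sub>l\<close> is at least \<open>\<lambda>\<^sub>d\<close>.
\<close>

lemma bunching_bound_le_smallest_eigenvalue:
  fixes x :: "nat \<Rightarrow> real ^ 'd"
  assumes len: "length (nonzero_eigs (gram n x)) = CARD('d)"
    and l: "1 \<le> l" "l \<le> CARD('d)"
    and gap: "b \<le> (eig (gram n x) CARD('d) - eig (gram n x) (CARD('d) + 1))\<^sup>2 / eig (gram n x) l"
  shows "b \<le> eig (gram n x) CARD('d)"
proof -
  let ?lam = "eig (gram n x)"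
  have "?lam CARD('d) \<in> set (nonzero_eigs (gram n x))"
    using len by (simp add: eig_def)
  then have pos: "0 < ?lam CARD('d)"
    using gram_eigenvalue_nonneg[of n x] by (force simp: set_nonzero_eigs_gram)
  have "?lam (CARD('d) + 1) = 0" using len by (simp add: eig_def)
  with gap have "b \<le> (?lam CARD('d))\<^sup>2 / ?lam l" by simp
  also have "\<dots> \<le> (?lam CARD('d))\<^sup>2 / ?lam CARD('d)"
    using eig_antimono[of l "CARD('d)" "gram n x"] l len pos by (intro divide_left_mono) auto
  also have "\<dots> = ?lam CARD('d)" using pos by (simp add: power2_eq_square)
  finally show ?thesis .
qed

lemma centered_gram_eq_gram:
  fixes z :: "nat \<Rightarrow> real ^ 'd"
  assumes "0 < n"
  shows "centered_gram n z = gram n (\<lambda>i. z i - (\<Sum>k<n. z k) /\<^sub>R real n)"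
proof (rule eq_matI)
  define C where "C i k = (if i = k then 1 else 0) - 1 / real n" for i k :: nat
  define G where "G = Matrix.mat n n (\<lambda>(i, j). z i \<bullet> z j)"
  have C: "centering_matrix n = Matrix.mat n n (\<lambda>(i, k). C i k)"
    by (rule eq_matI) (auto simp: centering_matrix_def C_def)
  have shift: "(\<Sum>k<n. C i k *\<^sub>R z k) = z i - (\<Sum>k<n. z k) /\<^sub>R real n" if "i < n" for i
  proof -
    have "(\<Sum>k<n. C i k *\<^sub>R z k) = (\<Sum>k<n. (if i = k then z k else 0) - (1 / real n) *\<^sub>R z k)"
      by (intro sum.cong refl) (simp add: C_def scaleR_diff_left)
    also have "\<dots> = z i - (\<Sum>k<n. z k) /\<^sub>R real n"
      using that by (simp add: sum_subtractf scaleR_sum_right inverse_eq_divide)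
    finally show ?thesis .
  qed
  fix i j assume "i < dim_row (gram n (\<lambda>i. z i - (\<Sum>k<n. z k) /\<^sub>R real n))"
    "j < dim_col (gram n (\<lambda>i. z i - (\<Sum>k<n. z k) /\<^sub>R real n))"
  then have ij: "i < n" "j < n" by (simp_all add: gram_def)
  have "centered_gram n z $$ (i, j) = (\<Sum>l<n. (\<Sum>k<n. C i k * (z k \<bullet> z l)) * C l j)"
    using ij by (simp add: centered_gram_def C scalar_prod_def atLeast0LessThan)
  also have "\<dots> = (\<Sum>l<n. ((\<Sum>k<n. C i k *\<^sub>R z k) \<bullet> z l) * C l j)"
    by (simp add: inner_sum_left)
  also have "\<dots> = (\<Sum>k<n. C i k *\<^sub>R z k) \<bullet> (\<Sum>l<n. C j l *\<^sub>R z l)"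
    by (simp add: inner_sum_right C_def mult.commute eq_commute)
  finally show "centered_gram n z $$ (i, j) = gram n (\<lambda>i. z i - (\<Sum>k<n. z k) /\<^sub>R real n) $$ (i, j)"
    using ij by (simp only: shift) (simp add: gram_def)
qed (simp_all add: centered_gram_def centering_matrix_def gram_def)

section \<open>Learnability\<close>

text \<open>
  Convergence in probability from a deterministic bound outside of small exceptional events.
  Since \<^const>\<open>measure\<close> is \<open>0\<close> on sets that are not measurable, the bound on the measure of
  \<open>\<bar>X\<bar> > \<delta>\<close> is trivial for such sets, and \<open>W n\<close> is measurable as soon as its measure is positive.
\<close>

lemma null_in_probI:
  fixes X :: "nat \<Rightarrow> 'w \<Rightarrow> real"
  assumes ps: "\<And>n. prob_space (M n)"
    and W: "(\<lambda>n. measure (M n) {\<omega> \<in> space (M n). W n \<omega>}) \<longlonglongrightarrow> 1"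
    and E: "\<forall>\<^sub>F n in sequentially. \<exists>E\<in>sets (M n). measure (M n) E \<le> q n \<and>
      (\<forall>\<omega>\<in>space (M n) - E. W n \<omega> \<longrightarrow> \<bar>X n \<omega>\<bar> \<le> c n)"
    and q: "q \<longlonglongrightarrow> 0" and c: "c \<longlonglongrightarrow> 0"
  shows "null_in_prob M X"
  unfolding null_in_prob_def
proof (intro allI impI)
  fix \<delta> :: real assume "0 < \<delta>"
  let ?W = "\<lambda>n. {\<omega> \<in> space (M n). W n \<omega>}"
  let ?B = "\<lambda>n. {\<omega> \<in> space (M n). \<bar>X n \<omega>\<bar> > \<delta>}"
  have W_pos: "\<forall>\<^sub>F n in sequentially. 0 < measure (M n) (?W n)"
    using order_tendstoD(1)[OF W, of 0] by simp
  have bad_le: "\<forall>\<^sub>F n in sequentially. measure (M n) (?B n) \<le> (1 - measure (M n) (?W n)) + q n"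
    using E W_pos order_tendstoD(2)[OF c \<open>0 < \<delta>\<close>]
  proof eventually_elim
    case (elim n)
    interpret prob_space "M n" by (rule ps)
    from elim(1) obtain E where E: "E \<in> events" "prob E \<le> q n"
      and EX: "\<And>\<omega>. \<omega> \<in> space (M n) - E \<Longrightarrow> W n \<omega> \<Longrightarrow> \<bar>X n \<omega>\<bar> \<le> c n" by blast
    have Wm: "?W n \<in> events"
      by (rule ccontr) (use elim(2) in \<open>simp add: measure_notin_sets\<close>)
    have "prob (?B n) \<le> prob ((space (M n) - ?W n) \<union> E)"
    proof (cases "?B n \<in> events")
      case True
      have "?B n \<subseteq> (space (M n) - ?W n) \<union> E"
      proof
        fix \<omega> assume \<omega>: "\<omega> \<in> ?B n"
        show "\<omega> \<in> (space (M n) - ?W n) \<union> E"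
        proof (rule ccontr)
          assume "\<omega> \<notin> (space (M n) - ?W n) \<union> E"
          then have "\<omega> \<in> space (M n) - E" "W n \<omega>" using \<omega> by auto
          from EX[OF this] show False using \<omega> elim(3) by simp
        qed
      qed
      then show ?thesis using Wm E by (intro finite_measure_mono) auto
    qed (simp add: measure_notin_sets)
    also have "\<dots> \<le> prob (space (M n) - ?W n) + prob E"
      using Wm E by (intro measure_Un_le) auto
    also have "\<dots> \<le> (1 - prob (?W n)) + q n"
      using E prob_compl[OF Wm] by simp
    finally show ?case .
  qed
  show "(\<lambda>n. measure (M n) (?B n)) \<longlonglongrightarrow> 0"
  proof (rule tendsto_sandwich[OF always_eventually bad_le tendsto_const])
    show "(\<lambda>n. (1 - measure (M n) (?W n)) + q n) \<longlonglongrightarrow> 0"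
      using tendsto_add[OF tendsto_diff[OF tendsto_const W, of 1] q] by simp
    show "\<forall>n. 0 \<le> measure (M n) (?B n)" by (intro allI measure_nonneg)
  qed
qed

lemma exceptional_prob_tendsto_0: "(\<lambda>n. 2 * real n * exp (- real n)) \<longlonglongrightarrow> 0"
proof -
  have "(\<lambda>n. 2 * (real n ^ 1 / exp (real n))) \<longlonglongrightarrow> 2 * 0"
    by (intro tendsto_mult tendsto_const
        filterlim_compose[OF tendsto_power_div_exp_0 filterlim_real_sequentially])
  then show ?thesis by (simp add: exp_minus field_simps)
qed

text \<open>
  Otherwise \<open>K\<close> vanishes identically, all networks are almost surely empty, and the expectation
  in the definition of sparsity is \<open>0\<close>.
\<close>

lemma sparse_imp_link_zero_pos:
  fixes Z :: "nat \<Rightarrow> 'w \<Rightarrow> nat \<Rightarrow> real ^ 'd"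
  assumes reg: "regular_lpm S K G \<epsilon> M Z Y" and sparse: "sparse_in_expectation e M Y"
  shows "0 < K 0"
proof (rule ccontr)
  have lpm: "lpm S K M Z Y" and diff: "K differentiable_on {0..}" and anti: "antimono_on {0..} K"
    using reg by (auto simp: regular_lpm_def)
  have cont: "continuous_on {0..} K" by (rule differentiable_imp_continuous_on[OF diff])
  have nonneg: "0 \<le> x \<Longrightarrow> 0 \<le> K x" for x using lpm by (simp add: lpm_def)
  assume "\<not> 0 < K 0"
  then have K0: "K x = 0" if "0 \<le> x" for x
    using monotone_onD[OF anti, of 0 x] nonneg[of x] that by simp
  have "integral\<^sup>L (M n) (\<lambda>\<omega>. \<Sum>i<n. \<Sum>j<n. Y n \<omega> $$ (i, j) / e n) = 0" for n
  proof -
    interpret prob_space "M n" using lpm by (simp add: lpm_def)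
    have "expectation (\<lambda>\<omega>. \<Sum>i<n. \<Sum>j<n. Y n \<omega> $$ (i, j) / e n) =
        expectation (\<lambda>\<omega>. 2 / e n * (\<Sum>p\<in>dyads n. Y n \<omega> $$ p))"
    proof (rule Bochner_Integration.integral_cong[OF refl])
      fix \<omega> assume "\<omega> \<in> space (M n)"
      then have Y: "Y n \<omega> $$ (i, j) = Y n \<omega> $$ (j, i)" "Y n \<omega> $$ (i, i) = 0" if "i < n" "j < n" for i j
        using lpm that by (simp_all add: lpm_def)
      have "(\<Sum>i<n. \<Sum>j<n. Y n \<omega> $$ (i, j) / e n) = 2 * (\<Sum>(i, j)\<in>dyads n. Y n \<omega> $$ (i, j) / e n)"
        by (rule sum_symmetric_eq_dyads) (use Y in auto)
      then show "(\<Sum>i<n. \<Sum>j<n. Y n \<omega> $$ (i, j) / e n) = 2 / e n * (\<Sum>p\<in>dyads n. Y n \<omega> $$ p)"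
        by (simp add: sum_divide_distrib[symmetric] case_prod_unfold)
    qed
    also have "\<dots> = 2 / e n * expectation (\<lambda>\<omega>. \<Sum>p\<in>dyads n. Y n \<omega> $$ p)"
      by (rule integral_mult_right_zero)
    also have "expectation (\<lambda>\<omega>. \<Sum>p\<in>dyads n. Y n \<omega> $$ p) = (\<Sum>p\<in>dyads n. expectation (\<lambda>\<omega>. Y n \<omega> $$ p))"
    proof (rule Bochner_Integration.integral_sum)
      fix p assume p: "p \<in> dyads n"
      show "integrable (M n) (\<lambda>\<omega>. Y n \<omega> $$ p)"
      proof (rule integrable_const_bound)
        show "AE \<omega> in M n. norm (Y n \<omega> $$ p) \<le> 1"
        proof (rule AE_I2)
          fix \<omega> assume "\<omega> \<in> space (M n)"
          from adjacency_0_1[OF lpm cont this p] show "norm (Y n \<omega> $$ p) \<le> 1" by auto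
        qed
      qed (rule adjacency_measurable[OF lpm cont p])
    qed
    also have "\<dots> = 0"
    proof (rule sum.neutral, rule ballI)
      fix p assume "p \<in> dyads n"
      then have "expectation (\<lambda>\<omega>. 1 * (\<Prod>p\<in>{p}. Y n \<omega> $$ p)) =
          expectation (\<lambda>\<omega>. 1 * (\<Prod>p\<in>{p}. link_at K (Z n \<omega>) p))"
        by (intro expectation_prod_adjacency[OF lpm cont, where c = 1]) auto
      then show "expectation (\<lambda>\<omega>. Y n \<omega> $$ p) = 0" by (simp add: link_at_def K0)
    qed
    finally show ?thesis by simp
  qed
  with sparse show False
    by (auto simp: sparse_in_expectation_def LIMSEQ_const_iff)
qed

lemma sparse_imp_rate_pos:
  fixes Z :: "nat \<Rightarrow> 'w \<Rightarrow> nat \<Rightarrow> real ^ 'd"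
  assumes lpm: "lpm S K M Z Y" and sparse: "sparse_in_expectation e M Y"
  shows "\<forall>\<^sub>F n in sequentially. 0 < e n"
proof -
  obtain C where "C > 0"
    and C: "(\<lambda>n. integral\<^sup>L (M n) (\<lambda>\<omega>. \<Sum>i<n. \<Sum>j<n. Y n \<omega> $$ (i, j) / e n)) \<longlonglongrightarrow> C"
    using sparse by (auto simp: sparse_in_expectation_def)
  from order_tendstoD(1)[OF C \<open>C > 0\<close>] show ?thesis
  proof eventually_elim
    case (elim n)
    show ?case
    proof (rule ccontr)
      assume "\<not> 0 < e n"
      then have "0 \<le> - (\<Sum>i<n. \<Sum>j<n. Y n \<omega> $$ (i, j) / e n)" if "\<omega> \<in> space (M n)" for \<omega>
      proof -
        have "Y n \<omega> $$ (i, j) / e n \<le> 0" if "i < n" "j < n" for i j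
        proof -
          have "Y n \<omega> $$ (i, j) \<in> {0, 1}" using lpm \<open>\<omega> \<in> space (M n)\<close> that by (simp add: lpm_def)
          then show ?thesis using \<open>\<not> 0 < e n\<close> by (auto simp: divide_nonneg_nonpos)
        qed
        then show ?thesis by (auto intro!: sum_nonpos)
      qed
      then have "0 \<le> integral\<^sup>L (M n) (\<lambda>\<omega>. - (\<Sum>i<n. \<Sum>j<n. Y n \<omega> $$ (i, j) / e n))"
        by (intro Bochner_Integration.integral_nonneg) auto
      then show False using elim by simp
    qed
  qed
qed

text \<open>
  If \<open>G n = 0\<close>, then \<open>alpha_sup\<close> is a supremum over the empty set and hence finite as well.
\<close>

lemma eventually_hellinger_consistency:
  fixes Z :: "nat \<Rightarrow> 'w \<Rightarrow> nat \<Rightarrow> real ^ 'd"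
  assumes reg: "regular_lpm S K G \<epsilon> M Z Y" and K0: "0 < K 0"
    and fin: "\<forall>\<^sub>F n in sequentially. 0 < G (real n) \<longrightarrow> alpha_sup K G \<epsilon> n < \<infinity>"
  shows "\<forall>\<^sub>F n in sequentially. 0 < n \<and> 0 \<le> G (real n) \<and> alpha_sup K G \<epsilon> n < \<infinity> \<and>
    (\<exists>E\<in>sets (M n). measure (M n) E \<le> 2 * real n * exp (- real n) \<and>
    (\<forall>\<omega>\<in>space (M n) - E. (MAX i\<in>{..<n}. norm (Z n \<omega> i)) \<le> G (real n) \<longrightarrow>
      (\<forall>i<n. norm (Z n \<omega> i) \<le> G (real n)) \<and>
      (\<forall>i<n. norm (poisson_mle K G (Y n \<omega>) i :: real ^ 'd) \<le> G (real n)) \<and>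
      hellinger_sq K n (poisson_mle K G (Y n \<omega>)) (Z n \<omega>) \<le>
        136 * (real CARD('d))\<^sup>2 * (enn2real (alpha_sup K G \<epsilon> n) * (G (real n))\<^sup>2 * (real n * sqrt (real n)))))"
proof -
  have lpm: "lpm S K M Z Y" and diff: "K differentiable_on {0..}"
    and W: "(\<lambda>n. measure (M n) {\<omega> \<in> space (M n). (MAX i\<in>{..<n}. norm (Z n \<omega> i)) \<le> G (real n)}) \<longlonglongrightarrow> 1"
    using reg by (auto simp: regular_lpm_def)
  have cont: "continuous_on {0..} K" by (rule differentiable_imp_continuous_on[OF diff])
  have W_pos: "\<forall>\<^sub>F n in sequentially.
      0 < measure (M n) {\<omega> \<in> space (M n). (MAX i\<in>{..<n}. norm (Z n \<omega> i)) \<le> G (real n)}"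
    using order_tendstoD(1)[OF W, of 0] by simp
  from fin W_pos eventually_gt_at_top[of 0] show ?thesis
  proof eventually_elim
    case (elim n)
    have max: "\<forall>i<n. norm (Z n \<omega> i) \<le> G (real n)" if "(MAX i\<in>{..<n}. norm (Z n \<omega> i)) \<le> G (real n)" for \<omega>
      using that elim(3) by (auto simp: lessThan_empty_iff)
    have "{\<omega> \<in> space (M n). (MAX i\<in>{..<n}. norm (Z n \<omega> i)) \<le> G (real n)} \<noteq> {}"
      using elim(2) by force
    then obtain \<omega> where "(MAX i\<in>{..<n}. norm (Z n \<omega> i)) \<le> G (real n)" by blast
    from max[OF this] have "norm (Z n \<omega> 0) \<le> G (real n)" using elim(3) by blast
    then have G: "0 \<le> G (real n)" by (rule order.trans[OF norm_ge_zero])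
    have alpha: "alpha_sup K G \<epsilon> n < \<infinity>"
    proof (cases "0 < G (real n)")
      case False
      then show ?thesis by (simp add: alpha_sup_def bot_ennreal)
    qed (use elim in simp)
    obtain E where E: "E \<in> sets (M n)" "measure (M n) E \<le> 2 * real n * exp (- real n)"
      and H: "\<And>\<omega>. \<omega> \<in> space (M n) - E \<Longrightarrow> \<forall>i<n. norm (Z n \<omega> i) \<le> G (real n) \<Longrightarrow>
        hellinger_sq K n (poisson_mle K G (Y n \<omega>)) (Z n \<omega>) \<le>
        136 * (real CARD('d))\<^sup>2 * (enn2real (alpha_sup K G \<epsilon> n) * (G (real n))\<^sup>2 * (real n * sqrt (real n)))"
      using hellinger_consistency[OF reg K0 alpha elim(3) G] by blast
    have mle: "\<forall>i<n. norm (poisson_mle K G (Y n \<omega>) i :: real ^ 'd) \<le> G (real n)" if "\<omega> \<in> space (M n)" for \<omega>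
    proof -
      have "Y n \<omega> \<in> carrier_mat n n" using lpm that by (simp add: lpm_def)
      then show ?thesis using poisson_mle_maximizes(1)[where G = G and n = n, OF cont _ G] by blast
    qed
    show ?case
      using elim(3) G alpha E max mle H by (intro conjI bexI[OF _ E(1)] ballI impI) auto
  qed
qed

lemma powr_one_and_half: "0 < n \<Longrightarrow> real n powr (3 / 2) = real n * sqrt (real n)"
  using powr_add[of "real n" 1 "1/2"] by (simp add: powr_half_sqrt)

lemma tendsto_0_imp_enn2real: "f \<longlonglongrightarrow> 0 \<Longrightarrow> (\<lambda>n. enn2real (f n)) \<longlonglongrightarrow> 0"
  using tendsto_enn2real[of f 0 sequentially] by simp

lemma eventually_less_infinity: "f \<longlonglongrightarrow> (0 :: ennreal) \<Longrightarrow> \<forall>\<^sub>F n in sequentially. f n < \<infinity>"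
  by (rule order_tendstoD) auto

proposition poisson_mle_learns_link_probs:
  fixes Z :: "nat \<Rightarrow> 'w \<Rightarrow> nat \<Rightarrow> real ^ 'd"
  assumes reg: "regular_lpm S K G \<epsilon> M Z Y" and sparse: "sparse_in_expectation e M Y"
    and rate: "link_prob_rate K G \<epsilon> e"
  shows "learns_link_probs (poisson_mle K G :: real mat \<Rightarrow> nat \<Rightarrow> real ^ 'd) K e M Z Y"
proof -
  have lpm: "lpm S K M Z Y"
    and W: "(\<lambda>n. measure (M n) {\<omega> \<in> space (M n). (MAX i\<in>{..<n}. norm (Z n \<omega> i)) \<le> G (real n)}) \<longlonglongrightarrow> 1"
    using reg by (auto simp: regular_lpm_def)
  have K: "0 \<le> x \<Longrightarrow> 0 \<le> K x \<and> K x \<le> 1" for x using lpm by (simp add: lpm_def)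
  have ps: "prob_space (M n)" for n using lpm by (simp add: lpm_def)
  define \<rho> where "\<rho> = (\<lambda>n. alpha_sup K G \<epsilon> n / ennreal (e n) * ennreal (real n powr 1.5 * (G (real n))\<^sup>2))"
  have \<rho>: "\<rho> \<longlonglongrightarrow> 0" using rate unfolding link_prob_rate_def \<rho>_def .
  have e: "\<forall>\<^sub>F n in sequentially. 0 < e n" by (rule sparse_imp_rate_pos[OF lpm sparse])
  have fin: "\<forall>\<^sub>F n in sequentially. 0 < G (real n) \<longrightarrow> alpha_sup K G \<epsilon> n < \<infinity>"
    using eventually_less_infinity[OF \<rho>] e eventually_gt_at_top[of 0]
  proof eventually_elim
    case (elim n)
    show ?case
    proof (intro impI, rule ccontr)
      assume "0 < G (real n)" "\<not> alpha_sup K G \<epsilon> n < \<infinity>"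
      then have "\<rho> n = \<infinity>"
        using elim by (simp add: \<rho>_def not_less top_unique divide_ennreal_def inverse_ennreal
            ennreal_top_mult ennreal_eq_0_iff not_le)
      then show False using elim by simp
    qed
  qed
  show ?thesis
    unfolding learns_link_probs_def
  proof (rule null_in_probI[OF ps W _ exceptional_prob_tendsto_0])
    show "(\<lambda>n. 1088 * (real CARD('d))\<^sup>2 * enn2real (\<rho> n)) \<longlonglongrightarrow> 0"
      using tendsto_mult[OF tendsto_const tendsto_0_imp_enn2real[OF \<rho>], of "1088 * (real CARD('d))\<^sup>2"] by simp
    show "\<forall>\<^sub>F n in sequentially. \<exists>E\<in>sets (M n). measure (M n) E \<le> 2 * real n * exp (- real n) \<and>
      (\<forall>\<omega>\<in>space (M n) - E. (MAX i\<in>{..<n}. norm (Z n \<omega> i)) \<le> G (real n) \<longrightarrow>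
        \<bar>(frob_norm n (\<lambda>i j. link_prob_matrix K (poisson_mle K G (Y n \<omega>) :: nat \<Rightarrow> real ^ 'd) i j
          - link_prob_matrix K (Z n \<omega>) i j))\<^sup>2 / e n\<bar> \<le> 1088 * (real CARD('d))\<^sup>2 * enn2real (\<rho> n))"
      using eventually_hellinger_consistency[OF reg sparse_imp_link_zero_pos[OF reg sparse] fin] e
    proof eventually_elim
      case (elim n)
      define a where "a = enn2real (alpha_sup K G \<epsilon> n)"
      have a: "alpha_sup K G \<epsilon> n = ennreal a" "0 \<le> a" using elim by (simp_all add: a_def less_top)
      have \<rho>n: "enn2real (\<rho> n) = a * (G (real n))\<^sup>2 * (real n * sqrt (real n)) / e n"
        using elim a(2) by (simp add: \<rho>_def a(1) divide_ennreal powr_one_and_half flip: ennreal_mult)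
      from elim obtain E where E: "E \<in> sets (M n)" "measure (M n) E \<le> 2 * real n * exp (- real n)"
        and H: "\<And>\<omega>. \<omega> \<in> space (M n) - E \<Longrightarrow> (MAX i\<in>{..<n}. norm (Z n \<omega> i)) \<le> G (real n) \<Longrightarrow>
          hellinger_sq K n (poisson_mle K G (Y n \<omega>)) (Z n \<omega>) \<le>
          136 * (real CARD('d))\<^sup>2 * (a * (G (real n))\<^sup>2 * (real n * sqrt (real n)))"
        unfolding a_def by blast
      show ?case
      proof (intro bexI[OF _ E(1)] conjI E(2) ballI impI)
        fix \<omega> assume \<omega>: "\<omega> \<in> space (M n) - E" "(MAX i\<in>{..<n}. norm (Z n \<omega> i)) \<le> G (real n)"
        let ?F = "(frob_norm n (\<lambda>i j. link_prob_matrix K (poisson_mle K G (Y n \<omega>) :: nat \<Rightarrow> real ^ 'd) i j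
          - link_prob_matrix K (Z n \<omega>) i j))\<^sup>2"
        have "?F \<le> 8 * hellinger_sq K n (poisson_mle K G (Y n \<omega>)) (Z n \<omega>)"
          by (rule link_prob_frob_le_hellinger[OF K])
        also have "\<dots> \<le> 8 * (136 * (real CARD('d))\<^sup>2 * (a * (G (real n))\<^sup>2 * (real n * sqrt (real n))))"
          by (rule mult_left_mono[OF H[OF \<omega>]]) simp
        finally have "?F / e n \<le> 8 * (136 * (real CARD('d))\<^sup>2 * (a * (G (real n))\<^sup>2 * (real n * sqrt (real n)))) / e n"
          using elim by (intro divide_right_mono) auto
        also have "\<dots> = 1088 * (real CARD('d))\<^sup>2 * enn2real (\<rho> n)" by (simp add: \<rho>n)
        finally show "\<bar>?F / e n\<bar> \<le> 1088 * (real CARD('d))\<^sup>2 * enn2real (\<rho> n)"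
          using elim by (simp add: abs_of_nonneg)
      qed
    qed
  qed
qed

lemma eventually_sq_dist_error_bound:
  fixes Z :: "nat \<Rightarrow> 'w \<Rightarrow> nat \<Rightarrow> real ^ 'd"
  assumes reg: "regular_lpm S K G \<epsilon> M Z Y" and K0: "0 < K 0"
    and fin: "\<forall>\<^sub>F n in sequentially. beta_sup K G n < \<infinity>"
      "\<forall>\<^sub>F n in sequentially. 0 < G (real n) \<longrightarrow> alpha_sup K G \<epsilon> n < \<infinity>"
  shows "\<forall>\<^sub>F n in sequentially. 0 < n \<and> beta_sup K G n < \<infinity> \<and> alpha_sup K G \<epsilon> n < \<infinity> \<and>
    (\<exists>E\<in>sets (M n). measure (M n) E \<le> 2 * real n * exp (- real n) \<and>
    (\<forall>\<omega>\<in>space (M n) - E. (MAX i\<in>{..<n}. norm (Z n \<omega> i)) \<le> G (real n) \<longrightarrow>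
      (frob_norm n (\<lambda>i j. sq_dist_matrix (poisson_mle K G (Y n \<omega>) :: nat \<Rightarrow> real ^ 'd) i j
        - sq_dist_matrix (Z n \<omega>) i j))\<^sup>2 \<le>
      4352 * (real CARD('d))\<^sup>2 * (enn2real (beta_sup K G n) * enn2real (alpha_sup K G \<epsilon> n) *
        (G (real n))\<^sup>2 * (real n * sqrt (real n)))))"
  using eventually_hellinger_consistency[OF reg K0 fin(2)] fin(1)
proof eventually_elim
  case (elim n)
  have lpm: "lpm S K M Z Y" and diff: "K differentiable_on {0..}" and anti: "antimono_on {0..} K"
    and "0 < \<epsilon>"
    using reg by (auto simp: regular_lpm_def)
  have nonneg: "0 \<le> x \<Longrightarrow> 0 \<le> K x" for x using lpm by (simp add: lpm_def)
  define a where "a = enn2real (alpha_sup K G \<epsilon> n)"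
  define B where "B = enn2real (beta_sup K G n)"
  have "0 \<le> B" by (simp add: B_def)
  have n: "0 < n" by (rule conjunct1[OF elim(1)])
  have alpha: "alpha_sup K G \<epsilon> n < \<infinity>" by (rule conjunct1[OF conjunct2[OF conjunct2[OF elim(1)]]])
  from elim obtain E where E: "E \<in> sets (M n)" "measure (M n) E \<le> 2 * real n * exp (- real n)"
    and H: "\<And>\<omega>. \<omega> \<in> space (M n) - E \<Longrightarrow> (MAX i\<in>{..<n}. norm (Z n \<omega> i)) \<le> G (real n) \<Longrightarrow>
      (\<forall>i<n. norm (Z n \<omega> i) \<le> G (real n)) \<and>
      (\<forall>i<n. norm (poisson_mle K G (Y n \<omega>) i :: real ^ 'd) \<le> G (real n)) \<and>
      hellinger_sq K n (poisson_mle K G (Y n \<omega>)) (Z n \<omega>) \<le>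
      136 * (real CARD('d))\<^sup>2 * (a * (G (real n))\<^sup>2 * (real n * sqrt (real n)))"
    unfolding a_def by blast
  have pos: "0 < K t" if "0 \<le> t" "t \<le> 2 * G (real n)" for t
  proof (rule link_positive[OF diff _ K0 that])
    fix s assume "0 < s" "s < 2 * G (real n)"
    then show "\<bar>deriv K s\<bar> \<le> (\<epsilon> * enn2real (alpha_sup K G \<epsilon> n)) * s * K s"
      by (intro deriv_link_le_alpha_sup[OF alpha \<open>0 < \<epsilon>\<close> nonneg]) auto
  qed
  have lip: "\<bar>x\<^sup>2 - y\<^sup>2\<bar> \<le> 4 * sqrt B * \<bar>sqrt (K x) - sqrt (K y)\<bar>"
    if "0 \<le> x" "x \<le> 2 * G (real n)" "0 \<le> y" "y \<le> 2 * G (real n)" for x y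
  proof (rule sq_diff_le_sqrt_link_diff[OF diff anti pos _ that])
    fix t assume "0 < t" "t < 2 * G (real n)"
    then show "t\<^sup>2 * K t \<le> B * (deriv K t)\<^sup>2"
      unfolding B_def by (intro link_le_beta_sup[OF elim(2) nonneg]) auto
  qed
  have bound: "(frob_norm n (\<lambda>i j. sq_dist_matrix (poisson_mle K G (Y n \<omega>) :: nat \<Rightarrow> real ^ 'd) i j
        - sq_dist_matrix (Z n \<omega>) i j))\<^sup>2 \<le>
      4352 * (real CARD('d))\<^sup>2 * (B * a * (G (real n))\<^sup>2 * (real n * sqrt (real n)))"
    if \<omega>: "\<omega> \<in> space (M n) - E" "(MAX i\<in>{..<n}. norm (Z n \<omega> i)) \<le> G (real n)" for \<omega>
  proof -
    have "(frob_norm n (\<lambda>i j. sq_dist_matrix (poisson_mle K G (Y n \<omega>) :: nat \<Rightarrow> real ^ 'd) i j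
        - sq_dist_matrix (Z n \<omega>) i j))\<^sup>2 \<le> 32 * B * hellinger_sq K n (poisson_mle K G (Y n \<omega>)) (Z n \<omega>)"
    proof (rule sq_dist_frob_le_hellinger[OF lip \<open>0 \<le> B\<close>])
      show "norm (poisson_mle K G (Y n \<omega>) i :: real ^ 'd) \<le> G (real n)" "norm (Z n \<omega> i) \<le> G (real n)"
        if "i < n" for i using H[OF \<omega>] that by blast+
    qed
    also have "\<dots> \<le> 32 * B * (136 * (real CARD('d))\<^sup>2 * (a * (G (real n))\<^sup>2 * (real n * sqrt (real n))))"
      by (rule mult_left_mono[OF conjunct2[OF conjunct2[OF H[OF \<omega>]]]]) (use \<open>0 \<le> B\<close> in simp)
    finally show ?thesis by (simp add: mult_ac)
  qed
  show ?case
  proof (intro conjI bexI[OF _ E(1)] E(2) ballI impI)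
    fix \<omega> assume "\<omega> \<in> space (M n) - E" "(MAX i\<in>{..<n}. norm (Z n \<omega> i)) \<le> G (real n)"
    then show "(frob_norm n (\<lambda>i j. sq_dist_matrix (poisson_mle K G (Y n \<omega>) :: nat \<Rightarrow> real ^ 'd) i j
        - sq_dist_matrix (Z n \<omega>) i j))\<^sup>2 \<le>
      4352 * (real CARD('d))\<^sup>2 * (enn2real (beta_sup K G n) * enn2real (alpha_sup K G \<epsilon> n) *
        (G (real n))\<^sup>2 * (real n * sqrt (real n)))"
      by (rule bound[unfolded a_def B_def])
  qed (rule n elim(2) alpha)+
qed

text \<open>
  A rate condition implies that \<open>alpha_sup\<close> is finite unless a vanishing factor absorbs it in the
  \<^typ>\<open>ennreal\<close> product, and that happens only for \<open>G n = 0\<close>.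
\<close>

lemma alpha_sup_finite_if_product_finite:
  assumes diff: "K differentiable_on {0..}" and K0: "0 < K 0"
    and prod: "\<And>n. c n = 0 \<Longrightarrow> G (real n) = 0 \<or> n = 0"
    and lim: "\<forall>\<^sub>F n in sequentially. beta_sup K G n * alpha_sup K G \<epsilon> n * c n < \<infinity>"
  shows "\<forall>\<^sub>F n in sequentially. 0 < G (real n) \<longrightarrow> alpha_sup K G \<epsilon> n < \<infinity>"
  using lim eventually_gt_at_top[of 0]
proof eventually_elim
  case (elim n)
  show ?case
  proof
    assume "0 < G (real n)"
    then have "beta_sup K G n \<noteq> 0" "c n \<noteq> 0"
      using beta_sup_pos[OF diff K0, of G n] prod[of n] elim(2) by auto
    then show "alpha_sup K G \<epsilon> n < \<infinity>"
      using elim(1) by - (rule ccontr, simp add: not_less top_unique ennreal_mult_top ennreal_top_mult)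
  qed
qed

proposition poisson_mle_learns_sq_dists:
  fixes Z :: "nat \<Rightarrow> 'w \<Rightarrow> nat \<Rightarrow> real ^ 'd"
  assumes reg: "regular_lpm S K G \<epsilon> M Z Y" and sparse: "sparse_in_expectation e M Y"
    and rate: "sq_dist_rate K G \<epsilon>"
  shows "learns_sq_dists (poisson_mle K G :: real mat \<Rightarrow> nat \<Rightarrow> real ^ 'd) M Z Y"
proof -
  have lpm: "lpm S K M Z Y" and diff: "K differentiable_on {0..}"
    and W: "(\<lambda>n. measure (M n) {\<omega> \<in> space (M n). (MAX i\<in>{..<n}. norm (Z n \<omega> i)) \<le> G (real n)}) \<longlonglongrightarrow> 1"
    using reg by (auto simp: regular_lpm_def)
  have ps: "prob_space (M n)" for n using lpm by (simp add: lpm_def)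
  have K0: "0 < K 0" by (rule sparse_imp_link_zero_pos[OF reg sparse])
  define \<rho> where "\<rho> = (\<lambda>n. beta_sup K G n * alpha_sup K G \<epsilon> n * ennreal (real n powr (- 0.5) * (G (real n))\<^sup>2))"
  have \<rho>: "\<rho> \<longlonglongrightarrow> 0" and beta: "\<forall>\<^sub>F n in sequentially. beta_sup K G n < \<infinity>"
    using rate unfolding sq_dist_rate_def \<rho>_def by blast+
  have fin: "\<forall>\<^sub>F n in sequentially. 0 < G (real n) \<longrightarrow> alpha_sup K G \<epsilon> n < \<infinity>"
    using eventually_less_infinity[OF \<rho>]
    by (intro alpha_sup_finite_if_product_finite[OF diff K0,
          where c = "\<lambda>n. ennreal (real n powr (- 0.5) * (G (real n))\<^sup>2)"])
      (auto simp: \<rho>_def ennreal_eq_0_iff mult_le_0_iff)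
  show ?thesis
    unfolding learns_sq_dists_def
  proof (rule null_in_probI[OF ps W _ exceptional_prob_tendsto_0])
    show "(\<lambda>n. 4352 * (real CARD('d))\<^sup>2 * enn2real (\<rho> n)) \<longlonglongrightarrow> 0"
      using tendsto_mult[OF tendsto_const tendsto_0_imp_enn2real[OF \<rho>], of "4352 * (real CARD('d))\<^sup>2"] by simp
    show "\<forall>\<^sub>F n in sequentially. \<exists>E\<in>sets (M n). measure (M n) E \<le> 2 * real n * exp (- real n) \<and>
      (\<forall>\<omega>\<in>space (M n) - E. (MAX i\<in>{..<n}. norm (Z n \<omega> i)) \<le> G (real n) \<longrightarrow>
        \<bar>(frob_norm n (\<lambda>i j. sq_dist_matrix (poisson_mle K G (Y n \<omega>) :: nat \<Rightarrow> real ^ 'd) i j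
          - sq_dist_matrix (Z n \<omega>) i j))\<^sup>2 / (real n)\<^sup>2\<bar> \<le> 4352 * (real CARD('d))\<^sup>2 * enn2real (\<rho> n))"
      using eventually_sq_dist_error_bound[OF reg K0 beta fin]
    proof eventually_elim
      case (elim n)
      define a where "a = enn2real (alpha_sup K G \<epsilon> n)"
      define B where "B = enn2real (beta_sup K G n)"
      have ab: "alpha_sup K G \<epsilon> n = ennreal a" "beta_sup K G n = ennreal B" "0 \<le> a" "0 \<le> B"
        using elim by (simp_all add: a_def B_def less_top)
      have powr: "real n powr (- 0.5) = real n * sqrt (real n) / (real n)\<^sup>2"
        using elim by (simp add: powr_minus powr_half_sqrt field_simps power2_eq_square)
      have \<rho>n: "enn2real (\<rho> n) = B * a * (G (real n))\<^sup>2 * (real n * sqrt (real n)) / (real n)\<^sup>2"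
        unfolding \<rho>_def powr ab(1,2) using ab(3,4) by (simp flip: ennreal_mult)
      from elim obtain E where E: "E \<in> sets (M n)" "measure (M n) E \<le> 2 * real n * exp (- real n)"
        and H: "\<And>\<omega>. \<omega> \<in> space (M n) - E \<Longrightarrow> (MAX i\<in>{..<n}. norm (Z n \<omega> i)) \<le> G (real n) \<Longrightarrow>
          (frob_norm n (\<lambda>i j. sq_dist_matrix (poisson_mle K G (Y n \<omega>) :: nat \<Rightarrow> real ^ 'd) i j
            - sq_dist_matrix (Z n \<omega>) i j))\<^sup>2 \<le>
          4352 * (real CARD('d))\<^sup>2 * (B * a * (G (real n))\<^sup>2 * (real n * sqrt (real n)))"
        unfolding a_def B_def by blast
      show ?case
      proof (intro bexI[OF _ E(1)] conjI E(2) ballI impI)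
        fix \<omega> assume \<omega>: "\<omega> \<in> space (M n) - E" "(MAX i\<in>{..<n}. norm (Z n \<omega> i)) \<le> G (real n)"
        let ?F = "(frob_norm n (\<lambda>i j. sq_dist_matrix (poisson_mle K G (Y n \<omega>) :: nat \<Rightarrow> real ^ 'd) i j
            - sq_dist_matrix (Z n \<omega>) i j))\<^sup>2"
        have "?F / (real n)\<^sup>2 \<le> 4352 * (real CARD('d))\<^sup>2 *
            (B * a * (G (real n))\<^sup>2 * (real n * sqrt (real n))) / (real n)\<^sup>2"
          using H[OF \<omega>] by (intro divide_right_mono) auto
        also have "\<dots> = 4352 * (real CARD('d))\<^sup>2 * enn2real (\<rho> n)" by (simp add: \<rho>n)
        finally show "\<bar>?F / (real n)\<^sup>2\<bar> \<le> 4352 * (real CARD('d))\<^sup>2 * enn2real (\<rho> n)"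
          by simp
      qed
    qed
  qed
qed

text \<open>
  The best rotation of the centred configurations, together with the shift that matches the two means, is
  one of the candidates in the infimum.
\<close>

lemma position_loss_bound:
  fixes z zh :: "nat \<Rightarrow> real ^ 'd"
  assumes "0 < n" and len: "length (nonzero_eigs (centered_gram n z)) = CARD('d)"
  defines "loss \<equiv> (INF (R, Q) \<in> {R. orthogonal_matrix R} \<times> {Q. \<forall>i<n. \<forall>j<n. Q i = Q j}.
      (frob_norm_rows n (\<lambda>i. zh i v* R - Q i - z i))\<^sup>2 / real n)"
  obtains \<mu> where "0 < \<mu>" "eig (centered_gram n z) CARD('d) \<le> \<mu>" "0 \<le> loss"
    and "\<mu> * loss \<le> 5 / 16 * (frob_norm n (\<lambda>i j. sq_dist_matrix zh i j - sq_dist_matrix z i j))\<^sup>2 / real n"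
proof -
  define m where "m = (\<Sum>k<n. z k) /\<^sub>R real n"
  define mh where "mh = (\<Sum>k<n. zh k) /\<^sub>R real n"
  define x where "x i = z i - m" for i
  define y where "y i = zh i - mh" for i
  have gram: "centered_gram n z = gram n x"
    using centered_gram_eq_gram[OF \<open>0 < n\<close>, of z] by (simp add: x_def[abs_def] m_def)
  obtain \<mu> where \<mu>: "0 < \<mu>" "eig (gram n x) CARD('d) \<le> \<mu>"
    and low: "\<And>w. \<mu> * (norm w)\<^sup>2 \<le> (\<Sum>j<n. (w \<bullet> x j)\<^sup>2)"
    using gram_smallest_eigenvalue[of n x] len gram by metis
  obtain R :: "real ^ 'd ^ 'd" where R: "orthogonal_matrix R"
    and proc: "4 / 5 * \<mu> * (\<Sum>i<n. (norm (y i v* R - x i))\<^sup>2) \<le> (\<Sum>i<n. \<Sum>j<n. (y i \<bullet> y j - x i \<bullet> x j)\<^sup>2)"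
    by (rule procrustes_bound[where \<mu> = \<mu> and n = n and x = x and y = y, OF low]) blast
  have "4 * (\<Sum>i<n. \<Sum>j<n. (y i \<bullet> y j - x i \<bullet> x j)\<^sup>2) \<le>
      (\<Sum>i<n. \<Sum>j<n. (sq_dist_matrix y i j - sq_dist_matrix x i j)\<^sup>2)"
    using \<open>0 < n\<close> by (intro gram_diff_le_sq_dist_diff)
      (simp_all add: x_def y_def m_def mh_def sum_subtractf sum_constant_scaleR del: sum_constant)
  also have "\<dots> = (frob_norm n (\<lambda>i j. sq_dist_matrix zh i j - sq_dist_matrix z i j))\<^sup>2"
    by (simp add: frob_norm_def sum_nonneg sq_dist_matrix_def x_def y_def)
  finally have gd: "4 * (\<Sum>i<n. \<Sum>j<n. (y i \<bullet> y j - x i \<bullet> x j)\<^sup>2) \<le>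
      (frob_norm n (\<lambda>i j. sq_dist_matrix zh i j - sq_dist_matrix z i j))\<^sup>2" .
  define Q :: "nat \<Rightarrow> real ^ 'd" where "Q = (\<lambda>_. mh v* R - m)"
  have loss0: "0 \<le> loss"
    unfolding loss_def using R by (intro cINF_greatest) auto
  have "loss \<le> (frob_norm_rows n (\<lambda>i. zh i v* R - Q i - z i))\<^sup>2 / real n"
    unfolding loss_def
  proof (rule cINF_lower2[where x = "(R, Q)"])
    show "bdd_below ((\<lambda>(R, Q). (frob_norm_rows n (\<lambda>i. zh i v* R - Q i - z i))\<^sup>2 / real n) `
        ({R. orthogonal_matrix R} \<times> {Q. \<forall>i<n. \<forall>j<n. Q i = Q j}))"
      by (intro bdd_belowI[of _ 0]) auto
  qed (use R in \<open>auto simp: Q_def\<close>)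
  also have "\<dots> = (\<Sum>i<n. (norm (y i v* R - x i))\<^sup>2) / real n"
    by (simp add: frob_norm_rows_def sum_nonneg Q_def x_def y_def vector_matrix_mult_diff_distrib algebra_simps)
  finally have "\<mu> * loss \<le> \<mu> * ((\<Sum>i<n. (norm (y i v* R - x i))\<^sup>2) / real n)"
    using \<mu> by (intro mult_left_mono) auto
  also have "\<dots> = (\<mu> * (\<Sum>i<n. (norm (y i v* R - x i))\<^sup>2)) / real n" by simp
  also have "\<dots> \<le> (5 / 16 * (frob_norm n (\<lambda>i j. sq_dist_matrix zh i j - sq_dist_matrix z i j))\<^sup>2) / real n"
    using proc gd by (intro divide_right_mono) auto
  finally show ?thesis using that \<mu> loss0 gram by simp
qed

lemma distinctly_bunched_smallest_eigenvalue:
  fixes Z :: "nat \<Rightarrow> 'w \<Rightarrow> nat \<Rightarrow> real ^ 'd"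
  assumes "distinctly_bunched a b M Z" "CARD('d) < n"
  shows "AE \<omega> in M n. length (nonzero_eigs (centered_gram n (Z n \<omega>))) = CARD('d) \<and>
    b n \<le> eig (centered_gram n (Z n \<omega>)) CARD('d)"
proof -
  obtain k i where k: "k \<in> {1..CARD('d)}" and i: "i 1 = 1" "i (k + 1) = CARD('d) + 1" "strict_mono_on {1..k + 1} i"
    and AE: "AE \<omega> in M n. let lam = eig (centered_gram n (Z n \<omega>)) in
      length (nonzero_eigs (centered_gram n (Z n \<omega>))) = CARD('d) \<and>
      (\<forall>j\<in>{1..k}. (lam (i (j + 1) - 1) - lam (i j))\<^sup>2 / lam (i (j + 1) - 1) \<le> a n \<and>
        (lam (i (j + 1) - 1) - lam (i (j + 1)))\<^sup>2 / lam (i j) \<ge> b n)"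
    using assms unfolding distinctly_bunched_def by blast
  have "i k < i (k + 1)" using k by (intro strict_mono_onD[OF i(3)]) auto
  moreover have "i 1 \<le> i k"
    using k by (cases "k = 1") (auto intro!: less_imp_le strict_mono_onD[OF i(3)])
  ultimately have ik: "1 \<le> i k" "i k \<le> CARD('d)" using i by auto
  have "0 < n" using assms(2) by simp
  from AE show ?thesis
  proof eventually_elim
    case (elim \<omega>)
    let ?lam = "eig (centered_gram n (Z n \<omega>))"
    have len: "length (nonzero_eigs (centered_gram n (Z n \<omega>))) = CARD('d)"
      using elim unfolding Let_def by (rule conjunct1)
    have "b n \<le> (?lam (i (k + 1) - 1) - ?lam (i (k + 1)))\<^sup>2 / ?lam (i k)"
      using elim k unfolding Let_def by auto
    then have gap: "b n \<le> (?lam CARD('d) - ?lam (CARD('d) + 1))\<^sup>2 / ?lam (i k)"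
      by (simp only: i(2) add_diff_cancel_right')
    show ?case
      using bunching_bound_le_smallest_eigenvalue[OF len[unfolded centered_gram_eq_gram[OF \<open>0 < n\<close>]] ik
          gap[unfolded centered_gram_eq_gram[OF \<open>0 < n\<close>]]] len
      by (simp add: centered_gram_eq_gram[OF \<open>0 < n\<close>])
  qed
qed

text \<open>
  For \<open>b \<le> 0\<close> the quotient in \<^typ>\<open>ennreal\<close> is infinite unless \<open>v = 0\<close>, in which case \<open>l\<close> vanishes
  because \<open>\<mu>\<close> is positive.
\<close>

lemma le_enn2real_quotient:
  assumes "0 \<le> l" "0 < \<mu>" "b \<le> \<mu>" "\<mu> * l \<le> C * v" "0 \<le> v"
    and fin: "ennreal v / ennreal b < \<infinity>"
  shows "l \<le> C * enn2real (ennreal v / ennreal b)"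
proof (cases "0 < b")
  case True
  have "b * l \<le> \<mu> * l" using assms by (intro mult_right_mono) auto
  then have "b * l \<le> C * v" using assms by linarith
  then show ?thesis using True \<open>0 \<le> v\<close> by (simp add: divide_ennreal field_simps)
next
  case False
  then have "v = 0"
    using fin \<open>0 \<le> v\<close> by (cases "v = 0") (auto simp: ennreal_neg ennreal_divide_eq_top_iff less_top)
  then have "\<mu> * l \<le> 0" using assms by simp
  then have "l \<le> 0" using \<open>0 < \<mu>\<close> by (simp add: mult_le_0_iff)
  then show ?thesis using \<open>v = 0\<close> by simp
qed

proposition poisson_mle_learns_positions:
  fixes Z :: "nat \<Rightarrow> 'w \<Rightarrow> nat \<Rightarrow> real ^ 'd"
  assumes reg: "regular_lpm S K G \<epsilon> M Z Y" and sparse: "sparse_in_expectation e M Y"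
    and bunched: "distinctly_bunched a b M Z" and rate: "position_rate K G \<epsilon> a b"
  shows "learns_positions (poisson_mle K G :: real mat \<Rightarrow> nat \<Rightarrow> real ^ 'd) M Z Y"
proof -
  have lpm: "lpm S K M Z Y" and diff: "K differentiable_on {0..}"
    and W: "(\<lambda>n. measure (M n) {\<omega> \<in> space (M n). (MAX i\<in>{..<n}. norm (Z n \<omega> i)) \<le> G (real n)}) \<longlonglongrightarrow> 1"
    using reg by (auto simp: regular_lpm_def)
  have ps: "prob_space (M n)" for n using lpm by (simp add: lpm_def)
  have K0: "0 < K 0" by (rule sparse_imp_link_zero_pos[OF reg sparse])
  define \<rho> where "\<rho> = (\<lambda>n. beta_sup K G n * alpha_sup K G \<epsilon> n * ennreal (real n powr 0.5 * (G (real n))\<^sup>2)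
      / ennreal (b n))"
  have \<rho>: "\<rho> \<longlonglongrightarrow> 0" and beta: "\<forall>\<^sub>F n in sequentially. beta_sup K G n < \<infinity>"
    using rate unfolding position_rate_def \<rho>_def by blast+
  have fin_\<rho>: "\<forall>\<^sub>F n in sequentially. \<rho> n < \<infinity>" by (rule eventually_less_infinity[OF \<rho>])
  have fin: "\<forall>\<^sub>F n in sequentially. 0 < G (real n) \<longrightarrow> alpha_sup K G \<epsilon> n < \<infinity>"
  proof (rule alpha_sup_finite_if_product_finite[OF diff K0,
        where c = "\<lambda>n. ennreal (real n powr 0.5 * (G (real n))\<^sup>2)"])
    show "\<forall>\<^sub>F n in sequentially. beta_sup K G n * alpha_sup K G \<epsilon> n * ennreal (real n powr 0.5 * (G (real n))\<^sup>2) < \<infinity>"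
      using fin_\<rho>
    proof eventually_elim
      case (elim n)
      show ?case
        by (rule ccontr) (use elim in \<open>simp add: \<rho>_def not_less top_unique divide_ennreal_def ennreal_top_mult\<close>)
    qed
  qed (auto simp: ennreal_eq_0_iff mult_le_0_iff)
  show ?thesis
    unfolding learns_positions_def
  proof (rule null_in_probI[OF ps W _ exceptional_prob_tendsto_0])
    show "(\<lambda>n. 1360 * (real CARD('d))\<^sup>2 * enn2real (\<rho> n)) \<longlonglongrightarrow> 0"
      using tendsto_mult[OF tendsto_const tendsto_0_imp_enn2real[OF \<rho>], of "1360 * (real CARD('d))\<^sup>2"] by simp
    show "\<forall>\<^sub>F n in sequentially. \<exists>E\<in>sets (M n). measure (M n) E \<le> 2 * real n * exp (- real n) \<and>
      (\<forall>\<omega>\<in>space (M n) - E. (MAX i\<in>{..<n}. norm (Z n \<omega> i)) \<le> G (real n) \<longrightarrow>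
        \<bar>INF (R, Q) \<in> {R. orthogonal_matrix R} \<times> {Q. \<forall>i<n. \<forall>j<n. Q i = Q j}.
          (frob_norm_rows n (\<lambda>i. (poisson_mle K G (Y n \<omega>) i :: real ^ 'd) v* R - Q i - Z n \<omega> i))\<^sup>2 / real n\<bar>
        \<le> 1360 * (real CARD('d))\<^sup>2 * enn2real (\<rho> n))"
      using eventually_sq_dist_error_bound[OF reg K0 beta fin] fin_\<rho> eventually_gt_at_top[of "CARD('d)"]
    proof eventually_elim
      case (elim n)
      interpret prob_space "M n" by (rule ps)
      define \<alpha> where "\<alpha> = enn2real (alpha_sup K G \<epsilon> n)"
      define B where "B = enn2real (beta_sup K G n)"
      define v where "v = B * \<alpha> * (G (real n))\<^sup>2 * sqrt (real n)"
      have ab: "alpha_sup K G \<epsilon> n = ennreal \<alpha>" "beta_sup K G n = ennreal B" "0 \<le> \<alpha>" "0 \<le> B"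
        using elim by (simp_all add: \<alpha>_def B_def less_top)
      have v: "0 \<le> v" using ab by (simp add: v_def)
      have \<rho>n: "\<rho> n = ennreal v / ennreal (b n)"
        unfolding \<rho>_def v_def ab(1,2) using ab(3,4)
        by (simp add: powr_half_sqrt mult_ac flip: ennreal_mult)
      from elim obtain E where E: "E \<in> events" "prob E \<le> 2 * real n * exp (- real n)"
        and H: "\<And>\<omega>. \<omega> \<in> space (M n) - E \<Longrightarrow> (MAX i\<in>{..<n}. norm (Z n \<omega> i)) \<le> G (real n) \<Longrightarrow>
          (frob_norm n (\<lambda>i j. sq_dist_matrix (poisson_mle K G (Y n \<omega>) :: nat \<Rightarrow> real ^ 'd) i j
            - sq_dist_matrix (Z n \<omega>) i j))\<^sup>2 \<le>
          4352 * (real CARD('d))\<^sup>2 * (B * \<alpha> * (G (real n))\<^sup>2 * (real n * sqrt (real n)))"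
        unfolding \<alpha>_def B_def by blast
      obtain N where N: "{\<omega> \<in> space (M n). \<not> (length (nonzero_eigs (centered_gram n (Z n \<omega>))) = CARD('d) \<and>
          b n \<le> eig (centered_gram n (Z n \<omega>)) CARD('d))} \<subseteq> N" "emeasure (M n) N = 0" "N \<in> events"
        by (rule AE_E[OF distinctly_bunched_smallest_eigenvalue[OF bunched elim(3)]])
      have "prob (E \<union> N) \<le> prob E + prob N" using E N by (intro measure_Un_le) auto
      also have "prob N = 0" using N(2) by (simp add: measure_def)
      finally have EN: "prob (E \<union> N) \<le> 2 * real n * exp (- real n)" using E by simp
      show ?case
      proof (intro bexI[of _ "E \<union> N"] conjI EN ballI impI sets.Un E(1) N(3))
        fix \<omega> assume \<omega>: "\<omega> \<in> space (M n) - (E \<union> N)" "(MAX i\<in>{..<n}. norm (Z n \<omega> i)) \<le> G (real n)"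
        let ?loss = "INF (R, Q) \<in> {R. orthogonal_matrix R} \<times> {Q. \<forall>i<n. \<forall>j<n. Q i = Q j}.
          (frob_norm_rows n (\<lambda>i. (poisson_mle K G (Y n \<omega>) i :: real ^ 'd) v* R - Q i - Z n \<omega> i))\<^sup>2 / real n"
        have len: "length (nonzero_eigs (centered_gram n (Z n \<omega>))) = CARD('d)"
          and bn: "b n \<le> eig (centered_gram n (Z n \<omega>)) CARD('d)"
          using \<omega>(1) N(1) by blast+
        have "0 < n" using elim by simp
        obtain \<mu> where \<mu>: "0 < \<mu>" "eig (centered_gram n (Z n \<omega>)) CARD('d) \<le> \<mu>" "0 \<le> ?loss"
          and loss: "\<mu> * ?loss \<le> 5 / 16 * (frob_norm n (\<lambda>i j.
            sq_dist_matrix (poisson_mle K G (Y n \<omega>) :: nat \<Rightarrow> real ^ 'd) i j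
              - sq_dist_matrix (Z n \<omega>) i j))\<^sup>2 / real n"
          by (rule position_loss_bound[where zh = "poisson_mle K G (Y n \<omega>)", OF \<open>0 < n\<close> len])
        have "\<mu> * ?loss \<le> 5 / 16 * (4352 * (real CARD('d))\<^sup>2 *
            (B * \<alpha> * (G (real n))\<^sup>2 * (real n * sqrt (real n)))) / real n"
          using H[of \<omega>] \<omega> by (intro order.trans[OF loss] divide_right_mono mult_left_mono) auto
        also have "\<dots> = 1360 * (real CARD('d))\<^sup>2 * v"
          using \<open>0 < n\<close> by (simp add: v_def)
        finally have key: "\<mu> * ?loss \<le> 1360 * (real CARD('d))\<^sup>2 * v" .
        have "?loss \<le> 1360 * (real CARD('d))\<^sup>2 * enn2real (\<rho> n)"
          unfolding \<rho>n
          by (rule le_enn2real_quotient[OF \<mu>(3,1) order.trans[OF bn \<mu>(2)] key v elim(2)[unfolded \<rho>n]])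
        then show "\<bar>?loss\<bar> \<le> 1360 * (real CARD('d))\<^sup>2 * enn2real (\<rho> n)" using \<mu>(3) by simp
      qed
    qed
  qed
qed

theorem theorem3:
  fixes K G :: "real \<Rightarrow> real"
  shows
    "(\<exists>Zhat :: real mat \<Rightarrow> nat \<Rightarrow> real ^ 'd.
        \<forall>(S :: (real ^ 'd) set) \<epsilon> e (M :: nat \<Rightarrow> 'w measure) Z Y.
          regular_lpm S K G \<epsilon> M Z Y \<and> sparse_in_expectation e M Y \<and>
          link_prob_rate K G \<epsilon> e
          \<longrightarrow> learns_link_probs Zhat K e M Z Y) \<and>
     (\<exists>Zhat :: real mat \<Rightarrow> nat \<Rightarrow> real ^ 'd.
        \<forall>(S :: (real ^ 'd) set) \<epsilon> e (M :: nat \<Rightarrow> 'w measure) Z Y.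
          regular_lpm S K G \<epsilon> M Z Y \<and> sparse_in_expectation e M Y \<and>
          sq_dist_rate K G \<epsilon>
          \<longrightarrow> learns_sq_dists Zhat M Z Y) \<and>
     (\<exists>Zhat :: real mat \<Rightarrow> nat \<Rightarrow> real ^ 'd.
        \<forall>(S :: (real ^ 'd) set) \<epsilon> e (M :: nat \<Rightarrow> 'w measure) Z Y a b.
          regular_lpm S K G \<epsilon> M Z Y \<and> sparse_in_expectation e M Y \<and>
          distinctly_bunched a b M Z \<and> position_rate K G \<epsilon> a b
          \<longrightarrow> learns_positions Zhat M Z Y)"
  by (intro conjI exI[of _ "poisson_mle K G"] allI impI; elim conjE)
    (rule poisson_mle_learns_link_probs poisson_mle_learns_sq_dists poisson_mle_learns_positions; assumption)+

end
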